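(* (1) Let $d\geq 3$, $0<c<\lambda(d)$ and $Q\in\mathcal G$. Then the standing wave $e^{it}Q(x)$ is unstable in the following sense: there exists a sequence $(u_{0,n})_{n\geq 1}\subset H^1$ with $u_{0,n}\to Q$ strongly in $H^1$ as $n\to\infty$ such that, for every $n\geq 1$, the corresponding solution $u_n$ of the $L^2$-critical equation with initial data $u_{0,n}$ blows up in finite time. (2) Let $d\geq 3$, $c<0$ and $Q_{\mathrm{rad}}\in\mathcal G_{\mathrm{rad}}$. Then the radial standing wave $e^{it}Q_{\mathrm{rad}}(x)$ is unstable in the same sense: there exists $(u_{0,n})_{n\geq1}\subset H^1$ with $u_{0,n}\to Q_{\mathrm{rad}}$ strongly in $H^1$ such that for every $n\geq 1$ the corresponding solution $u_n$ with initial data $u_{0,n}$ blows up in finite time.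
   Context: Let $\lambda(d)=\left(\frac{d-2}{2}\right)^2$ and $c\neq 0$, $c<\lambda(d)$. The $L^2$-critical equation is $i\partial_t u+\Delta u+c|x|^{-2}u=-|u|^{4/d}u$ on $\mathbb R^+\times\mathbb R^d$, $u(0)=u_0\in H^1$, where $-\Delta-c|x|^{-2}$ is a self-adjoint extension (e.g. Friedrichs) of its action on $C_0^\infty(\mathbb R^d\setminus\{0\})$. For each $u_0\in H^1$ there is a unique maximal solution $u\in C([0,T),H^1)$; it blows up in finite time if $T<\infty$, in which case $\|\nabla u(t)\|_{L^2}\to\infty$ as $t\uparrow T$. Let $\|u\|_{\dot H^1_c}^2=\int|\nabla u|^2-c|x|^{-2}|u|^2dx$ and define the Weinstein functional $J_c(u)=\dfrac{\|u\|_{L^{4/d+2}}^{4/d+2}}{\|u\|_{L^2}^{4/d}\|u\|_{\dot H^1_c}^{2}}$ for $u\in H^1\setminus\{0\}$. For $0<c<\lambda(d)$, $\mathcal G$ (the set of ground states) is the set of maximizers of $J_c$ over $H^1\setminus\{0\}$ which are positive radial solutions of $-\Delta Q-c|x|^{-2}Q+Q=|Q|^{4/d}Q$. For $c<0$, $\mathcal G_{\mathrm{rad}}$ (the set of radial ground states) is the set of maximizers of $J_c$ over $H^1_{\mathrm{rad}}\setminus\{0\}$ which are positive radial solutions of $-\Delta Q_{\mathrm{rad}}-c|x|^{-2}Q_{\mathrm{rad}}+Q_{\mathrm{rad}}=|Q_{\mathrm{rad}}|^{4/d}Q_{\mathrm{rad}}$. *)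

theory Defs
  imports "HOL-Analysis.Analysis"
begin

text \<open>Functions on R^d are modelled as maps from a Euclidean space 'a (d = DIM('a))
to complex numbers; Lebesgue measure is used throughout.\<close>

definition lam :: "nat \<Rightarrow> real" where
  "lam d = ((real d - 2) / 2)^2"

fun Ck :: "nat \<Rightarrow> ('a::real_normed_vector \<Rightarrow> 'b::real_normed_vector) \<Rightarrow> bool" where
  "Ck 0 f = continuous_on UNIV f"
| "Ck (Suc k) f = ((\<forall>x. f differentiable (at x)) \<and>
                   (\<forall>v. Ck k (\<lambda>x. frechet_derivative f (at x) v)))"

definition smooth_fun :: "('a::real_normed_vector \<Rightarrow> 'b::real_normed_vector) \<Rightarrow> bool" where
  "smooth_fun f \<longleftrightarrow> (\<forall>k. Ck k f)"

definition pd :: "'a::real_normed_vector \<Rightarrow> ('a \<Rightarrow> 'b::real_normed_vector) \<Rightarrow> 'a \<Rightarrow> 'b" where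
  "pd v f x = frechet_derivative f (at x) v"

definition lap :: "('a::euclidean_space \<Rightarrow> complex) \<Rightarrow> 'a \<Rightarrow> complex" where
  "lap f x = (\<Sum>b\<in>Basis. pd b (pd b f) x)"

definition test_fun :: "('a::euclidean_space \<Rightarrow> complex) \<Rightarrow> bool" where
  "test_fun w \<longleftrightarrow> smooth_fun w \<and> compact (closure {x. w x \<noteq> 0})"

definition test_fun_punct :: "('a::euclidean_space \<Rightarrow> complex) \<Rightarrow> bool" where
  "test_fun_punct w \<longleftrightarrow> test_fun w \<and> 0 \<notin> closure {x. w x \<noteq> 0}"

definition L2 :: "('a::euclidean_space \<Rightarrow> complex) set" where
  "L2 = {f. f \<in> borel_measurable lebesgue \<and> integrable lebesgue (\<lambda>x. (norm (f x))^2)}"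

definition L2norm2 :: "('a::euclidean_space \<Rightarrow> complex) \<Rightarrow> real" where
  "L2norm2 f = (LINT x|lebesgue. (norm (f x))^2)"

definition weak_partial :: "('a::euclidean_space \<Rightarrow> complex) \<Rightarrow> 'a \<Rightarrow> ('a \<Rightarrow> complex) \<Rightarrow> bool" where
  "weak_partial f b g \<longleftrightarrow>
     (\<forall>\<psi>. test_fun \<psi> \<longrightarrow>
        (LINT x|lebesgue. f x * pd b \<psi> x) = - (LINT x|lebesgue. g x * \<psi> x))"

definition H1 :: "('a::euclidean_space \<Rightarrow> complex) set" where
  "H1 = {f. f \<in> L2 \<and> (\<forall>b\<in>Basis. \<exists>g\<in>L2. weak_partial f b g)}"

definition wgrad :: "('a::euclidean_space \<Rightarrow> complex) \<Rightarrow> 'a \<Rightarrow> 'a \<Rightarrow> complex" where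
  "wgrad f b = (SOME g. g \<in> L2 \<and> weak_partial f b g)"

definition grad_norm2 :: "('a::euclidean_space \<Rightarrow> complex) \<Rightarrow> real" where
  "grad_norm2 f = (\<Sum>b\<in>Basis. LINT x|lebesgue. (norm (wgrad f b x))^2)"

definition H1_dist :: "('a::euclidean_space \<Rightarrow> complex) \<Rightarrow> ('a \<Rightarrow> complex) \<Rightarrow> real" where
  "H1_dist f g = sqrt (L2norm2 (\<lambda>x. f x - g x) + grad_norm2 (\<lambda>x. f x - g x))"

definition Hc_norm2 :: "real \<Rightarrow> ('a::euclidean_space \<Rightarrow> complex) \<Rightarrow> real" where
  "Hc_norm2 c f = grad_norm2 f - c * (LINT x|lebesgue. (norm (f x))^2 / (norm x)^2)"

definition Lp_pow :: "real \<Rightarrow> ('a::euclidean_space \<Rightarrow> complex) \<Rightarrow> real" where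
  "Lp_pow p f = (LINT x|lebesgue. norm (f x) powr p)"

definition J :: "real \<Rightarrow> ('a::euclidean_space \<Rightarrow> complex) \<Rightarrow> real" where
  "J c f = (let d = real DIM('a) in
     Lp_pow (4/d + 2) f / (sqrt (L2norm2 f) powr (4/d) * Hc_norm2 c f))"

definition nonzero :: "('a::euclidean_space \<Rightarrow> complex) \<Rightarrow> bool" where
  "nonzero f \<longleftrightarrow> \<not> (AE x in lebesgue. f x = 0)"

definition radial :: "('a::euclidean_space \<Rightarrow> complex) \<Rightarrow> bool" where
  "radial f \<longleftrightarrow> (\<exists>g. (\<forall>x y. norm x = norm y \<longrightarrow> g x = g y) \<and> (AE x in lebesgue. f x = g x))"

definition positive_fun :: "('a::euclidean_space \<Rightarrow> complex) \<Rightarrow> bool" where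
  "positive_fun f \<longleftrightarrow> (AE x in lebesgue. Im (f x) = 0 \<and> Re (f x) > 0)"

text \<open>Weak (H^1) solution of -Delta Q - c|x|^-2 Q + Q = |Q|^{4/d} Q, tested against
C_c^infinity(R^d minus 0).\<close>
definition elliptic_sol :: "real \<Rightarrow> ('a::euclidean_space \<Rightarrow> complex) \<Rightarrow> bool" where
  "elliptic_sol c Q \<longleftrightarrow> Q \<in> H1 \<and>
     (\<forall>w::'a\<Rightarrow>complex. test_fun_punct w \<longrightarrow>
        - (LINT x|lebesgue. Q x * lap w x)
        - of_real c * (LINT x|lebesgue. Q x * w x / of_real ((norm x)^2))
        + (LINT x|lebesgue. Q x * w x)
        = (LINT x|lebesgue. of_real (norm (Q x) powr (4 / real DIM('a))) * Q x * w x))"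

definition ground_states :: "real \<Rightarrow> ('a::euclidean_space \<Rightarrow> complex) set" where
  "ground_states c = {Q. Q \<in> H1 \<and> nonzero Q \<and>
      (\<forall>f::'a\<Rightarrow>complex\<in>H1. nonzero f \<longrightarrow> J c f \<le> J c Q) \<and>
      positive_fun Q \<and> radial Q \<and> elliptic_sol c Q}"

definition rad_ground_states :: "real \<Rightarrow> ('a::euclidean_space \<Rightarrow> complex) set" where
  "rad_ground_states c = {Q. Q \<in> H1 \<and> nonzero Q \<and> radial Q \<and>
      (\<forall>f::'a\<Rightarrow>complex\<in>H1. radial f \<longrightarrow> nonzero f \<longrightarrow> J c f \<le> J c Q) \<and>
      positive_fun Q \<and> elliptic_sol c Q}"

text \<open>u is a solution on [0,T) of i u_t + Delta u + c|x|^-2 u = -|u|^{4/d} u with u(0) = u0: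
u in C([0,T),H^1), and the equation holds in the weak sense: for every test function chi
in C_c^infinity(R^d minus 0), t -> <u(t),chi> is differentiable on (0,T) with
i d/dt <u,chi> + <u, Delta chi> + c <|x|^-2 u, chi> + <|u|^{4/d} u, chi> = 0.\<close>
definition nls_solution :: "real \<Rightarrow> real \<Rightarrow> ('a::euclidean_space \<Rightarrow> complex) \<Rightarrow> (real \<Rightarrow> 'a \<Rightarrow> complex) \<Rightarrow> bool" where
  "nls_solution c T u0 u \<longleftrightarrow> 0 < T \<and>
     (\<forall>t\<in>{0..<T}. u t \<in> H1) \<and>
     (\<forall>t0\<in>{0..<T}. ((\<lambda>t. H1_dist (u t) (u t0)) \<longlongrightarrow> 0) (at t0 within {0..<T})) \<and>
     (AE x in lebesgue. u 0 x = u0 x) \<and>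
     (\<forall>w::'a\<Rightarrow>complex. test_fun_punct w \<longrightarrow> (\<forall>t\<in>{0<..<T}. \<exists>D::complex.
        ((\<lambda>s::real. LINT x|lebesgue. u s x * w x) has_vector_derivative D) (at t) \<and>
        \<i> * D + (LINT x|lebesgue. u t x * lap w x)
        + of_real c * (LINT x|lebesgue. u t x * w x / of_real ((norm x)^2))
        + (LINT x|lebesgue. of_real (norm (u t x) powr (4 / real DIM('a))) * u t x * w x) = 0))"

text \<open>Finite-time blow-up: the (unique maximal) solution exists on some [0,T), T finite,
and ||grad u(t)||_{L^2} tends to infinity as t tends to T from the left.\<close>
definition blows_up :: "real \<Rightarrow> ('a::euclidean_space \<Rightarrow> complex) \<Rightarrow> bool" where
  "blows_up c u0 \<longleftrightarrow> (\<exists>T u. nls_solution c T u0 u \<and>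
      filterlim (\<lambda>t. grad_norm2 (u t)) at_top (at_left T))"

end

theory Submission
  imports Defs
begin

text \<open>
  The equation is invariant under the pseudo-conformal transformation, so the standing wave of a
  profile \<open>Q\<close> produces for every \<open>T > 0\<close> the explicit solution
  \<open>u(t,x) = l^(-d/2) exp(i t/l) exp(-i |x|^2 / (4 T l)) Q(x/l)\<close> with \<open>l = 1 - t/T\<close>, whose gradient
  blows up at time \<open>T\<close>. Its initial datum \<open>exp(-i |x|^2 / (4 T)) Q\<close> tends to \<open>Q\<close> in \<open>H1\<close> as \<open>T\<close> tends
  to infinity, provided that \<open>|x| Q\<close> is square integrable.

  This moment bound is the analytic part. Being radial with square integrable gradient, \<open>Q\<close> tends to
  0 at infinity, since in dimension at least 3 the differences of its shell averages are controlled by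
  the gradient. Hence far out the equation reads \<open>Q/2 - Laplace Q \<le> 0\<close> weakly, and testing with
  smoothly truncated powers of \<open>|x|\<close> improves the integrability of \<open>Q\<close> by two powers at a time,
  starting from \<open>|x|^(-d) Q\<close>, which is integrable because \<open>Q\<close> is square integrable.
\<close>

subsection \<open>Calculus of smooth functions\<close>

text \<open>Radial objects are written in s = |x|^2 (\<open>sq\<close>), which is smooth at the
  origin too, so that W(|x|^2) is smooth with W; an exponent p in s means |x|^(2p). The equation is
  tested only against smooth functions supported away from 0, so Q itself cannot serve as a test
  function. All estimates are therefore linear in Q: shell integrals and moments of the first power.
  Positivity makes these genuine bounds, radiality turns shell integrals into pointwise ones, and
  smallness of Q far out converts a moment of Q into one of Q^2. In the decay argument the potential
  matters only where |c|/|x|^2 is at most 1/4, so both signs of c are treated at once. The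
  transformation respects the equation because c/|x|^2 and |u|^(4/d) scale like the Laplacian, while
  the quadratic phase cancels the drift caused by the moving dilation. Since Q is only weakly
  differentiable, the wave is transposed: pairing it with a test function equals pairing Q with a
  time dependent test function, on which all derivatives fall.\<close>

abbreviation sq :: "'a::real_inner \<Rightarrow> real" where
  "sq x \<equiv> x \<bullet> x"

lemma pd_eq: "(f has_derivative f') (at x) \<Longrightarrow> pd v f x = f' v"
  unfolding pd_def using frechet_derivative_at by metis

lemma CkI:
  assumes "\<And>x. (f has_derivative f' x) (at x)" "\<And>v. Ck k (\<lambda>x. f' x v)"
  shows "Ck (Suc k) f"
proof -
  have "frechet_derivative f (at x) v = f' x v" for x v
    using frechet_derivative_at[OF assms(1)] by metis
  then show ?thesis
    using assms by (auto simp: differentiable_def)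
qed

lemma Ck_Suc_has_derivative:
  "Ck (Suc k) f \<Longrightarrow> (f has_derivative frechet_derivative f (at x)) (at x)"
  by (simp add: frechet_derivative_works)

lemma Ck_frechet_derivative: "Ck (Suc k) f \<Longrightarrow> Ck k (\<lambda>x. frechet_derivative f (at x) v)"
  by simp

lemma Ck_SucD: "Ck (Suc k) f \<Longrightarrow> Ck k f"
proof (induction k arbitrary: f)
  case 0
  then show ?case
    by (auto simp: continuous_on_eq_continuous_at intro!: differentiable_imp_continuous_within)
next
  case (Suc k)
  from Suc.prems have "\<forall>x. f differentiable (at x)"
    "\<forall>v. Ck (Suc k) (\<lambda>x. frechet_derivative f (at x) v)"
    using Ck.simps(2) by blast+
  with Suc.IH show ?case by auto
qed

lemma Ck_const: "Ck k (\<lambda>x. c)"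
proof (induction k arbitrary: c)
  case (Suc k)
  show ?case by (rule CkI[OF has_derivative_const]) (rule Suc)
qed simp

lemma Ck_bounded_linear:
  assumes "bounded_linear h" shows "Ck k h"
proof (cases k)
  case 0
  then show ?thesis by (simp add: linear_continuous_on assms)
next
  case (Suc m)
  show ?thesis unfolding Suc
    by (rule CkI[OF bounded_linear_imp_has_derivative[OF assms]]) (rule Ck_const)
qed

lemma Ck_add: "Ck k f \<Longrightarrow> Ck k g \<Longrightarrow> Ck k (\<lambda>x. f x + g x)"
proof (induction k arbitrary: f g)
  case (Suc k)
  show ?case
    by (rule CkI[OF has_derivative_add[OF Ck_Suc_has_derivative[OF Suc.prems(1)] Ck_Suc_has_derivative[OF Suc.prems(2)]]])
      (intro Suc.IH Ck_frechet_derivative Suc.prems)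
qed (simp add: continuous_on_add)

lemma Ck_bounded_bilinear:
  assumes "bounded_bilinear h"
  shows "Ck k f \<Longrightarrow> Ck k g \<Longrightarrow> Ck k (\<lambda>x. h (f x) (g x))"
proof (induction k arbitrary: f g)
  case 0
  then show ?case by (simp add: bounded_bilinear.continuous_on[OF assms])
next
  case (Suc k)
  show ?case
    by (rule CkI[OF bounded_bilinear.FDERIV[OF assms Ck_Suc_has_derivative[OF Suc.prems(1)] Ck_Suc_has_derivative[OF Suc.prems(2)]]])
      (intro Suc.IH Ck_frechet_derivative Suc.prems Ck_add Ck_SucD[OF Suc.prems(1)] Ck_SucD[OF Suc.prems(2)])
qed

lemma Ck_compose_bounded_linear:
  assumes "bounded_linear h"
  shows "Ck k f \<Longrightarrow> Ck k (\<lambda>x. f (h x))"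
proof (induction k arbitrary: f)
  case 0
  then show ?case
    using continuous_on_compose2[of UNIV f UNIV h] linear_continuous_on[OF assms] by simp
next
  case (Suc k)
  have "Ck k (\<lambda>x. frechet_derivative f (at (h x)) (h v))" for v
    using Suc.IH[OF Ck_frechet_derivative[OF Suc.prems]] .
  then show ?case
    by (intro CkI[OF has_derivative_compose[OF bounded_linear_imp_has_derivative[OF assms] Ck_Suc_has_derivative[OF Suc.prems]]])
qed

text \<open>For a real inner function the chain rule is a product, the scalar derivative of
  \<open>f\<close> times the derivative of \<open>g\<close> at \<open>f x\<close>, so the bilinear
  lemma closes the induction over the order.\<close>

lemma Ck_compose_real:
  fixes f :: "'a::real_normed_vector \<Rightarrow> real" and g :: "real \<Rightarrow> 'b::real_normed_vector"
  shows "Ck k g \<Longrightarrow> Ck k f \<Longrightarrow> Ck k (\<lambda>x. g (f x))"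
proof (induction k arbitrary: g)
  case 0
  then show ?case using continuous_on_compose2[of UNIV g UNIV f] by simp
next
  case (Suc k)
  have g: "(g has_derivative frechet_derivative g (at s)) (at s)" for s
    by (rule Ck_Suc_has_derivative[OF Suc.prems(1)])
  have lin: "frechet_derivative g (at s) r = r *\<^sub>R frechet_derivative g (at s) 1" for s r
    using linear_scale[OF has_derivative_linear[OF g[of s]], of r 1] by simp
  have "Ck k (\<lambda>x. frechet_derivative f (at x) v *\<^sub>R frechet_derivative g (at (f x)) 1)" for v
    by (intro Ck_bounded_bilinear[OF bounded_bilinear_scaleR] Ck_frechet_derivative Suc.IH Ck_SucD[OF Suc.prems(2)] Suc.prems)
  then show ?case
    by (intro CkI[OF has_derivative_compose[OF Ck_Suc_has_derivative[OF Suc.prems(2)] g]])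
      (subst lin, simp)
qed

lemma Ck_real_derivativeI:
  fixes f :: "real \<Rightarrow> 'b::real_normed_vector"
  assumes "\<And>s. (f has_vector_derivative f' s) (at s)" "Ck k f'"
  shows "Ck (Suc k) f"
  by (rule CkI[OF assms(1)[unfolded has_vector_derivative_def]])
    (intro Ck_bounded_bilinear[OF bounded_bilinear_scaleR] Ck_const assms)

lemma smooth_const: "smooth_fun (\<lambda>x. c)"
  and smooth_bounded_linear: "bounded_linear h \<Longrightarrow> smooth_fun h"
  by (auto simp: smooth_fun_def Ck_const Ck_bounded_linear)

lemma smooth_add: "smooth_fun f \<Longrightarrow> smooth_fun g \<Longrightarrow> smooth_fun (\<lambda>x. f x + g x)"
  by (auto simp: smooth_fun_def Ck_add)

lemma smooth_mult:
  fixes f g :: "'a::real_normed_vector \<Rightarrow> 'b::real_normed_algebra"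
  shows "smooth_fun f \<Longrightarrow> smooth_fun g \<Longrightarrow> smooth_fun (\<lambda>x. f x * g x)"
  by (auto simp: smooth_fun_def intro: Ck_bounded_bilinear[OF bounded_bilinear_mult])

lemma smooth_prod:
  fixes f :: "'i \<Rightarrow> 'a::real_normed_vector \<Rightarrow> 'b::{comm_monoid_mult,real_normed_algebra,comm_semiring_1}"
  assumes "\<And>i. i \<in> I \<Longrightarrow> smooth_fun (f i)"
  shows "smooth_fun (\<lambda>x. \<Prod>i\<in>I. f i x)"
  using assms by (induction I rule: infinite_finite_induct) (auto intro!: smooth_const smooth_mult)

lemma smooth_inner_self: "smooth_fun (\<lambda>x::'a::real_inner. sq x)"
  unfolding smooth_fun_def
  using Ck_bounded_bilinear[OF bounded_bilinear_inner, of _ "\<lambda>x. x" "\<lambda>x. x"]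
    Ck_bounded_linear[OF bounded_linear_ident] by blast

lemma smooth_compose_real:
  fixes f :: "'a::real_normed_vector \<Rightarrow> real" and g :: "real \<Rightarrow> 'b::real_normed_vector"
  shows "smooth_fun g \<Longrightarrow> smooth_fun f \<Longrightarrow> smooth_fun (\<lambda>x. g (f x))"
  by (auto simp: smooth_fun_def intro: Ck_compose_real)

lemma smooth_compose_bounded_linear:
  "smooth_fun f \<Longrightarrow> bounded_linear h \<Longrightarrow> smooth_fun (\<lambda>x. f (h x))"
  by (auto simp: smooth_fun_def intro: Ck_compose_bounded_linear)

lemma smooth_bounded_linear_compose:
  "bounded_linear h \<Longrightarrow> smooth_fun f \<Longrightarrow> smooth_fun (\<lambda>x. h (f x))"
proof -
  assume h: "bounded_linear h"
  have "Ck k (\<lambda>x. h (f x))" if "Ck k f" for k f using that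
  proof (induction k arbitrary: f)
    case 0
    then show ?case
      using continuous_on_compose2[OF linear_continuous_on[OF h]] by auto
  next
    case (Suc k)
    show ?case
      by (rule CkI[OF bounded_linear.has_derivative[OF h Ck_Suc_has_derivative[OF Suc.prems]]])
        (intro Suc.IH Ck_frechet_derivative Suc.prems)
  qed
  then show "smooth_fun f \<Longrightarrow> ?thesis" by (auto simp: smooth_fun_def)
qed

lemma smooth_pd: "smooth_fun f \<Longrightarrow> smooth_fun (pd v f)"
  unfolding smooth_fun_def pd_def[abs_def] using Ck_frechet_derivative by blast

lemma smooth_continuous: "smooth_fun f \<Longrightarrow> continuous_on A f"
  unfolding smooth_fun_def using Ck.simps(1) continuous_on_subset by blast

lemma smooth_has_derivative: "smooth_fun f \<Longrightarrow> (f has_derivative (\<lambda>v. pd v f x)) (at x)"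
  unfolding smooth_fun_def pd_def by (rule Ck_Suc_has_derivative) auto

text \<open>Each member of the family is the derivative of its predecessor, so one induction over
  the order serves the entire chain; meant for exponentials, whose derivatives are known in closed
  form.\<close>

lemma smooth_real_derivative_chain:
  fixes f :: "nat \<Rightarrow> real \<Rightarrow> 'b::real_normed_vector"
  assumes "\<And>n s. (f n has_vector_derivative f (Suc n) s) (at s)"
  shows "smooth_fun (f n)"
proof -
  have "Ck k (f n)" for k
  proof (induction k arbitrary: n)
    case 0
    then show ?case
      using assms by (auto simp: continuous_on_eq_continuous_at intro!: has_vector_derivative_continuous)
  next
    case (Suc k)
    show ?case by (rule Ck_real_derivativeI[OF assms Suc])
  qed
  then show ?thesis by (simp add: smooth_fun_def)
qed

lemma smooth_exp_cis: "smooth_fun (\<lambda>s::real. exp (\<i> * of_real (a * s)))"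
proof -
  have "((\<lambda>s. (\<i> * of_real a)^n * exp (\<i> * of_real (a * s))) has_vector_derivative
      (\<i> * of_real a)^(Suc n) * exp (\<i> * of_real (a * s))) (at s)" for n s
    by (auto intro!: derivative_eq_intros has_vector_derivative_real_field)
  from smooth_real_derivative_chain[where f = "\<lambda>n s. (\<i> * of_real a)^n * exp (\<i> * of_real (a * s))", OF this, of 0]
  show ?thesis by simp
qed

subsection \<open>Flat functions\<close>

text \<open>The classical exp(-1/s) with a power weight. The weights make the family closed under
  differentiation, and for large s the function is comparable to s^(-j). Hence
  \<open>flat j (s - R)\<close> is a smooth power truncated on the left, and
  \<open>flat 0 (1 - s / n)\<close> is a smooth cutoff on the right.\<close>

definition flat :: "real \<Rightarrow> real \<Rightarrow> real" where
  "flat j s = (if s \<le> 0 then 0 else s powr (- j) * exp (- (1 / s)))"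

lemma flat_nonneg: "0 \<le> flat j s"
  by (simp add: flat_def)

lemma flat_le_0 [simp]: "s \<le> 0 \<Longrightarrow> flat j s = 0"
  by (simp add: flat_def)

lemma flat_tendsto_0: "(flat j \<longlongrightarrow> 0) (at_right 0)"
proof -
  have "((\<lambda>s. s powr (- j) * exp (- (1 / s))) \<longlongrightarrow> 0) (at_right 0)"
    by real_asymp
  then show ?thesis
    by (rule Lim_transform_eventually) (auto simp: flat_def eventually_at_right_less intro!: eventually_at_rightI[of 0 1])
qed

lemma flat_has_derivative: "(flat j has_real_derivative (flat (j + 2) s - j * flat (j + 1) s)) (at s)"
proof (cases s "0::real" rule: linorder_cases)
  case less
  have "((\<lambda>_. 0) has_real_derivative 0) (at s)" by simp
  then have "(flat j has_real_derivative 0) (at s)"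
    by (rule has_field_derivative_transform_within_open[of _ _ _ "{..<0}"]) (use less in \<open>auto\<close>)
  then show ?thesis using less by simp
next
  case equal
  \<comment> \<open>To the right of the origin the difference quotient of \<open>flat j\<close> is
    \<open>flat (j + 1)\<close>.\<close>
  have "((\<lambda>s. flat j s / s) \<longlongrightarrow> 0) (at_right 0)"
    by (rule Lim_transform_eventually[OF flat_tendsto_0[of "j + 1"]])
      (auto simp: flat_def powr_diff intro!: eventually_at_rightI[of 0 1])
  moreover have "((\<lambda>s. flat j s / s) \<longlongrightarrow> 0) (at_left 0)"
    by (rule Lim_transform_eventually[OF tendsto_const]) (auto simp: intro!: eventually_at_leftI[of "-1" 0])
  ultimately have "((\<lambda>s. flat j s / s) \<longlongrightarrow> 0) (at 0)"
    by (simp add: filterlim_split_at)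
  then show ?thesis using equal by (simp add: has_field_derivative_iff)
next
  case greater
  have "((\<lambda>s. s powr (- j) * exp (- (1 / s))) has_real_derivative
     (flat (j + 2) s - j * flat (j + 1) s)) (at s)"
    using greater
    by (auto intro!: derivative_eq_intros simp: flat_def powr_diff power2_eq_square powr_minus field_simps powr_add)
  then show ?thesis
    by (rule has_field_derivative_transform_within_open[of _ _ _ "{0<..}"]) (use greater in \<open>auto simp: flat_def\<close>)
qed

text \<open>The derivative formula does not leave the family, so the induction over the order runs
  with the index arbitrary.\<close>

lemma smooth_flat: "smooth_fun (flat j)"
proof -
  have "Ck k (flat j)" for k
  proof (induction k arbitrary: j)
    case 0
    then show ?case
      by (auto simp: continuous_on_eq_continuous_at intro!: DERIV_isCont flat_has_derivative)
  next
    case (Suc k)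
    have "Ck k (\<lambda>s. flat (j + 2) s + (- j) * flat (j + 1) s)"
      by (intro Ck_add Ck_bounded_bilinear[OF bounded_bilinear_mult] Ck_const Suc)
    then show ?case
      by (intro Ck_real_derivativeI[where f' = "\<lambda>s. flat (j + 2) s - j * flat (j + 1) s"])
       (auto simp flip: has_real_derivative_iff_has_vector_derivative intro!: flat_has_derivative)
  qed
  then show ?thesis by (simp add: smooth_fun_def)
qed


subsection \<open>Test functions\<close>

lemma test_funI:
  assumes "smooth_fun w" "\<And>x. R < norm x \<Longrightarrow> w x = 0"
  shows "test_fun w"
proof -
  have "closure {x. w x \<noteq> 0} \<subseteq> cball 0 R"
    using assms(2) by (intro closure_minimal) (auto, meson not_le)
  then show ?thesis
    unfolding test_fun_def using assms(1) compact_cball compact_Int_closed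
    by (metis closed_closure inf.absorb_iff2)
qed

lemma test_fun_support:
  fixes w :: "'a::euclidean_space \<Rightarrow> complex"
  assumes "test_fun w" obtains R where "0 < R" "\<And>x. R \<le> norm x \<Longrightarrow> w x = 0"
proof -
  have "bounded (closure {x. w x \<noteq> 0})"
    using assms compact_imp_bounded by (auto simp: test_fun_def)
  then obtain R where R: "0 < R" "\<And>x. x \<in> closure {x. w x \<noteq> 0} \<Longrightarrow> norm x \<le> R"
    by (auto simp: bounded_pos)
  show ?thesis
  proof (rule that[of "R + 1"])
    fix x :: 'a assume "R + 1 \<le> norm x"
    then have "x \<notin> closure {x. w x \<noteq> 0}" using R(2)[of x] by auto
    then show "w x = 0" using closure_subset[of "{x. w x \<noteq> 0}"] by auto
  qed (use R in auto)
qed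

lemma test_fun_smooth: "test_fun w \<Longrightarrow> smooth_fun w"
  by (simp add: test_fun_def)

lemma test_fun_punctI:
  assumes "smooth_fun w" "\<And>x. R < norm x \<Longrightarrow> w x = 0" "0 < r" "\<And>x. norm x < r \<Longrightarrow> w x = 0"
  shows "test_fun_punct w"
proof -
  have "closure {x. w x \<noteq> 0} \<subseteq> - ball 0 r"
    using assms(4) by (intro closure_minimal) (auto simp: closed_Compl)
  then show ?thesis
    using assms(3) test_funI[OF assms(1,2)] by (auto simp: test_fun_punct_def)
qed

lemma test_fun_punct_near_0:
  fixes w :: "'a::euclidean_space \<Rightarrow> complex"
  assumes "test_fun_punct w" obtains r where "0 < r" "\<And>x. norm x < r \<Longrightarrow> w x = 0"
proof -
  have "open (- closure {x. w x \<noteq> 0})" "0 \<in> - closure {x. w x \<noteq> 0}"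
    using assms by (auto simp: test_fun_punct_def)
  then obtain r where r: "0 < r" "ball 0 r \<subseteq> - closure {x. w x \<noteq> 0}"
    using open_contains_ball by blast
  show ?thesis
  proof (rule that[OF r(1)])
    fix x :: 'a assume "norm x < r"
    then have "x \<notin> closure {x. w x \<noteq> 0}" using r(2) by auto
    then show "w x = 0" using closure_subset[of "{x. w x \<noteq> 0}"] by auto
  qed
qed

lemma pd_zero_outside:
  assumes "\<And>x. R \<le> norm x \<Longrightarrow> w x = 0" "R < norm x"
  shows "pd v w x = 0"
proof -
  have "(w has_derivative (\<lambda>_. 0)) (at x)"
    by (rule has_derivative_transform_within_open[OF has_derivative_const, of "- cball 0 R"])
      (use assms in \<open>auto simp: open_Compl\<close>)
  then show ?thesis by (rule pd_eq)
qed

lemma test_fun_pd: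
  assumes "test_fun w" shows "test_fun (pd v w)"
proof -
  obtain R where "\<And>x. R \<le> norm x \<Longrightarrow> w x = 0" using test_fun_support[OF assms] by metis
  then show ?thesis
    using test_funI[of "pd v w" R] pd_zero_outside[of R w _ v] smooth_pd[OF test_fun_smooth[OF assms]]
    by blast
qed

subsection \<open>Derivatives of radial functions and of products\<close>

lemma has_derivative_radial:
  fixes W :: "real \<Rightarrow> complex"
  assumes "\<And>s. (W has_vector_derivative W' s) (at s)"
  shows "((\<lambda>x::'a::real_inner. W (sq x)) has_derivative (\<lambda>v. (2 * (x \<bullet> v)) *\<^sub>R W' (sq x))) (at x)"
  using has_derivative_compose[OF bounded_bilinear.FDERIV[OF bounded_bilinear_inner has_derivative_ident has_derivative_ident]
      assms[unfolded has_vector_derivative_def], of x UNIV]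
  by (simp add: inner_commute)

lemma pd_radial:
  fixes W :: "real \<Rightarrow> complex"
  assumes "\<And>s. (W has_vector_derivative W' s) (at s)"
  shows "pd v (\<lambda>x::'a::euclidean_space. W (sq x)) x = (2 * (x \<bullet> v)) *\<^sub>R W' (sq x)"
  by (rule pd_eq[OF has_derivative_radial[OF assms]])

lemma has_derivative_coord_radial:
  fixes W :: "real \<Rightarrow> complex"
  assumes "\<And>s. (W has_vector_derivative W' s) (at s)"
  shows "((\<lambda>x::'a::real_inner. (x \<bullet> b) *\<^sub>R W (sq x)) has_derivative
    (\<lambda>v. (x \<bullet> b) *\<^sub>R ((2 * (x \<bullet> v)) *\<^sub>R W' (sq x)) + (v \<bullet> b) *\<^sub>R W (sq x))) (at x)"
  by (intro bounded_bilinear.FDERIV[OF bounded_bilinear_scaleR] has_derivative_radial assms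
     bounded_linear_imp_has_derivative bounded_linear_inner_left)

lemma pd_coord_radial:
  fixes W :: "real \<Rightarrow> complex"
  assumes "\<And>s. (W has_vector_derivative W' s) (at s)" "b \<in> Basis"
  shows "pd b (\<lambda>x::'a::euclidean_space. (x \<bullet> b) *\<^sub>R W (sq x)) x
    = W (sq x) + (2 * (x \<bullet> b)^2) *\<^sub>R W' (sq x)"
  using pd_eq[OF has_derivative_coord_radial[OF assms(1)], of b] assms(2)
  by (simp add: power2_eq_square mult_ac)

lemma sum_coord_sq: "(\<Sum>b\<in>Basis. (x \<bullet> b)^2) = (x::'a::euclidean_space) \<bullet> x"
  unfolding euclidean_inner[of x x] by (simp add: power2_eq_square)

text \<open>The gradient of W(|x|^2) is 2 x W'(s); a second derivative brings |2x|^2 = 4s in front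
  of W'' and the trace 2d in front of W'.\<close>

lemma lap_radial:
  fixes W :: "real \<Rightarrow> complex"
  assumes W: "\<And>s. (W has_vector_derivative W' s) (at s)"
    and W': "\<And>s. (W' has_vector_derivative W'' s) (at s)"
  shows "lap (\<lambda>x::'a::euclidean_space. W (sq x)) x
    = (4 * (sq x)) *\<^sub>R W'' (sq x) + (2 * DIM('a)) *\<^sub>R W' (sq x)"
proof -
  have *: "pd b (pd b (\<lambda>x::'a. W (sq x))) x = 2 *\<^sub>R W' (sq x) + (4 * (x \<bullet> b)^2) *\<^sub>R W'' (sq x)"
    if "b \<in> Basis" for b :: 'a
  proof -
    have V: "((\<lambda>s. 2 *\<^sub>R W' s) has_vector_derivative 2 *\<^sub>R W'' s) (at s)" for s
      by (intro W' bounded_linear.has_vector_derivative[OF bounded_linear_scaleR_right])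
    have "pd b (\<lambda>x::'a. W (sq x)) = (\<lambda>x. (x \<bullet> b) *\<^sub>R (2 *\<^sub>R W' (sq x)))"
      by (rule ext) (simp add: pd_radial[OF W] mult_ac)
    then show ?thesis
      using pd_coord_radial[OF V that] by (simp add: mult_ac)
  qed
  have "lap (\<lambda>x::'a. W (sq x)) x = (\<Sum>b\<in>Basis. 2 *\<^sub>R W' (sq x) + (4 * (x \<bullet> b)^2) *\<^sub>R W'' (sq x))"
    unfolding lap_def using * by (intro sum.cong) auto
  also have "\<dots> = (\<Sum>b\<in>(Basis::'a set). 2 *\<^sub>R W' (sq x)) + (\<Sum>b\<in>Basis. 4 * (x \<bullet> b)^2) *\<^sub>R W'' (sq x)"
    by (simp only: sum.distrib scaleR_sum_left)
  also have "(\<Sum>b\<in>Basis. 4 * (x \<bullet> b)^2) = 4 * (sq x)"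
    by (simp add: sum_distrib_left[symmetric] sum_coord_sq)
  also have "(\<Sum>b\<in>(Basis::'a set). 2 *\<^sub>R W' (sq x)) = (2 * DIM('a)) *\<^sub>R W' (sq x)"
    by (simp add: scaleR_conv_of_real)
  finally show ?thesis by (simp only: add.commute)
qed

lemma pd_mult:
  fixes f g :: "'a::real_normed_vector \<Rightarrow> complex"
  assumes "smooth_fun f" "smooth_fun g"
  shows "pd v (\<lambda>x. f x * g x) x = f x * pd v g x + pd v f x * g x"
  by (rule pd_eq[OF has_derivative_mult[OF smooth_has_derivative[OF assms(1)] smooth_has_derivative[OF assms(2)]]])

lemma pd_add:
  assumes "smooth_fun f" "smooth_fun g"
  shows "pd v (\<lambda>x. f x + g x) x = pd v f x + pd v g x"
  by (rule pd_eq[OF has_derivative_add[OF smooth_has_derivative[OF assms(1)] smooth_has_derivative[OF assms(2)]]])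

lemma lap_mult:
  fixes f g :: "'a::euclidean_space \<Rightarrow> complex"
  assumes "smooth_fun f" "smooth_fun g"
  shows "lap (\<lambda>x. f x * g x) x = f x * lap g x + 2 * (\<Sum>b\<in>Basis. pd b f x * pd b g x) + lap f x * g x"
proof -
  have "pd b (pd b (\<lambda>x. f x * g x)) x = f x * pd b (pd b g) x + 2 * (pd b f x * pd b g x) + pd b (pd b f) x * g x" for b
  proof -
    have "pd b (\<lambda>x. f x * g x) = (\<lambda>x. f x * pd b g x + pd b f x * g x)"
      by (rule ext) (rule pd_mult[OF assms])
    then show ?thesis
      by (simp add: pd_add pd_mult smooth_mult smooth_pd assms)
  qed
  then show ?thesis
    by (simp add: lap_def sum.distrib sum_distrib_left sum_distrib_right)
qed

lemma pd_scale:
  assumes "smooth_fun f"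
  shows "pd v (\<lambda>x. f (r *\<^sub>R x)) x = r *\<^sub>R pd v f (r *\<^sub>R x)"
proof -
  have D: "(f has_derivative (\<lambda>v. pd v f (r *\<^sub>R x))) (at (r *\<^sub>R x))"
    by (rule smooth_has_derivative[OF assms])
  have "((\<lambda>x. f (r *\<^sub>R x)) has_derivative (\<lambda>v. pd (r *\<^sub>R v) f (r *\<^sub>R x))) (at x)"
    by (rule has_derivative_compose[OF bounded_linear_imp_has_derivative[OF bounded_linear_scaleR_right] D])
  then have "pd v (\<lambda>x. f (r *\<^sub>R x)) x = pd (r *\<^sub>R v) f (r *\<^sub>R x)"
    by (rule pd_eq)
  also have "\<dots> = r *\<^sub>R pd v f (r *\<^sub>R x)"
    using linear_scale[OF has_derivative_linear[OF D], of r v] by simp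
  finally show ?thesis .
qed

lemma lap_scale:
  fixes f :: "'a::euclidean_space \<Rightarrow> complex"
  assumes "smooth_fun f"
  shows "lap (\<lambda>x. f (r *\<^sub>R x)) x = r^2 *\<^sub>R lap f (r *\<^sub>R x)"
proof -
  have "pd b (pd b (\<lambda>x. f (r *\<^sub>R x))) x = r^2 *\<^sub>R pd b (pd b f) (r *\<^sub>R x)" for b
  proof -
    have "pd b (\<lambda>x. f (r *\<^sub>R x)) = (\<lambda>x. r *\<^sub>R pd b f (r *\<^sub>R x))"
      by (rule ext) (rule pd_scale[OF assms])
    moreover have "pd b (\<lambda>x. r *\<^sub>R pd b f (r *\<^sub>R x)) x = r *\<^sub>R pd b (\<lambda>x. pd b f (r *\<^sub>R x)) x"
      by (intro pd_eq has_derivative_scaleR_right smooth_has_derivative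
          smooth_compose_bounded_linear[OF smooth_pd[OF assms]] bounded_linear_scaleR_right)
    ultimately show ?thesis
      by (simp add: pd_scale[OF smooth_pd[OF assms]] power2_eq_square)
  qed
  then show ?thesis by (simp add: lap_def scaleR_sum_right)
qed

lemma smooth_exp_radial: "smooth_fun (\<lambda>x::'a::euclidean_space. exp (\<i> * of_real (a * (sq x))))"
  by (rule smooth_compose_real[OF smooth_exp_cis smooth_inner_self])

lemma pd_exp_radial:
  "pd b (\<lambda>x::'a::euclidean_space. exp (\<i> * of_real (a * (sq x)))) x
    = 2 * \<i> * of_real (a * (x \<bullet> b)) * exp (\<i> * of_real (a * (sq x)))"
proof -
  have "((\<lambda>s. exp (\<i> * of_real (a * s))) has_vector_derivative (\<i> * of_real a) * exp (\<i> * of_real (a * s))) (at s)" for s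
    by (auto intro!: derivative_eq_intros has_vector_derivative_real_field)
  from pd_radial[OF this, of b x] show ?thesis by (simp add: scaleR_conv_of_real mult_ac)
qed

lemma lap_exp_radial:
  "lap (\<lambda>x::'a::euclidean_space. exp (\<i> * of_real (a * (sq x)))) x
    = (2 * \<i> * of_real (a * DIM('a)) - 4 * of_real (a^2 * (sq x))) * exp (\<i> * of_real (a * (sq x)))"
proof -
  have *: "((\<lambda>s. exp (\<i> * of_real (a * s))) has_vector_derivative (\<i> * of_real a) * exp (\<i> * of_real (a * s))) (at s)" for s
    by (auto intro!: derivative_eq_intros has_vector_derivative_real_field)
  have "((\<lambda>s. (\<i> * of_real a) * exp (\<i> * of_real (a * s))) has_vector_derivative
      - of_real (a^2) * exp (\<i> * of_real (a * s))) (at s)" for s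
    by (auto intro!: derivative_eq_intros has_vector_derivative_real_field simp: power2_eq_square mult_ac)
  from lap_radial[OF * this, of x] show ?thesis by (simp add: scaleR_conv_of_real algebra_simps)
qed

subsection \<open>Square-integrable functions\<close>

lemma measurable_lebesgue_continuous:
  fixes f :: "'a::euclidean_space \<Rightarrow> 'b::euclidean_space"
  shows "continuous_on UNIV f \<Longrightarrow> f \<in> borel_measurable lebesgue"
  by (intro measurable_completion) (simp add: borel_measurable_continuous_onI)

lemma measurable_lebesgue_ident [measurable]: "(\<lambda>x::'a::euclidean_space. x) \<in> borel_measurable lebesgue"
  by (rule measurable_lebesgue_continuous) (rule continuous_on_id)

lemma L2_measurable [measurable_dest]: "f \<in> L2 \<Longrightarrow> f \<in> borel_measurable lebesgue"
  by (simp add: L2_def)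

lemma L2_mult_integrable:
  assumes "f \<in> L2" "g \<in> L2"
  shows "integrable lebesgue (\<lambda>x. f x * g x)"
proof (rule Bochner_Integration.integrable_bound)
  show "integrable lebesgue (\<lambda>x. (norm (f x))^2 + (norm (g x))^2)"
    using assms by (auto simp: L2_def)
  have "norm (f x * g x) \<le> (norm (f x))^2 + (norm (g x))^2" for x
  proof -
    have "2 * (norm (f x) * norm (g x)) \<le> (norm (f x))^2 + (norm (g x))^2"
      using sum_squares_bound[of "norm (f x)" "norm (g x)"] by simp
    then show ?thesis
      using mult_nonneg_nonneg[OF norm_ge_zero norm_ge_zero, of "f x" "g x"]
      unfolding norm_mult by linarith
  qed
  then show "AE x in lebesgue. norm (f x * g x) \<le> norm ((norm (f x))^2 + (norm (g x))^2)"
    by simp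
qed (use assms in \<open>auto simp: L2_def\<close>)

lemma L2_bound:
  assumes "g \<in> L2" "f \<in> borel_measurable lebesgue" "AE x in lebesgue. norm (f x) \<le> C * norm (g x)"
  shows "f \<in> L2"
proof -
  have i: "integrable lebesgue (\<lambda>x. C^2 * (norm (g x))^2)"
    using assms by (auto simp: L2_def)
  have b: "AE x in lebesgue. norm ((norm (f x))^2) \<le> norm (C^2 * (norm (g x))^2)"
    using assms(3)
  proof eventually_elim
    case (elim x)
    then have "(norm (f x))^2 \<le> (C * norm (g x))^2" by (intro power_mono) auto
    then show ?case by (simp add: power_mult_distrib)
  qed
  have "integrable lebesgue (\<lambda>x. (norm (f x))^2)"
    by (rule Bochner_Integration.integrable_bound[OF i _ b]) (use assms(2) in measurable)
  then show ?thesis using assms by (simp add: L2_def)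
qed

lemma L2_add:
  assumes "f \<in> L2" "g \<in> L2" shows "(\<lambda>x. f x + g x) \<in> L2"
proof -
  have i: "integrable lebesgue (\<lambda>x. 2 * (norm (f x))^2 + 2 * (norm (g x))^2)"
    using assms by (auto simp: L2_def)
  have b: "norm ((norm (f x + g x))^2) \<le> norm (2 * (norm (f x))^2 + 2 * (norm (g x))^2)" for x
  proof -
    have "(norm (f x + g x))^2 \<le> (norm (f x) + norm (g x))^2"
      by (intro power_mono norm_triangle_ineq) auto
    also have "\<dots> \<le> 2 * (norm (f x))^2 + 2 * (norm (g x))^2"
      using sum_squares_bound[of "norm (f x)" "norm (g x)"] by (simp add: power2_sum)
    finally show ?thesis by simp
  qed
  have "integrable lebesgue (\<lambda>x. (norm (f x + g x))^2)"
    by (rule Bochner_Integration.integrable_bound[OF i _ AE_I2[OF b]]) (use assms in \<open>auto simp: L2_def\<close>)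
  moreover have "(\<lambda>x. f x + g x) \<in> borel_measurable lebesgue"
    using assms[THEN L2_measurable] by measurable
  ultimately show ?thesis by (simp add: L2_def)
qed

lemma L2_mult_bounded:
  assumes "f \<in> L2" "h \<in> borel_measurable lebesgue" "\<And>x. norm (h x) \<le> B"
  shows "(\<lambda>x. h x * f x) \<in> L2"
  by (rule L2_bound[OF assms(1), of _ B])
    (use assms in \<open>auto simp: norm_mult L2_def intro!: mult_right_mono\<close>)

lemma L2_cmult: "f \<in> L2 \<Longrightarrow> (\<lambda>x. c * f x) \<in> L2"
  by (rule L2_mult_bounded[of _ "\<lambda>_. c" "norm c"]) auto

lemma L2_diff: "f \<in> L2 \<Longrightarrow> g \<in> L2 \<Longrightarrow> (\<lambda>x. f x - g x) \<in> L2"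
  using L2_add[of f "\<lambda>x. (-1) * g x"] L2_cmult[of g "-1"] by simp

lemma L2_bounded_support:
  fixes f :: "'a::euclidean_space \<Rightarrow> complex"
  assumes "f \<in> borel_measurable lebesgue" "\<And>x. norm (f x) \<le> B" "\<And>x. R < norm x \<Longrightarrow> f x = 0"
  shows "f \<in> L2"
proof -
  have ind: "(\<lambda>x::'a. indicator (cball 0 R) x :: complex) \<in> L2"
  proof -
    have "integrable lebesgue (indicat_real (cball 0 R :: 'a set))"
      using lmeasurable_cball[of "0::'a" R] by (auto simp: integrable_indicator_iff fmeasurable_def)
    moreover have "(\<lambda>x. (norm (indicator (cball 0 R) x :: complex))^2) = indicat_real (cball 0 R :: 'a set)"
      by (auto simp: indicator_def)
    ultimately have "integrable lebesgue (\<lambda>x::'a. (norm (indicator (cball 0 R) x :: complex))^2)" by simp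
    moreover have "(\<lambda>x::'a. indicator (cball 0 R) x :: complex) \<in> borel_measurable lebesgue"
      by (intro borel_measurable_indicator) simp
    ultimately show ?thesis by (simp only: L2_def mem_Collect_eq simp_thms)
  qed
  show ?thesis
    by (rule L2_bound[OF ind assms(1), of B]) (use assms(2,3) in \<open>auto simp: indicator_def not_le\<close>)
qed

lemma continuous_compact_support_bounded:
  fixes f :: "'a::euclidean_space \<Rightarrow> 'b::real_normed_vector"
  assumes "continuous_on UNIV f" "\<And>x. R < norm x \<Longrightarrow> f x = 0"
  obtains B where "0 \<le> B" "\<And>x. norm (f x) \<le> B"
proof -
  have "compact (f ` cball 0 R)"
    by (rule compact_continuous_image[OF continuous_on_subset[OF assms(1)]]) auto
  then obtain B where B: "\<And>y. y \<in> f ` cball 0 R \<Longrightarrow> norm y \<le> B"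
    using compact_imp_bounded bounded_iff by metis
  have "norm (f x) \<le> max B 0" for x
    using B[of "f x"] assms(2)[of x] by (cases "R < norm x") auto
  then show ?thesis using that[of "max B 0"] by auto
qed

lemma L2_continuous_support:
  fixes f :: "'a::euclidean_space \<Rightarrow> complex"
  assumes "continuous_on UNIV f" "\<And>x. R < norm x \<Longrightarrow> f x = 0"
  shows "f \<in> L2"
proof -
  obtain B where "\<And>x. norm (f x) \<le> B" using continuous_compact_support_bounded[of f R] assms by blast
  then show ?thesis
    by (intro L2_bounded_support[of f B R] measurable_lebesgue_continuous assms)
qed

lemma test_fun_L2:
  fixes w :: "'a::euclidean_space \<Rightarrow> complex"
  assumes "test_fun w" shows "w \<in> L2"
proof -
  obtain R where "\<And>x. R \<le> norm x \<Longrightarrow> w x = 0" using test_fun_support[OF assms] by metis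
  then show ?thesis
    by (intro L2_continuous_support[of w R] smooth_continuous test_fun_smooth assms) auto
qed

lemma L2_test_integrable: "f \<in> L2 \<Longrightarrow> test_fun w \<Longrightarrow> integrable lebesgue (\<lambda>x. f x * w x)"
  by (rule L2_mult_integrable[OF _ test_fun_L2])

subsection \<open>Uniqueness of weak derivatives\<close>

text \<open>The positive and negative parts of \<open>r\<close> are densities of two measures that
  agree on boxes, an intersection-stable generator, with finite values on boxes exhausting the
  space. So the measures coincide, and a density determines its function almost everywhere. The
  argument takes place on Borel sets, which is why \<open>r\<close> is first replaced by a Borel
  representative.\<close>

lemma AE_zero_if_box_integrals_zero:
  fixes r :: "'a::euclidean_space \<Rightarrow> real"
  assumes meas: "r \<in> borel_measurable lebesgue"
    and int: "\<And>a b. integrable lebesgue (\<lambda>x. r x * indicator (box a b) x)"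
    and zero: "\<And>a b. (LINT x|lebesgue. r x * indicator (box a b) x) = 0"
  shows "AE x in lebesgue. r x = 0"
proof -
  obtain r' where r'[measurable]: "r' \<in> borel_measurable lborel" and ae: "AE x in lborel. r x = r' x"
    using completion_ex_borel_measurable_real[OF meas] by auto
  have [measurable]: "r' \<in> borel_measurable lebesgue" "r \<in> borel_measurable lebesgue"
    by (rule measurable_completion[OF r'], rule meas)
  let ?p = "\<lambda>x. ennreal (max 0 (r' x))" and ?n = "\<lambda>x. ennreal (max 0 (- r' x))"
  have eq: "emeasure (density lborel ?p) (box a b) = emeasure (density lborel ?n) (box a b)"
    and fin: "emeasure (density lborel ?p) (box a b) \<noteq> \<infinity>" for a b :: 'a
  proof -
    have ae': "AE x in lebesgue. r x * indicator (box a b) x = r' x * indicator (box a b) x"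
      using AE_completion[OF ae] by eventually_elim simp
    have i1: "integrable lebesgue (\<lambda>x. r' x * indicator (box a b) x)"
      using int[of a b] by (subst (asm) integrable_cong_AE[OF _ _ ae']) measurable
    have z1: "(LINT x|lebesgue. r' x * indicator (box a b) x) = 0"
      using zero[of a b] by (subst (asm) integral_cong_AE[OF _ _ ae']) measurable
    have i2: "integrable lborel (\<lambda>x. r' x * indicator (box a b) x)"
      using i1 by (subst (asm) integrable_completion) measurable
    have z2: "(LINT x|lborel. r' x * indicator (box a b) x) = 0"
      using z1 by (subst (asm) integral_completion) measurable
    have ip: "integrable lborel (\<lambda>x. max 0 (r' x) * indicator (box a b) x)"
     and im: "integrable lborel (\<lambda>x. max 0 (- r' x) * indicator (box a b) x)"
      by (rule Bochner_Integration.integrable_bound[OF i2]; auto simp: indicator_def)+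
    have "(LINT x|lborel. max 0 (r' x) * indicator (box a b) x) - (LINT x|lborel. max 0 (- r' x) * indicator (box a b) x)
      = (LINT x|lborel. r' x * indicator (box a b) x)"
      by (subst Bochner_Integration.integral_diff[symmetric, OF ip im])
        (intro Bochner_Integration.integral_cong, auto simp: indicator_def)
    then have E: "(LINT x|lborel. max 0 (r' x) * indicator (box a b) x) = (LINT x|lborel. max 0 (- r' x) * indicator (box a b) x)"
      using z2 by simp
    have mp: "emeasure (density lborel ?p) (box a b) = ennreal (LINT x|lborel. max 0 (r' x) * indicator (box a b) x)"
      by (subst emeasure_density, simp, simp, subst nn_integral_eq_integral[OF ip, symmetric])
         (auto intro!: nn_integral_cong simp: indicator_def)
    have mm: "emeasure (density lborel ?n) (box a b) = ennreal (LINT x|lborel. max 0 (- r' x) * indicator (box a b) x)"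
      by (subst emeasure_density, simp, simp, subst nn_integral_eq_integral[OF im, symmetric])
         (auto intro!: nn_integral_cong simp: indicator_def)
    show "emeasure (density lborel ?p) (box a b) = emeasure (density lborel ?n) (box a b)"
      "emeasure (density lborel ?p) (box a b) \<noteq> \<infinity>"
      by (auto simp: mp mm E)
  qed
  let ?E = "range (\<lambda>(a::'a, b). box a b)"
  have "density lborel ?p = density lborel ?n"
  proof (rule measure_eqI_generator_eq[of ?E UNIV _ _ "\<lambda>n. box (- (real n *\<^sub>R One)) (real n *\<^sub>R One)"])
    show "Int_stable ?E"
      by (auto simp: Int_stable_def box_Int_box)
    show "sets (density lborel ?p) = sigma_sets UNIV ?E" "sets (density lborel ?n) = sigma_sets UNIV ?E"
      by (simp_all add: borel_eq_box)
    show "(\<Union>i. box (- (real i *\<^sub>R One)) (real i *\<^sub>R One)) = (UNIV :: 'a set)"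
      using UN_box_eq_UNIV by simp
  qed (use eq fin in auto)
  then have "AE x in lborel. ?p x = ?n x"
    by (intro sigma_finite_measure.density_unique[OF sigma_finite_lborel]) auto
  then have "AE x in lborel. r x = 0"
    using ae by eventually_elim (auto simp: max_def ennreal_eq_0_iff split: if_splits)
  then show ?thesis by (rule AE_completion)
qed

lemma flat_0_scale_tendsto:
  "(\<lambda>n. flat 0 (real n * s)) \<longlonglongrightarrow> indicator {0<..} s"
proof (cases "s > 0")
  case True
  have "(\<lambda>n. exp (- (1 / (real n * s)))) \<longlonglongrightarrow> 1"
    using True by real_asymp
  then have "(\<lambda>n. flat 0 (real n * s)) \<longlonglongrightarrow> 1"
    by (rule Lim_transform_eventually)
      (use True in \<open>auto simp: flat_def mult_le_0_iff intro!: eventually_mono[OF eventually_gt_at_top[of 0]]\<close>)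
  then show ?thesis using True by simp
next
  case False
  then have "flat 0 (real n * s) = 0" for n
    by (simp add: mult_nonneg_nonpos)
  then show ?thesis using False by simp
qed

lemma flat_0_le_1: "flat 0 s \<le> 1"
  by (simp add: flat_def)

text \<open>Smooth functions between 0 and 1, supported in the box and converging to the indicator
  of the open box. On the real line they also serve as densities of intervals of squared
  radii.\<close>

definition box_bump :: "nat \<Rightarrow> 'a::euclidean_space \<Rightarrow> 'a \<Rightarrow> 'a \<Rightarrow> real" where
  "box_bump n a b x = (\<Prod>i\<in>Basis. flat 0 (real n * (x \<bullet> i - a \<bullet> i)) * flat 0 (real n * (b \<bullet> i - x \<bullet> i)))"

lemma box_bump_tendsto: "(\<lambda>n. box_bump n a b x) \<longlonglongrightarrow> indicator (box a b) x"
proof -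
  have "(\<lambda>n. box_bump n a b x) \<longlonglongrightarrow> (\<Prod>i\<in>Basis. indicator {0<..} (x \<bullet> i - a \<bullet> i) * indicator {0<..} (b \<bullet> i - x \<bullet> i))"
    unfolding box_bump_def by (intro tendsto_prod tendsto_mult flat_0_scale_tendsto)
  also have "(\<Prod>i\<in>Basis. indicator {0<..} (x \<bullet> i - a \<bullet> i) * indicator {0<..} (b \<bullet> i - x \<bullet> i)) = (indicator (box a b) x :: real)"
  proof (cases "x \<in> box a b")
    case True
    then show ?thesis by (auto simp: mem_box intro!: prod.neutral)
  next
    case False
    then obtain i where "i \<in> Basis" "\<not> (a \<bullet> i < x \<bullet> i \<and> x \<bullet> i < b \<bullet> i)" by (auto simp: mem_box)
    then show ?thesis using False
      by (auto simp: indicator_def intro!: prod_zero bexI[of _ i])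
  qed
  finally show ?thesis .
qed

lemma box_bump_nonneg: "0 \<le> box_bump n a b x" and box_bump_le_1: "box_bump n a b x \<le> 1"
  unfolding box_bump_def
  by (auto intro!: prod_nonneg prod_le_1 flat_nonneg mult_nonneg_nonneg mult_le_one flat_0_le_1)

lemma box_bump_outside:
  assumes "x \<notin> box a b" shows "box_bump n a b x = 0"
proof -
  obtain i where "i \<in> Basis" "\<not> (a \<bullet> i < x \<bullet> i \<and> x \<bullet> i < b \<bullet> i)" using assms by (auto simp: mem_box)
  then show ?thesis unfolding box_bump_def
    by (intro prod_zero bexI[of _ i]) (auto simp: mult_nonneg_nonpos)
qed

lemma test_fun_box_bump: "test_fun (\<lambda>x. complex_of_real (box_bump n a b x))"
proof -
  have "smooth_fun (box_bump n a b)"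
    unfolding box_bump_def[abs_def]
  proof (intro smooth_prod smooth_mult[OF smooth_compose_real[OF smooth_flat] smooth_compose_real[OF smooth_flat]])
    fix i :: 'a
    have "smooth_fun (\<lambda>x::'a. real n * (x \<bullet> i) + (- (real n * (a \<bullet> i))))"
      "smooth_fun (\<lambda>x::'a. (- real n) * (x \<bullet> i) + real n * (b \<bullet> i))"
      by (intro smooth_add smooth_const smooth_bounded_linear bounded_linear_intros)+
    then show "smooth_fun (\<lambda>x::'a. real n * (x \<bullet> i - a \<bullet> i))" "smooth_fun (\<lambda>x::'a. real n * (b \<bullet> i - x \<bullet> i))"
    proof -
      have "(\<lambda>x::'a. real n * (x \<bullet> i - a \<bullet> i)) = (\<lambda>x::'a. real n * (x \<bullet> i) + (- (real n * (a \<bullet> i))))"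
        "(\<lambda>x::'a. real n * (b \<bullet> i - x \<bullet> i)) = (\<lambda>x::'a. (- real n) * (x \<bullet> i) + real n * (b \<bullet> i))"
        by (auto simp: fun_eq_iff right_diff_distrib)
      then show "smooth_fun (\<lambda>x::'a. real n * (x \<bullet> i) + (- (real n * (a \<bullet> i)))) \<Longrightarrow>
         smooth_fun (\<lambda>x::'a. real n * (x \<bullet> i - a \<bullet> i))"
       "smooth_fun (\<lambda>x::'a. (- real n) * (x \<bullet> i) + real n * (b \<bullet> i)) \<Longrightarrow>
         smooth_fun (\<lambda>x::'a. real n * (b \<bullet> i - x \<bullet> i))"
        by (simp_all only:)
    qed
  qed
  then have "smooth_fun (\<lambda>x. complex_of_real (box_bump n a b x))"
    by (rule smooth_bounded_linear_compose[OF bounded_linear_of_real])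
  moreover obtain R where "\<forall>x\<in>box a b. norm x \<le> R" using bounded_box bounded_iff by metis
  ultimately show ?thesis
    by (intro test_funI[of _ R]) (auto intro!: box_bump_outside)
qed

text \<open>Box indicators are bounded pointwise limits of test functions, so dominated convergence
  makes all box integrals of \<open>h\<close> vanish; real and imaginary part are then treated
  separately.\<close>

lemma fundamental_lemma:
  fixes h :: "'a::euclidean_space \<Rightarrow> complex"
  assumes h: "h \<in> L2" and zero: "\<And>w. test_fun w \<Longrightarrow> (LINT x|lebesgue. h x * w x) = 0"
  shows "AE x in lebesgue. h x = 0"
proof -
  note [measurable] = L2_measurable[OF h]
  have box: "integrable lebesgue (\<lambda>x. h x * indicator (box a b) x) \<and> (LINT x|lebesgue. h x * indicator (box a b) x) = 0" for a b :: 'a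
  proof
    have ind: "(\<lambda>x. indicator (box a b) x :: complex) \<in> L2"
    proof -
      obtain R where "\<forall>x\<in>box a b. norm x \<le> R" using bounded_box bounded_iff by metis
      then show ?thesis by (intro L2_bounded_support[of _ 1 R]) (measurable, auto split: split_indicator)
    qed
    show i: "integrable lebesgue (\<lambda>x. h x * indicator (box a b) x)"
      by (rule L2_mult_integrable[OF h ind])
    have "(\<lambda>n. LINT x|lebesgue. h x * of_real (box_bump n a b x)) \<longlonglongrightarrow> (LINT x|lebesgue. h x * indicator (box a b) x)"
    proof (rule integral_dominated_convergence[where w = "\<lambda>x. norm (h x * indicator (box a b) x)"])
      show "integrable lebesgue (\<lambda>x. norm (h x * indicator (box a b) x))" using i by (rule integrable_norm)
      show "AE x in lebesgue. (\<lambda>n. h x * of_real (box_bump n a b x)) \<longlonglongrightarrow> h x * indicator (box a b) x" (is "AE x in _. ?P x")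
      proof (rule AE_I2)
        fix x
        have "(\<lambda>n. h x * of_real (box_bump n a b x)) \<longlonglongrightarrow> h x * of_real (indicator (box a b) x)"
          by (intro tendsto_mult tendsto_of_real box_bump_tendsto tendsto_const)
        then show "?P x"
          by (cases "x \<in> box a b") simp_all
      qed
      show "AE x in lebesgue. norm (h x * of_real (box_bump n a b x)) \<le> norm (h x * indicator (box a b) x)" for n
        using box_bump_nonneg[of n a b] box_bump_le_1[of n a b] box_bump_outside[of _ a b n]
        by (intro AE_I2) (auto simp: norm_mult indicator_def intro!: mult_left_le)
      show "(\<lambda>x. h x * of_real (box_bump n a b x)) \<in> borel_measurable lebesgue" for n
        using L2_test_integrable[OF h test_fun_box_bump] by (rule borel_measurable_integrable)
    qed measurable
    moreover have "(LINT x|lebesgue. h x * of_real (box_bump n a b x)) = 0" for n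
      by (rule zero[OF test_fun_box_bump])
    ultimately show "(LINT x|lebesgue. h x * indicator (box a b) x) = 0"
      by (simp add: LIMSEQ_const_iff)
  qed
  have "AE x in lebesgue. Re (h x) = 0"
  proof (rule AE_zero_if_box_integrals_zero)
    fix a b :: 'a
    have "(\<lambda>x. Re (h x * indicator (box a b) x)) = (\<lambda>x. Re (h x) * indicator (box a b) x)"
      by (auto simp: indicator_def)
    then show "integrable lebesgue (\<lambda>x. Re (h x) * indicator (box a b) x)" "(LINT x|lebesgue. Re (h x) * indicator (box a b) x) = 0"
      using integrable_Re[OF conjunct1[OF box[of a b]]] integral_Re[OF conjunct1[OF box[of a b]]] box[of a b] by simp_all
  qed measurable
  moreover have "AE x in lebesgue. Im (h x) = 0"
  proof (rule AE_zero_if_box_integrals_zero)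
    fix a b :: 'a
    have "(\<lambda>x. Im (h x * indicator (box a b) x)) = (\<lambda>x. Im (h x) * indicator (box a b) x)"
      by (auto simp: indicator_def)
    then show "integrable lebesgue (\<lambda>x. Im (h x) * indicator (box a b) x)" "(LINT x|lebesgue. Im (h x) * indicator (box a b) x) = 0"
      using integrable_Im[OF conjunct1[OF box[of a b]]] integral_Im[OF conjunct1[OF box[of a b]]] box[of a b] by simp_all
  qed measurable
  ultimately show ?thesis by eventually_elim (simp add: complex_eq_iff)
qed

lemma weak_partial_unique:
  assumes "g \<in> L2" "h \<in> L2" "weak_partial f b g" "weak_partial f b h"
  shows "AE x in lebesgue. g x = h x"
proof -
  have "AE x in lebesgue. g x - h x = 0"
  proof (rule fundamental_lemma[OF L2_diff[OF assms(1,2)]])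
    fix w :: "'a \<Rightarrow> complex" assume w: "test_fun w"
    have "(LINT x|lebesgue. f x * pd b w x) = - (LINT x|lebesgue. g x * w x)"
      "(LINT x|lebesgue. f x * pd b w x) = - (LINT x|lebesgue. h x * w x)"
      using assms(3,4) w unfolding weak_partial_def by simp_all
    then have "(LINT x|lebesgue. g x * w x) = (LINT x|lebesgue. h x * w x)"
      by simp
    then show "(LINT x|lebesgue. (g x - h x) * w x) = 0"
      by (simp add: left_diff_distrib L2_test_integrable assms w)
  qed
  then show ?thesis by simp
qed

text \<open>\<open>wgrad\<close> is picked by a choice operator. Uniqueness of weak derivatives
  makes the norm independent of the choice, so any explicit weak gradient computes it.\<close>

lemma grad_norm2_eq:
  assumes "\<And>b. b \<in> Basis \<Longrightarrow> g b \<in> L2" "\<And>b. b \<in> Basis \<Longrightarrow> weak_partial f b (g b)"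
  shows "grad_norm2 f = (\<Sum>b\<in>Basis. L2norm2 (g b))"
  unfolding grad_norm2_def L2norm2_def
proof (rule sum.cong[OF refl])
  fix b :: 'a assume b: "b \<in> Basis"
  have w: "wgrad f b \<in> L2 \<and> weak_partial f b (wgrad f b)"
    unfolding wgrad_def by (rule someI[where P = "\<lambda>g. g \<in> L2 \<and> weak_partial f b g" and x = "g b"]) (use assms b in auto)
  then have "AE x in lebesgue. wgrad f b x = g b x"
    using weak_partial_unique assms b by metis
  then show "(LINT x|lebesgue. (norm (wgrad f b x))\<^sup>2) = (LINT x|lebesgue. (norm (g b x))\<^sup>2)"
    by (intro integral_cong_AE) (use w assms b in \<open>auto simp: L2_def\<close>)
qed

lemma weak_partial_diff:
  assumes "f \<in> L2" "f' \<in> L2" "g \<in> L2" "g' \<in> L2" "weak_partial f b g" "weak_partial f' b g'"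
  shows "weak_partial (\<lambda>x. f x - f' x) b (\<lambda>x. g x - g' x)"
  using assms unfolding weak_partial_def
  by (auto simp: left_diff_distrib L2_test_integrable test_fun_pd)

lemma H1_dist_eq:
  assumes "f \<in> L2" "f' \<in> L2" "\<And>b. b \<in> Basis \<Longrightarrow> g b \<in> L2" "\<And>b. b \<in> Basis \<Longrightarrow> g' b \<in> L2"
    "\<And>b. b \<in> Basis \<Longrightarrow> weak_partial f b (g b)" "\<And>b. b \<in> Basis \<Longrightarrow> weak_partial f' b (g' b)"
  shows "H1_dist f f' = sqrt (L2norm2 (\<lambda>x. f x - f' x) + (\<Sum>b\<in>Basis. L2norm2 (\<lambda>x. g b x - g' b x)))"
proof -
  have "grad_norm2 (\<lambda>x. f x - f' x) = (\<Sum>b\<in>Basis. L2norm2 (\<lambda>x. g b x - g' b x))"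
    by (rule grad_norm2_eq) (simp_all add: assms L2_diff weak_partial_diff)
  then show ?thesis by (simp add: H1_dist_def)
qed

subsection \<open>Integrability of powers at infinity\<close>

lemma ennreal_le_suminf: "f n \<le> (\<Sum>n. f n :: ennreal)"
  using sum_le_suminf[of f "{n}"] by (simp add: summableI)

text \<open>Dyadic decomposition: where 4^n <= |x|^2 <= 4^(n+1) the function is at most 4^(-pn), and
  this region lies in a ball of radius 2^(n+1). The resulting series is geometric with ratio
  2^(d-2p), below 1 by the hypothesis on p.\<close>

lemma integrable_inverse_power_at_infinity:
  fixes p :: real
  assumes p: "real DIM('a) / 2 < p"
  shows "integrable lebesgue (\<lambda>x::'a::euclidean_space. indicator {1..} (sq x) * sq x powr (- p))"
proof (rule integrableI_bounded)
  let ?d = "real DIM('a)" and ?V = "unit_ball_vol (real DIM('a))"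
  show "(\<lambda>x::'a. indicator {1..} (sq x) * sq x powr (- p)) \<in> borel_measurable lebesgue"
    by measurable
  have le: "ennreal (norm (indicator {1..} (sq x) * sq x powr (- p)))
      \<le> (\<Sum>n. ennreal (4 powr (- p * real n)) * indicator (cball 0 (2^(n+1))) x)" for x :: 'a
  proof (cases "1 \<le> sq x")
    case True
    define n where "n = nat \<lfloor>log 4 (sq x)\<rfloor>"
    have l0: "0 \<le> log 4 (sq x)" using True by (intro zero_le_log_cancel_iff[THEN iffD2]) linarith+
    have n1: "real n \<le> log 4 (sq x)" and n2: "log 4 (sq x) \<le> real n + 1"
      unfolding n_def using l0 by linarith+
    have s1: "4 powr real n \<le> sq x"
      using n1 True by (subst (asm) le_log_iff) auto
    have "sq x \<le> 4 powr (real n + 1)"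
      using n2 True by (subst (asm) log_le_iff) auto
    also have "\<dots> = (2^(n+1))^2"
      by (simp add: powr_add powr_realpow power_mult_distrib power_mult[symmetric] power2_eq_square flip: power_mult_distrib)
    finally have "norm x \<le> 2^(n+1)"
      by (simp add: norm_eq_sqrt_inner real_le_lsqrt)
    then have "x \<in> cball 0 (2^(n+1))" by simp
    moreover have "sq x powr (- p) \<le> 4 powr (- p * real n)"
    proof -
      have "sq x powr (- p) \<le> (4 powr real n) powr (- p)"
        using p s1 by (intro powr_mono2') auto
      then show ?thesis by (simp add: powr_powr mult.commute)
    qed
    ultimately have "ennreal (norm (indicator {1..} (sq x) * sq x powr (- p)))
        \<le> ennreal (4 powr (- p * real n)) * indicator (cball 0 (2^(n+1))) x"
      using True by (simp add: ennreal_leI)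
    also have "\<dots> \<le> (\<Sum>n. ennreal (4 powr (- p * real n)) * indicator (cball 0 (2^(n+1))) x)"
      by (rule ennreal_le_suminf)
    finally show ?thesis .
  qed simp
  have "(\<integral>\<^sup>+x. ennreal (norm (indicator {1..} (sq x) * sq x powr (- p))) \<partial>(lebesgue::'a measure))
      \<le> (\<integral>\<^sup>+x. (\<Sum>n. ennreal (4 powr (- p * real n)) * indicator (cball 0 (2^(n+1))) x) \<partial>(lebesgue::'a measure))"
    by (intro nn_integral_mono le)
  also have "\<dots> = (\<Sum>n. (\<integral>\<^sup>+x. ennreal (4 powr (- p * real n)) * indicator (cball 0 (2^(n+1))) x \<partial>(lebesgue::'a measure)))"
    by (rule nn_integral_suminf) (intro borel_measurable_times_ennreal borel_measurable_const borel_measurable_indicator, simp)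
  also have "\<dots> = (\<Sum>n. ennreal (?V * 2 powr ?d * (2 powr (?d - 2 * p)) ^ n))"
  proof (rule suminf_cong)
    fix n :: nat
    have "(\<integral>\<^sup>+x. ennreal (4 powr (- p * real n)) * indicator (cball 0 (2^(n+1))) x \<partial>(lebesgue::'a measure))
      = ennreal (4 powr (- p * real n)) * emeasure lebesgue (cball 0 (2^(n+1)) :: 'a set)"
      by (rule nn_integral_cmult_indicator) simp
    also have "\<dots> = ennreal (4 powr (- p * real n)) * ennreal (?V * (2^(n+1))^DIM('a))"
      by (simp add: emeasure_cball)
    also have "\<dots> = ennreal (4 powr (- p * real n) * (?V * (2^(n+1))^DIM('a)))"
      by (simp add: ennreal_mult)
    also have "4 powr (- p * real n) * (?V * (2^(n+1))^DIM('a)) = ?V * 2 powr ?d * (2 powr (?d - 2 * p)) ^ n"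
    proof -
      have "(4::real) powr (- p * real n) = 2 powr (- 2 * p * real n)"
      proof -
        have "(4::real) = 2 powr 2" by simp
        then show ?thesis by (simp only: powr_powr) (simp add: mult_ac)
      qed
      moreover have "((2::real)^(n+1))^DIM('a) = 2 powr (real (n+1) * ?d)"
      proof -
        have "((2::real)^(n+1))^DIM('a) = 2^((n+1) * DIM('a))" by (rule power_mult[symmetric])
        also have "\<dots> = 2 powr real ((n+1) * DIM('a))" by (rule powr_realpow[symmetric]) simp
        finally show ?thesis by (simp only: of_nat_mult)
      qed
      moreover have "(2 powr (?d - 2 * p)) ^ n = (2::real) powr ((?d - 2 * p) * real n)"
        by (simp add: powr_realpow[symmetric] powr_powr)
      ultimately show ?thesis
        by (simp add: powr_add[symmetric] algebra_simps)
    qed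
    finally show "(\<integral>\<^sup>+x. ennreal (4 powr (- p * real n)) * indicator (cball 0 (2^(n+1))) x \<partial>(lebesgue::'a measure))
      = ennreal (?V * 2 powr ?d * (2 powr (?d - 2 * p)) ^ n)" .
  qed
  also have "\<dots> < \<infinity>"
  proof -
    have "2 powr (?d - 2 * p) < 2 powr 0" using p by (intro powr_less_mono) auto
    then have "summable (\<lambda>n. ?V * 2 powr ?d * (2 powr (?d - 2 * p)) ^ n)"
      by (intro summable_mult summable_geometric) auto
    then have "(\<Sum>n. ennreal (?V * 2 powr ?d * (2 powr (?d - 2 * p)) ^ n)) \<noteq> top"
      by (intro ennreal_suminf_neq_top) auto
    then show ?thesis by (simp add: top.not_eq_extremum)
  qed
  finally show "(\<integral>\<^sup>+x. ennreal (norm (indicator {1..} (sq x) * sq x powr (- p))) \<partial>(lebesgue::'a measure)) < \<infinity>" .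
qed

lemma L2_inverse_power_at_infinity:
  fixes p :: real
  assumes p: "real DIM('a) / 4 < p"
  shows "(\<lambda>x::'a::euclidean_space. complex_of_real (indicator {1..} (sq x) * sq x powr (- p))) \<in> L2"
proof -
  have "(norm (complex_of_real (indicator {1..} (sq x) * sq x powr (- p))))^2
      = indicator {1..} (sq x) * sq x powr (- (2 * p))" for x :: 'a
    by (cases "1 \<le> sq x") (simp_all add: power2_eq_square powr_add[symmetric])
  moreover have "integrable lebesgue (\<lambda>x::'a. indicator {1..} (sq x) * sq x powr (- (2 * p)))"
    by (rule integrable_inverse_power_at_infinity) (use p in simp)
  moreover have "(\<lambda>x::'a. complex_of_real (indicator {1..} (sq x) * sq x powr (- p))) \<in> borel_measurable lebesgue"
    by measurable
  ultimately show ?thesis by (simp add: L2_def)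
qed

subsection \<open>Radial functions with nonpositive shell integrals\<close>

text \<open>If f were positive on a set of positive measure, inner regularity would give a compact K
  in it. By radiality f is positive almost everywhere on the union of all spheres meeting K. That
  union is a limit of finite unions of shells, over which the integral is nonpositive, a
  contradiction. This is how averaged information becomes pointwise.\<close>

lemma radial_nonpos_AE:
  fixes f :: "'a::euclidean_space \<Rightarrow> real"
  assumes meas: "f \<in> borel_measurable lebesgue"
    and rad: "\<And>x y. norm x = norm y \<Longrightarrow> g x = g y" "AE x in lebesgue. f x = g x"
    and int: "\<And>a b. R \<le> a \<Longrightarrow> a < b \<Longrightarrow> integrable lebesgue (\<lambda>x. f x * indicator {a<..<b} (sq x))"
    and le: "\<And>a b. R \<le> a \<Longrightarrow> a < b \<Longrightarrow> (LINT x|lebesgue. f x * indicator {a<..<b} (sq x)) \<le> 0"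
    and R: "0 < R"
  shows "AE x in lebesgue. R < sq x \<longrightarrow> f x \<le> 0"
proof -
  note [measurable] = meas
  have sphere: "AE x::'a in lebesgue. sq x \<noteq> a" if "0 < a" for a
  proof -
    have "{x::'a. sq x = a} = sphere 0 (sqrt a)"
      using that by (auto simp: norm_eq_sqrt_inner)
    then have "negligible {x::'a. sq x = a}" by (simp add: negligible_sphere)
    then have "{x::'a. sq x = a} \<in> null_sets lebesgue" by (simp add: negligible_iff_null_sets)
    from AE_not_in[OF this] show ?thesis by simp
  qed
  \<comment> \<open>Half-open shells tile the half-line without overlap; they differ from the open
    ones by a sphere, which is a null set.\<close>
  have half: "integrable lebesgue (\<lambda>x. f x * indicator {a..<b} (sq x)) \<and> (LINT x|lebesgue. f x * indicator {a..<b} (sq x)) \<le> 0"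
    if ab: "R \<le> a" "a < b" for a b
  proof -
    have "AE x in lebesgue. f x * indicator {a<..<b} (sq x) = f x * indicator {a..<b} (sq x)"
      using sphere[of a] R ab by (auto simp: indicator_def elim!: eventually_mono)
    note * = integrable_cong_AE[OF _ _ this] integral_cong_AE[OF _ _ this]
    have [measurable]: "(\<lambda>x. f x * indicator {a<..<b} (sq x)) \<in> borel_measurable lebesgue"
      "(\<lambda>x. f x * indicator {a..<b} (sq x)) \<in> borel_measurable lebesgue"
      by measurable
    show ?thesis using int[OF ab] le[OF ab] by (simp add: *)
  qed
  have gm[measurable]: "g \<in> borel_measurable lebesgue"
    using borel_measurable_AE[OF meas rad(2)] .
  have bd: "AE x in lebesgue. \<not> (R < sq x \<and> sq x < M \<and> 0 < g x)" for M
  proof (rule ccontr)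
    define A where "A = {x. R < sq x \<and> sq x < M \<and> 0 < g x}"
    assume nAE: "\<not> ?thesis"
    have "{x \<in> space lebesgue. R < sq x \<and> sq x < M \<and> 0 < g x} \<in> sets lebesgue" by measurable
    then have As: "A \<in> sets lebesgue" by (simp add: A_def)
    have "A \<notin> null_sets lebesgue"
    proof
      assume "A \<in> null_sets lebesgue"
      from AE_not_in[OF this] nAE show False by (simp add: A_def)
    qed
    then have Apos: "emeasure lebesgue A \<noteq> 0" using As by (auto simp: null_sets_def)
    have RM: "R < M"
    proof (rule ccontr)
      assume "\<not> R < M" then have "A = {}" by (auto simp: A_def)
      then show False using Apos by (simp only: emeasure_empty)
    qed
    have "bounded A"
      using R by (intro boundedI[of _ "sqrt M"]) (auto simp: norm_eq_sqrt_inner A_def)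
    then have Alm: "A \<in> lmeasurable" using As by (rule bounded_set_imp_lmeasurable)
    have "measure lebesgue A \<noteq> 0" using Apos by (auto simp: emeasure_eq_measure2[OF Alm])
    then have mpos: "0 < measure lebesgue A" by (simp add: zero_less_measure_iff)
    \<comment> \<open>Compactness of \<open>K\<close> passes to the set \<open>B\<close> of its
      squared radii, which is thus Borel and keeps a positive distance from both R and M.\<close>
    obtain K where K: "compact K" "K \<subseteq> A" "K \<in> lmeasurable" "0 < measure lebesgue K"
    proof -
      obtain T where T: "closed T" "T \<subseteq> A" "A - T \<in> lmeasurable" "emeasure lebesgue (A - T) < ennreal (measure lebesgue A)"
        by (rule sets_lebesgue_inner_closed[OF As mpos])
      have cT: "compact T" using T(1,2) \<open>bounded A\<close> bounded_subset by (auto simp: compact_eq_bounded_closed)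
      have Tl: "T \<in> lmeasurable" using cT by (rule lmeasurable_compact)
      have "measure lebesgue (A - T) < measure lebesgue A"
        using T(3,4) by (simp add: emeasure_eq_measure2 ennreal_less_iff)
      moreover have "measure lebesgue (A - T) = measure lebesgue A - measure lebesgue T"
        by (rule measurable_measure_Diff[OF Alm _ T(2)]) (use Tl in auto)
      ultimately show ?thesis using that[OF cT T(2) Tl] by simp
    qed
    define B where "B = (\<lambda>x. sq x) ` K"
    have cB: "compact B" unfolding B_def by (intro compact_continuous_image continuous_intros K)
    have Kne: "K \<noteq> {}" using K(4) by auto
    then have Bne: "B \<noteq> {}" by (auto simp: B_def)
    have BRM: "\<And>r. r \<in> B \<Longrightarrow> R < r \<and> r < M" using K(2) by (auto simp: B_def A_def)
    obtain m where m: "m \<in> B" "\<And>r. r \<in> B \<Longrightarrow> m \<le> r"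
      using compact_attains_inf[OF cB Bne] by blast
    obtain mm where mm: "mm \<in> B" "\<And>r. r \<in> B \<Longrightarrow> r \<le> mm"
      using compact_attains_sup[OF cB Bne] by blast
    have "(\<lambda>n. (1/2::real)^n) \<longlonglongrightarrow> 0" by (simp add: LIMSEQ_realpow_zero)
    moreover have "0 < min (m - R) (M - mm)" using BRM[OF m(1)] BRM[OF mm(1)] by auto
    ultimately have "\<forall>\<^sub>F n in sequentially. (1/2::real)^n < min (m - R) (M - mm)"
      by (rule order_tendstoD)
    then obtain N where N: "\<And>n. N \<le> n \<Longrightarrow> (1/2::real)^n < min (m - R) (M - mm)"
      by (auto simp: eventually_sequentially)
    \<comment> \<open>\<open>F n\<close> indexes the dyadic cells of length 2^(-n) that meet
      \<open>B\<close>, and \<open>D n\<close> is their union. For n >= N these cells start at or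
      beyond R, so as a finite union of shells \<open>D n\<close> has nonpositive integral, and
      \<open>D n\<close> shrinks to the closed set \<open>B\<close>.\<close>
    define F where "F n = (\<lambda>r. \<lfloor>2^n * r\<rfloor>) ` B" for n :: nat
    define D where "D n = {r::real. \<lfloor>2^n * r\<rfloor> \<in> F n}" for n :: nat
    have finF: "finite (F n)" for n
      by (rule finite_subset[of _ "{\<lfloor>2^n * m\<rfloor> .. \<lfloor>2^n * mm\<rfloor>}"])
        (auto simp: F_def m mm intro!: floor_mono)
    have Dind: "indicat_real (D n) r = (\<Sum>k\<in>F n. indicator {real_of_int k / 2^n ..< (real_of_int k + 1) / 2^n} r)" for n r
    proof -
      have "indicator {real_of_int k / 2^n ..< (real_of_int k + 1) / 2^n} r = (if k = \<lfloor>2^n * r\<rfloor> then 1 else 0 :: real)" for k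
      proof -
        have "r \<in> {real_of_int k / 2^n ..< (real_of_int k + 1) / 2^n} \<longleftrightarrow> of_int k \<le> 2^n * r \<and> 2^n * r < of_int k + 1"
          by (simp add: pos_divide_le_eq pos_less_divide_eq mult.commute)
        also have "\<dots> \<longleftrightarrow> k = \<lfloor>2^n * r\<rfloor>" by (auto simp: floor_eq_iff eq_commute[of k])
        finally show ?thesis by (simp add: indicator_def)
      qed
      then show ?thesis using finF by (simp add: D_def indicator_def)
    qed
    have Dcl: "\<exists>r'\<in>B. \<bar>r - r'\<bar> \<le> (1/2)^n" if rD: "r \<in> D n" for r n
    proof -
      obtain r' where r': "r' \<in> B" "\<lfloor>2^n * r\<rfloor> = \<lfloor>2^n * r'\<rfloor>" using rD by (auto simp: D_def F_def)
      have "\<bar>2^n * r - 2^n * r'\<bar> \<le> 1" using r'(2) by linarith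
      then have "2^n * \<bar>r - r'\<bar> \<le> 1" by (simp add: right_diff_distrib[symmetric] abs_mult)
      then show ?thesis using r'(1) by (intro bexI[of _ r']) (auto simp: field_simps power_one_over)
    qed
    have Ik: "integrable lebesgue (\<lambda>x. f x * indicator (D n) (sq x)) \<and> (LINT x|lebesgue. f x * indicator (D n) (sq x)) \<le> 0" if n: "N \<le> n" for n
    proof -
      have kk: "R \<le> real_of_int k / 2^n" if kF: "k \<in> F n" for k
      proof -
        obtain r where r: "r \<in> B" "k = \<lfloor>2^n * r\<rfloor>" using kF by (auto simp: F_def)
        have "2^n * r - 1 \<le> of_int k" unfolding r(2) by linarith
        then have "(2^n * r - 1) / 2^n \<le> of_int k / 2^n" by (intro divide_right_mono) auto
        then have "r - (1/2)^n \<le> of_int k / 2^n" by (simp add: diff_divide_distrib power_one_over)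
        then show ?thesis using N[OF n] m(2)[OF r(1)] by linarith
      qed
      have lt: "real_of_int k / 2^n < (real_of_int k + 1) / 2^n" for k
        by (simp add: divide_strict_right_mono)
      note H = half[OF kk lt]
      have eq: "f x * indicator (D n) (sq x) = (\<Sum>k\<in>F n. f x * indicator {real_of_int k / 2^n ..< (real_of_int k + 1) / 2^n} (sq x))" for x
        by (simp add: Dind sum_distrib_left)
      show ?thesis unfolding eq
        using H by (auto intro!: sum_nonpos simp: Bochner_Integration.integral_sum)
    qed
    have lim: "(\<lambda>n. LINT x|lebesgue. f x * indicator (D n) (sq x)) \<longlonglongrightarrow> (LINT x|lebesgue. f x * indicator B (sq x))"
    proof -
      have Bm[measurable]: "B \<in> sets borel" using cB by (simp add: borel_compact)
      have Dm[measurable]: "D n \<in> sets borel" for n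
        unfolding D_def using finF by measurable
      have "(\<lambda>n. LINT x|lebesgue. f x * indicator (D (n + N)) (sq x)) \<longlonglongrightarrow> (LINT x|lebesgue. f x * indicator B (sq x))"
      proof (rule integral_dominated_convergence[where w = "\<lambda>x. norm (f x * indicator {R<..<M} (sq x))"])
        show "integrable lebesgue (\<lambda>x. norm (f x * indicator {R<..<M} (sq x)))"
          using int[of R M] RM by (intro integrable_norm) auto
        show "AE x in lebesgue. norm (f x * indicator (D (n + N)) (sq x)) \<le> norm (f x * indicator {R<..<M} (sq x))" (is "AE x in _. ?P x") for n
        proof (rule AE_I2)
          fix x :: 'a
          have "sq x \<in> {R<..<M}" if xD: "sq x \<in> D (n + N)"
          proof -
            obtain r' where r': "r' \<in> B" "\<bar>sq x - r'\<bar> \<le> (1/2)^(n + N)" using Dcl[OF xD] by blast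
            then show ?thesis using N[of "n + N"] m(2)[OF r'(1)] mm(2)[OF r'(1)] by auto
          qed
          then show "?P x"
            by (auto simp: indicator_def)
        qed
        show "AE x in lebesgue. (\<lambda>n. f x * indicator (D (n + N)) (sq x)) \<longlonglongrightarrow> f x * indicator B (sq x)" (is "AE x in _. ?P x")
        proof (rule AE_I2)
          fix x :: 'a
          have "(\<lambda>n. indicat_real (D n) (sq x)) \<longlonglongrightarrow> indicator B (sq x)"
          proof (cases "sq x \<in> B")
            case True
            then have "sq x \<in> D n" for n by (auto simp: D_def F_def)
            then show ?thesis using True by simp
          next
            case False
            then have "0 < infdist (sq x) B"
              using cB Bne by (simp add: compact_imp_closed infdist_pos_not_in_closed)
            then have "\<forall>\<^sub>F n in sequentially. (1/2::real)^n < infdist (sq x) B"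
              using LIMSEQ_realpow_zero[of "1/2"] by (intro order_tendstoD) auto
            then have "\<forall>\<^sub>F n in sequentially. indicat_real (D n) (sq x) = 0"
            proof eventually_elim
              case (elim n)
              have "sq x \<notin> D n"
              proof
                assume "sq x \<in> D n"
                then obtain r' where r': "r' \<in> B" "\<bar>sq x - r'\<bar> \<le> (1/2)^n" using Dcl by blast
                then have "infdist (sq x) B \<le> (1/2)^n"
                  using infdist_le2[OF r'(1), of "sq x"] by (simp add: dist_real_def)
                then show False using elim by simp
              qed
              then show ?case by simp
            qed
            then show ?thesis using False by (simp add: tendsto_eventually)
          qed
          then show "?P x"
            by (intro tendsto_mult tendsto_const LIMSEQ_ignore_initial_segment)
        qed
      qed measurable
      then show ?thesis by (rule LIMSEQ_offset)
    qed
    have le0: "(LINT x|lebesgue. f x * indicator B (sq x)) \<le> 0"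
      by (rule LIMSEQ_le_const2[OF lim]) (use Ik in blast)
    have Bm[measurable]: "B \<in> sets borel" using cB by (simp add: borel_compact)
    \<comment> \<open>A point whose squared radius lies in \<open>B\<close> has the same norm as
      some point of \<open>K\<close>, so radiality gives positivity there, also outside
      \<open>K\<close>.\<close>
    have ptw: "AE x in lebesgue. 0 \<le> f x * indicator B (sq x) \<and> (x \<in> K \<longrightarrow> 0 < f x * indicator B (sq x))"
      using rad(2)
    proof eventually_elim
      case (elim x)
      have "0 < g x" if xB: "sq x \<in> B"
      proof -
        obtain y where "y \<in> K" "sq x = sq y" using xB by (auto simp: B_def)
        then show ?thesis using rad(1)[of x y] K(2) by (auto simp: norm_eq_sqrt_inner A_def)
      qed
      then show ?case using elim by (auto simp: indicator_def B_def)
    qed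
    have iB: "integrable lebesgue (\<lambda>x. f x * indicator B (sq x))"
      by (rule Bochner_Integration.integrable_bound[OF int[of R M]])
        (use RM BRM in \<open>auto simp: indicator_def intro!: AE_I2\<close>)
    have "0 \<le> (LINT x|lebesgue. f x * indicator B (sq x))"
      by (rule integral_nonneg_AE) (use ptw in \<open>auto elim!: eventually_mono\<close>)
    then have "AE x in lebesgue. f x * indicator B (sq x) = 0"
      using le0 integral_nonneg_eq_0_iff_AE[OF iB] ptw by (auto elim!: eventually_mono)
    then have "AE x in lebesgue. x \<notin> K"
      using ptw by eventually_elim auto
    then have "emeasure lebesgue K = 0"
      using K(3) by (subst (asm) AE_iff_measurable[of K]) auto
    then show False using K(4) by (simp add: measure_def)
  qed
  have "AE x in lebesgue. \<forall>n::nat. \<not> (R < sq x \<and> sq x < real n \<and> 0 < g x)"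
    by (subst AE_all_countable) (use bd in blast)
  then show ?thesis using rad(2)
  proof eventually_elim
    case (elim x)
    obtain n where "sq x < real n" using reals_Archimedean2 by blast
    then show ?case using elim by auto
  qed
qed

section \<open>Cutoffs and antiderivatives in the squared radius\<close>

lemma flat_le_powr: "0 \<le> s \<Longrightarrow> flat j s \<le> s powr (- j)"
  by (simp add: flat_def mult_left_le)

lemma flat_ge_powr: "1 \<le> s \<Longrightarrow> exp (- 1) * s powr (- j) \<le> flat j s"
  by (simp add: flat_def mult.commute mult_left_mono)

lemma flat_bounded_left:
  obtains C where "0 < C" "\<And>s. s \<le> 1 \<Longrightarrow> flat j s \<le> C"
proof -
  have "compact (flat j ` {0..1})"
    by (rule compact_continuous_image[OF smooth_continuous[OF smooth_flat]]) auto
  then obtain B where B: "\<And>y. y \<in> flat j ` {0..1} \<Longrightarrow> norm y \<le> B"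
    using compact_imp_bounded bounded_iff by metis
  have "flat j s \<le> max B 1" if "s \<le> 1" for s
    using B[of "flat j s"] that by (cases "s \<le> 0") auto
  then show ?thesis using that[of "max B 1"] by auto
qed

lemma mult_flat_Suc: "s * flat (j + 1) s = flat j s"
  by (simp add: flat_def powr_diff powr_minus)

lemma cutoff_has_derivative:
  "n \<noteq> 0 \<Longrightarrow> ((\<lambda>s. flat 0 (1 - s / n)) has_real_derivative - (flat 2 (1 - s / n) / n)) (at s)"
proof -
  assume "n \<noteq> 0"
  then have "((\<lambda>s. 1 - s / n) has_real_derivative - (1 / n)) (at s)"
    by (auto intro!: derivative_eq_intros)
  from DERIV_chain2[OF flat_has_derivative this, of 0] show ?thesis by simp
qed

text \<open>Differentiating the cutoff yields 1/n, and its derivative lives on s < n, where s/n <= 1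
  absorbs the extra factor s. The bound is therefore uniform in n.\<close>

lemma cutoff_error_le:
  assumes n: "0 < n" and s: "1 \<le> s" and C: "0 < C" "\<And>s. s \<le> 1 \<Longrightarrow> flat 2 s \<le> C"
  shows "2 * s * (flat 2 (1 - s / n) / n) * flat p s \<le> 2 * C * s powr (- p)"
proof (cases "s < n")
  case True
  have "2 * s * (flat 2 (1 - s / n) / n) * flat p s = 2 * (s / n) * flat 2 (1 - s / n) * flat p s" by simp
  also have "\<dots> \<le> 2 * 1 * C * s powr (- p)"
    using True n s C(1) C(2)[of "1 - s / n"]
    by (intro mult_mono flat_le_powr flat_nonneg mult_nonneg_nonneg) auto
  finally show ?thesis by simp
next
  case False
  then show ?thesis using n C(1) by simp
qed

lemma smooth_affine: "smooth_fun (\<lambda>s::real. a * s + b)"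
  by (intro smooth_add smooth_const smooth_bounded_linear bounded_linear_mult_right)

lemma smooth_cutoff: "smooth_fun (\<lambda>s. flat j (1 - s / n))"
proof -
  have "(\<lambda>s. flat j (1 - s / n)) = (\<lambda>s. flat j ((- (1 / n)) * s + 1))"
    by (rule ext) simp
  then show ?thesis
    using smooth_compose_real[OF smooth_flat smooth_affine[of "- (1 / n)" 1], of j] by (simp only:)
qed

text \<open>Supplies a radial factor whose derivative is a prescribed bump, zero on the inner side
  and at most the length of the interval. In a vector field it isolates one shell under the
  divergence.\<close>

lemma smooth_antiderivative:
  fixes \<rho> :: "real \<Rightarrow> real"
  assumes \<rho>: "smooth_fun \<rho>" "\<And>s. s \<notin> {a<..<b} \<Longrightarrow> \<rho> s = 0" "\<And>s. 0 \<le> \<rho> s" "\<And>s. \<rho> s \<le> 1" and ab: "a < b"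
  obtains \<Phi> where "smooth_fun \<Phi>" "\<And>s. (\<Phi> has_real_derivative \<rho> s) (at s)"
    "\<And>s. s \<le> a \<Longrightarrow> \<Phi> s = 0" "\<And>s. 0 \<le> \<Phi> s" "\<And>s. \<Phi> s \<le> b - a"
proof -
  \<comment> \<open>The integral starts at a - 1 rather than a, so that also s = a is an interior
    point when the fundamental theorem is applied.\<close>
  define \<Phi> where "\<Phi> s = integral {a - 1..s} \<rho>" for s
  have cont: "continuous_on A \<rho>" for A using smooth_continuous[OF \<rho>(1)] .
  have left: "\<Phi> s = 0" if "s \<le> a" for s
  proof -
    have "\<Phi> s = integral {a - 1..s} (\<lambda>_. 0)"
      unfolding \<Phi>_def using \<rho>(2) that by (intro integral_cong) auto
    then show ?thesis by simp
  qed
  have D: "(\<Phi> has_real_derivative \<rho> s) (at s)" for s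
  proof (cases "s < a")
    case True
    have "((\<lambda>_. 0) has_real_derivative 0) (at s)" by simp
    then have "(\<Phi> has_real_derivative 0) (at s)"
      by (rule has_field_derivative_transform_within_open[of _ _ _ "{..<a}"]) (use True left in auto)
    then show ?thesis using True \<rho>(2)[of s] by simp
  next
    case False
    have "(\<Phi> has_real_derivative \<rho> s) (at s within {a - 1..s + 1})"
      unfolding \<Phi>_def by (rule integral_has_real_derivative[OF cont]) (use False in auto)
    moreover have "at s within {a - 1..s + 1} = at s"
      by (rule at_within_interior) (use False in auto)
    ultimately show ?thesis by simp
  qed
  have sm: "smooth_fun \<Phi>"
  proof -
    have "Ck (Suc k) \<Phi>" for k
      by (rule Ck_real_derivativeI[where f' = \<rho>])
        (use D \<rho>(1) in \<open>auto simp: smooth_fun_def simp flip: has_real_derivative_iff_has_vector_derivative\<close>)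
    from Ck_SucD[OF this] show ?thesis unfolding smooth_fun_def ..
  qed
  have nn: "0 \<le> \<Phi> s" for s
    unfolding \<Phi>_def by (rule integral_nonneg[OF integrable_continuous_real[OF cont]]) (rule \<rho>(3))
  have mono: "\<Phi> s \<le> \<Phi> t" if "s \<le> t" for s t
    by (rule DERIV_nonneg_imp_nondecreasing[OF that]) (use D \<rho>(3) in blast)
  have up: "\<Phi> s \<le> s - a" if "a \<le> s" for s
  proof -
    have "a - \<Phi> a \<le> s - \<Phi> s"
    proof (rule DERIV_nonneg_imp_nondecreasing[OF that, of "\<lambda>s. s - \<Phi> s"])
      fix x
      have "((\<lambda>s. s - \<Phi> s) has_real_derivative 1 - \<rho> x) (at x)"
        by (intro derivative_intros D)
      then show "\<exists>y. ((\<lambda>s. s - \<Phi> s) has_real_derivative y) (at x) \<and> 0 \<le> y"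
        using \<rho>(4)[of x] by auto
    qed
    then show ?thesis using left[of a] by simp
  qed
  have "\<Phi> s \<le> b - a" for s
  proof (cases "s \<le> b")
    case True
    then show ?thesis using mono[OF True] up[of b] ab by simp
  next
    case False
    have "- \<Phi> b \<le> - \<Phi> s"
    proof (rule DERIV_nonneg_imp_nondecreasing[of b s "\<lambda>s. - \<Phi> s"])
      fix x assume "b \<le> x"
      then have "((\<lambda>s. - \<Phi> s) has_real_derivative - 0) (at x)"
        using \<rho>(2)[of x] D[of x] by (intro DERIV_minus) auto
      then show "\<exists>y. ((\<lambda>s. - \<Phi> s) has_real_derivative y) (at x) \<and> 0 \<le> y" by auto
    qed (use False in auto)
    then show ?thesis using up[of b] ab by simp
  qed
  from that[OF sm D left nn this] show ?thesis .
qed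

lemma integrable_real_mult_L2:
  assumes "(\<lambda>x. complex_of_real (f x)) \<in> L2" "(\<lambda>x. complex_of_real (g x)) \<in> L2"
  shows "integrable lebesgue (\<lambda>x. f x * g x)"
  using integrable_Re[OF L2_mult_integrable[OF assms]] by simp

lemma L2_norm: "f \<in> L2 \<Longrightarrow> (\<lambda>x. complex_of_real (norm (f x))) \<in> L2"
  by (rule L2_bound[of f _ 1]) auto

section \<open>Shell averages of a positive radial profile\<close>

locale radial_profile =
  fixes Q :: "'a::euclidean_space \<Rightarrow> complex" and G :: "'a \<Rightarrow> 'a \<Rightarrow> complex"
  assumes dim: "3 \<le> DIM('a)" and Q_L2: "Q \<in> L2" and G_L2: "\<And>b. b \<in> Basis \<Longrightarrow> G b \<in> L2"
    and G_weak: "\<And>b. b \<in> Basis \<Longrightarrow> weak_partial Q b (G b)"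
    and pos: "positive_fun Q" and rad: "radial Q"
begin

definition q :: "'a \<Rightarrow> real" where "q x = Re (Q x)"

definition G_abs :: "'a \<Rightarrow> real" where "G_abs x = (\<Sum>b\<in>Basis. norm (G b x))"

text \<open>Gradient mass outside the ball |x|^2 < a with weight |x|^(1-d), the length of the field
  x |x|^(-d). This weight is square integrable at infinity exactly for d > 2, which is where the
  dimension enters.\<close>

definition tail :: "real \<Rightarrow> real" where
  "tail a = (LINT x|lebesgue. G_abs x * (indicator {a..} (sq x) * sq x powr ((1 - real DIM('a)) / 2)))"

lemma q_L2: "(\<lambda>x. complex_of_real (q x)) \<in> L2"
  by (rule L2_bound[OF Q_L2, of _ 1]) (use L2_measurable[OF Q_L2] in \<open>auto simp: q_def abs_Re_le_cmod\<close>)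

lemma q_measurable [measurable]: "q \<in> borel_measurable lebesgue"
  unfolding q_def[abs_def] using L2_measurable[OF Q_L2] by measurable

lemma q_pos: "AE x in lebesgue. 0 < q x"
  using pos by (auto simp: positive_fun_def q_def)

lemma Q_eq_q: "AE x in lebesgue. Q x = complex_of_real (q x)"
  using pos by (auto simp: positive_fun_def q_def complex_eq_iff elim!: eventually_mono)

lemma q_nonneg: "AE x in lebesgue. 0 \<le> q x"
  using q_pos by (auto elim!: eventually_mono)

lemma G_abs_L2: "(\<lambda>x. complex_of_real (G_abs x)) \<in> L2"
proof -
  have "(\<lambda>x. complex_of_real (\<Sum>b\<in>B. norm (G b x))) \<in> L2" if "finite B" "B \<subseteq> Basis" for B
    using that
  proof (induction B rule: finite_induct)
    case empty
    show ?case by (simp add: L2_def)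
  next
    case (insert b B)
    then show ?case using L2_add[OF L2_norm[OF G_L2[of b]], of "\<lambda>x. complex_of_real (\<Sum>b\<in>B. norm (G b x))"] by simp
  qed
  then show ?thesis by (simp add: G_abs_def)
qed

lemma G_abs_nonneg: "0 \<le> G_abs x"
  by (simp add: G_abs_def sum_nonneg)

lemma G_abs_measurable [measurable]: "G_abs \<in> borel_measurable lebesgue"
proof -
  have "(\<lambda>x. Re (complex_of_real (G_abs x))) \<in> borel_measurable lebesgue"
    using L2_measurable[OF G_abs_L2] by measurable
  then show ?thesis by simp
qed

lemma tail_integrable:
  assumes "1 \<le> a"
  shows "integrable lebesgue (\<lambda>x. G_abs x * (indicator {a..} (sq x) * sq x powr ((1 - real DIM('a)) / 2)))"
proof (rule integrable_real_mult_L2[OF G_abs_L2])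
  have *: "(\<lambda>x::'a. complex_of_real (indicator {1..} (sq x) * sq x powr (- ((real DIM('a) - 1) / 2)))) \<in> L2"
    by (rule L2_inverse_power_at_infinity) (use dim in simp)
  have e: "- ((real DIM('a) - 1) / 2) = (1 - real DIM('a)) / 2" by (simp add: field_simps)
  show "(\<lambda>x::'a. complex_of_real (indicator {a..} (sq x) * sq x powr ((1 - real DIM('a)) / 2))) \<in> L2"
  proof (rule L2_bound[OF *[unfolded e], of _ 1])
    show "AE x::'a in lebesgue. norm (complex_of_real (indicator {a..} (sq x) * sq x powr ((1 - real DIM('a)) / 2)))
       \<le> 1 * norm (complex_of_real (indicator {1..} (sq x) * sq x powr ((1 - real DIM('a)) / 2)))"
      using assms by (intro AE_I2) (simp add: indicator_def)
  qed measurable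
qed

text \<open>The weight is |x|^(-d), square integrable at infinity. It dominates the cutoff errors
  below and is the starting point of the moment bootstrap.\<close>

lemma q_weight_integrable:
  "integrable lebesgue (\<lambda>x. q x * (indicator {1..} (sq x) * sq x powr (- (DIM('a) / 2))))"
  by (rule integrable_real_mult_L2[OF q_L2 L2_inverse_power_at_infinity]) (use dim in simp)

text \<open>The weak derivatives are tested with the components of the field x P(|x|^2) and summed
  over the coordinates; d P + 2 s P' is the divergence of that field.\<close>

lemma radial_divergence:
  fixes P P' :: "real \<Rightarrow> real"
  assumes P: "smooth_fun P" "\<And>s. (P has_real_derivative P' s) (at s)" "\<And>s. M \<le> s \<Longrightarrow> P s = 0"
  shows "integrable lebesgue (\<lambda>x. q x * (DIM('a) * P (sq x) + 2 * sq x * P' (sq x)))" (is ?A)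
    and "integrable lebesgue (\<lambda>x. (\<Sum>b\<in>Basis. Re (G b x) * (x \<bullet> b)) * P (sq x))" (is ?B)
    and "(LINT x|lebesgue. q x * (DIM('a) * P (sq x) + 2 * sq x * P' (sq x)))
      = - (LINT x|lebesgue. (\<Sum>b\<in>Basis. Re (G b x) * (x \<bullet> b)) * P (sq x))" (is ?C)
proof -
  define \<psi> where "\<psi> b x = (x \<bullet> b) *\<^sub>R complex_of_real (P (sq x))" for b x :: 'a
  have V: "((\<lambda>s. complex_of_real (P s)) has_vector_derivative complex_of_real (P' s)) (at s)" for s
    by (rule bounded_linear.has_vector_derivative[OF bounded_linear_of_real])
      (use P(2) in \<open>simp add: has_real_derivative_iff_has_vector_derivative\<close>)
  have t: "test_fun (\<psi> b)" for b
  proof (rule test_funI[of _ "sqrt \<bar>M\<bar>"])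
    have 1: "smooth_fun (\<lambda>x::'a. complex_of_real (x \<bullet> b))"
      by (rule smooth_bounded_linear) (rule bounded_linear_compose[OF bounded_linear_of_real bounded_linear_inner_left])
    have 2: "smooth_fun (\<lambda>x::'a. complex_of_real (P (sq x)))"
      by (rule smooth_bounded_linear_compose[OF bounded_linear_of_real smooth_compose_real[OF P(1) smooth_inner_self]])
    show "smooth_fun (\<psi> b)"
      using smooth_mult[OF 1 2] by (simp add: \<psi>_def[abs_def] scaleR_conv_of_real)
    fix x :: 'a assume "sqrt \<bar>M\<bar> < norm x"
    then have "M \<le> sq x" by (simp add: norm_eq_sqrt_inner)
    then show "\<psi> b x = 0" by (simp add: \<psi>_def P(3))
  qed
  have pd: "pd b (\<psi> b) x = complex_of_real (P (sq x) + 2 * (x \<bullet> b)^2 * P' (sq x))" if "b \<in> Basis" for b x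
    using pd_coord_radial[OF V that] by (simp add: \<psi>_def[abs_def] scaleR_conv_of_real)
  have eq: "(LINT x|lebesgue. Q x * pd b (\<psi> b) x) = - (LINT x|lebesgue. G b x * \<psi> b x)" if "b \<in> Basis" for b
    using G_weak[OF that] t unfolding weak_partial_def by blast
  have sp: "(\<Sum>b\<in>Basis. Q x * pd b (\<psi> b) x) = Q x * complex_of_real (DIM('a) * P (sq x) + 2 * sq x * P' (sq x))" for x
  proof -
    have "(\<Sum>b\<in>Basis. Q x * pd b (\<psi> b) x) = Q x * complex_of_real (\<Sum>b\<in>Basis. P (sq x) + 2 * (x \<bullet> b)^2 * P' (sq x))"
      by (simp add: pd sum_distrib_left)
    also have "(\<Sum>b\<in>Basis. P (sq x) + 2 * (x \<bullet> b)^2 * P' (sq x)) = DIM('a) * P (sq x) + 2 * (\<Sum>b\<in>Basis. (x \<bullet> b)^2) * P' (sq x)"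
      by (simp add: sum.distrib sum_distrib_left sum_distrib_right)
    finally show ?thesis by (simp add: sum_coord_sq)
  qed
  have sg: "(\<Sum>b\<in>Basis. G b x * \<psi> b x) = (\<Sum>b\<in>Basis. G b x * of_real (x \<bullet> b)) * of_real (P (sq x))" for x
    unfolding \<psi>_def scaleR_conv_of_real sum_distrib_right by (simp only: mult.assoc)
  have i1: "integrable lebesgue (\<lambda>x. Q x * complex_of_real (DIM('a) * P (sq x) + 2 * sq x * P' (sq x)))"
    unfolding sp[symmetric] by (intro Bochner_Integration.integrable_sum L2_test_integrable Q_L2 test_fun_pd t)
  have i2: "integrable lebesgue (\<lambda>x. (\<Sum>b\<in>Basis. G b x * of_real (x \<bullet> b)) * of_real (P (sq x)))"
    unfolding sg[symmetric] by (intro Bochner_Integration.integrable_sum L2_test_integrable G_L2 t)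
  have "(LINT x|lebesgue. Q x * complex_of_real (DIM('a) * P (sq x) + 2 * sq x * P' (sq x)))
    = (\<Sum>b\<in>Basis. LINT x|lebesgue. Q x * pd b (\<psi> b) x)"
    unfolding sp[symmetric] by (intro Bochner_Integration.integral_sum L2_test_integrable Q_L2 test_fun_pd t)
  also have "\<dots> = - (\<Sum>b\<in>Basis. LINT x|lebesgue. G b x * \<psi> b x)"
    by (simp add: eq sum_negf)
  also have "(\<Sum>b\<in>Basis. LINT x|lebesgue. G b x * \<psi> b x) = (LINT x|lebesgue. (\<Sum>b\<in>Basis. G b x * of_real (x \<bullet> b)) * of_real (P (sq x)))"
    unfolding sg[symmetric] by (intro Bochner_Integration.integral_sum[symmetric] L2_test_integrable G_L2 t)
  finally have E: "(LINT x|lebesgue. Q x * complex_of_real (DIM('a) * P (sq x) + 2 * sq x * P' (sq x)))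
    = - (LINT x|lebesgue. (\<Sum>b\<in>Basis. G b x * of_real (x \<bullet> b)) * of_real (P (sq x)))" .
  have r1: "Re (Q x * complex_of_real y) = q x * y" for x y by (simp add: q_def)
  have r2: "Re ((\<Sum>b\<in>Basis. G b x * of_real (x \<bullet> b)) * of_real (P (sq x))) = (\<Sum>b\<in>Basis. Re (G b x) * (x \<bullet> b)) * P (sq x)" for x
    by simp
  show ?A using integrable_Re[OF i1] unfolding r1 .
  show ?B using integrable_Re[OF i2] unfolding r2 .
  show ?C using arg_cong[OF E, of Re] unfolding integral_Re[OF i1, symmetric] integral_Re[OF i2, symmetric] r1 r2 uminus_complex.sel .
qed

text \<open>The field is x P with P = \<Phi> times cutoff times F, where F imitates |x|^(-d). Since
  x |x|^(-d) is divergence free away from 0, the divergence consists of the wanted shell term with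
  \<rho> = \<Phi>', an error from the cutoff, and a term of favourable sign. The divergence identity
  trades this for the gradient, weighted as in \<open>tail\<close>.\<close>

lemma smooth_shell_bound:
  fixes \<rho> :: "real \<Rightarrow> real"
  assumes a: "1 \<le> a" "a < b" and n: "0 < n"
    and \<rho>: "smooth_fun \<rho>" "\<And>s. s \<notin> {a<..<b} \<Longrightarrow> \<rho> s = 0" "\<And>s. 0 \<le> \<rho> s" "\<And>s. \<rho> s \<le> 1"
  defines "F \<equiv> flat (real DIM('a) / 2)"
  shows "(LINT x|lebesgue. q x * (2 * sq x * \<rho> (sq x) * flat 0 (1 - sq x / n) * F (sq x)))
    \<le> (b - a) * tail a + (b - a) * (LINT x|lebesgue. q x * (indicator {a..} (sq x) * (2 * sq x * (flat 2 (1 - sq x / n) / n) * F (sq x))))"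
    (is "?L \<le> _ + _ * ?E")
    and "integrable lebesgue (\<lambda>x. q x * (indicator {a..} (sq x) * (2 * sq x * (flat 2 (1 - sq x / n) / n) * F (sq x))))"
proof -
  obtain \<Phi> where \<Phi>: "smooth_fun \<Phi>" "\<And>s. (\<Phi> has_real_derivative \<rho> s) (at s)"
    "\<And>s. s \<le> a \<Longrightarrow> \<Phi> s = 0" "\<And>s. 0 \<le> \<Phi> s" "\<And>s. \<Phi> s \<le> b - a"
    using smooth_antiderivative[OF \<rho> a(2)] by metis
  let ?d = "real DIM('a)" and ?\<chi> = "\<lambda>s. flat 0 (1 - s / n)" and ?\<chi>' = "\<lambda>s. flat 2 (1 - s / n) / n"
  define P where "P s = \<Phi> s * ?\<chi> s * F s" for s
  define P' where "P' s = (\<rho> s * ?\<chi> s + \<Phi> s * (- ?\<chi>' s)) * F s + \<Phi> s * ?\<chi> s * (flat (?d / 2 + 2) s - ?d / 2 * flat (?d / 2 + 1) s)" for s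
  have Psm: "smooth_fun P"
    unfolding P_def[abs_def] F_def by (intro smooth_mult smooth_cutoff \<Phi>(1) smooth_flat)
  have Pd: "(P has_real_derivative P' s) (at s)" for s
    unfolding P_def[abs_def] F_def
    by (rule DERIV_cong[OF DERIV_mult[OF DERIV_mult[OF \<Phi>(2) cutoff_has_derivative] flat_has_derivative]])
      (use n in \<open>simp_all add: P'_def F_def algebra_simps\<close>)
  have P0: "P s = 0" if "n \<le> s" for s using that n by (simp add: P_def)
  have key: "?d * P s + 2 * s * P' s = 2 * s * \<rho> s * ?\<chi> s * F s - 2 * s * \<Phi> s * ?\<chi>' s * F s + 2 * s * \<Phi> s * ?\<chi> s * flat (?d / 2 + 2) s" for s
  proof -
    have "s * flat (?d / 2 + 1) s = F s" unfolding F_def by (rule mult_flat_Suc)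
    then have "2 * s * (\<Phi> s * ?\<chi> s * (?d / 2 * flat (?d / 2 + 1) s)) = ?d * P s"
      by (simp add: P_def mult_ac)
    then show ?thesis by (simp add: P'_def algebra_simps)
  qed
  have F0: "0 \<le> F s" for s by (simp add: F_def flat_nonneg)
  obtain C where C: "0 < C" "\<And>s. s \<le> 1 \<Longrightarrow> flat 2 s \<le> C" using flat_bounded_left by blast
  have [measurable]: "(\<lambda>s. flat j s) \<in> borel_measurable borel" for j
    by (intro borel_measurable_continuous_onI smooth_continuous smooth_flat)
  have [measurable]: "\<rho> \<in> borel_measurable borel" "\<Phi> \<in> borel_measurable borel" "F \<in> borel_measurable borel"
    unfolding F_def by (intro borel_measurable_continuous_onI smooth_continuous \<rho>(1) \<Phi>(1) smooth_flat)+
  show iE: "integrable lebesgue (\<lambda>x. q x * (indicator {a..} (sq x) * (2 * sq x * (flat 2 (1 - sq x / n) / n) * F (sq x))))"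
  proof (rule Bochner_Integration.integrable_bound)
    show "integrable lebesgue (\<lambda>x. 2 * C * (q x * (indicator {1..} (sq x) * sq x powr (- (?d / 2)))))"
      by (intro integrable_mult_right q_weight_integrable)
    show "AE x in lebesgue. norm (q x * (indicator {a..} (sq x) * (2 * sq x * (flat 2 (1 - sq x / n) / n) * F (sq x))))
       \<le> norm (2 * C * (q x * (indicator {1..} (sq x) * sq x powr (- (?d / 2)))))" (is "AE x in _. ?P x")
    proof (rule AE_I2)
      fix x :: 'a
      have "norm (q x * (indicator {a..} (sq x) * (2 * sq x * (flat 2 (1 - sq x / n) / n) * F (sq x))))
        = \<bar>q x\<bar> * (indicator {a..} (sq x) * (2 * sq x * (flat 2 (1 - sq x / n) / n) * F (sq x)))"
        using n F0 flat_nonneg by (simp add: abs_mult)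
      also have "\<dots> \<le> \<bar>q x\<bar> * (indicator {1..} (sq x) * (2 * C * sq x powr (- (?d / 2))))"
        using cutoff_error_le[OF n _ C, of "sq x" "?d / 2"] a C(1) unfolding F_def
        by (intro mult_left_mono) (auto simp: indicator_def)
      also have "\<dots> = norm (2 * C * (q x * (indicator {1..} (sq x) * sq x powr (- (?d / 2)))))"
        using C(1) by (simp add: abs_mult)
      finally show "?P x" .
    qed
  qed measurable
  note RD = radial_divergence[of P P' n, OF Psm Pd P0]
  have iL: "integrable lebesgue (\<lambda>x. q x * (2 * sq x * \<rho> (sq x) * ?\<chi> (sq x) * F (sq x)))"
  proof (rule integrable_real_mult_L2[OF q_L2])
    have c: "continuous_on UNIV (\<lambda>x::'a. complex_of_real (2 * sq x * \<rho> (sq x) * ?\<chi> (sq x) * F (sq x)))"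
      unfolding F_def
      by (intro continuous_intros continuous_on_compose2[OF smooth_continuous[OF \<rho>(1), of UNIV]]
         continuous_on_compose2[OF smooth_continuous[OF smooth_cutoff, of UNIV]]
         continuous_on_compose2[OF smooth_continuous[OF smooth_flat, of UNIV]]) auto
    show "(\<lambda>x::'a. complex_of_real (2 * sq x * \<rho> (sq x) * ?\<chi> (sq x) * F (sq x))) \<in> L2"
      by (rule L2_continuous_support[OF c, of "sqrt b"]) (use \<rho>(2) in \<open>auto simp: norm_eq_sqrt_inner\<close>)
  qed
  have "?L \<le> (LINT x|lebesgue. q x * (?d * P (sq x) + 2 * sq x * P' (sq x))
     + (b - a) * (q x * (indicator {a..} (sq x) * (2 * sq x * ?\<chi>' (sq x) * F (sq x)))))"
  proof (rule integral_mono_AE[OF iL])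
    show "integrable lebesgue (\<lambda>x. q x * (?d * P (sq x) + 2 * sq x * P' (sq x))
     + (b - a) * (q x * (indicator {a..} (sq x) * (2 * sq x * ?\<chi>' (sq x) * F (sq x)))))"
      by (intro Bochner_Integration.integrable_add RD(1) integrable_mult_right iE)
    show "AE x in lebesgue. q x * (2 * sq x * \<rho> (sq x) * ?\<chi> (sq x) * F (sq x))
      \<le> q x * (?d * P (sq x) + 2 * sq x * P' (sq x))
     + (b - a) * (q x * (indicator {a..} (sq x) * (2 * sq x * ?\<chi>' (sq x) * F (sq x))))"
      using q_nonneg
    proof eventually_elim
      case (elim x)
      define s where "s = sq x"
      have s0: "0 \<le> s" by (simp add: s_def)
      have c1: "0 \<le> 2 * s * \<Phi> s * ?\<chi> s * flat (?d / 2 + 2) s"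
        using s0 \<Phi>(4) flat_nonneg by (intro mult_nonneg_nonneg) auto
      have Z: "0 \<le> 2 * s * ?\<chi>' s * F s" using s0 n F0 flat_nonneg by (intro mult_nonneg_nonneg divide_nonneg_nonneg) auto
      have "\<Phi> s * (2 * s * ?\<chi>' s * F s) \<le> ((b - a) * indicator {a..} s) * (2 * s * ?\<chi>' s * F s)"
        using \<Phi>(3)[of s] \<Phi>(5)[of s] Z by (intro mult_right_mono) (auto simp: indicator_def)
      then have "2 * s * \<rho> s * ?\<chi> s * F s \<le> (?d * P s + 2 * s * P' s) + (b - a) * (indicator {a..} s * (2 * s * ?\<chi>' s * F s))"
        unfolding key using c1 by (simp add: algebra_simps)
      from mult_left_mono[OF this elim] show ?case
        unfolding s_def by (simp add: distrib_left mult.left_commute)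
    qed
  qed
  also have "\<dots> = (LINT x|lebesgue. q x * (?d * P (sq x) + 2 * sq x * P' (sq x))) + (b - a) * ?E"
    by (simp only: Bochner_Integration.integral_add[OF RD(1) integrable_mult_right[OF iE]] integral_mult_right_zero)
  also have "(LINT x|lebesgue. q x * (?d * P (sq x) + 2 * sq x * P' (sq x))) \<le> (b - a) * tail a"
  proof -
    have "- (LINT x|lebesgue. (\<Sum>b\<in>Basis. Re (G b x) * (x \<bullet> b)) * P (sq x)) = (LINT x|lebesgue. - ((\<Sum>b\<in>Basis. Re (G b x) * (x \<bullet> b)) * P (sq x)))"
      by simp
    also have "\<dots> \<le> (LINT x|lebesgue. (b - a) * (G_abs x * (indicator {a..} (sq x) * sq x powr ((1 - ?d) / 2))))"
    proof (rule integral_mono)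
      show "integrable lebesgue (\<lambda>x. - ((\<Sum>b\<in>Basis. Re (G b x) * (x \<bullet> b)) * P (sq x)))" using RD(2) by simp
      show "integrable lebesgue (\<lambda>x. (b - a) * (G_abs x * (indicator {a..} (sq x) * sq x powr ((1 - ?d) / 2))))"
        by (intro integrable_mult_right tail_integrable a)
      fix x :: 'a
      have "\<bar>\<Sum>b\<in>Basis. Re (G b x) * (x \<bullet> b)\<bar> \<le> (\<Sum>b\<in>Basis. norm (G b x) * norm x)"
        by (rule order_trans[OF sum_abs])
          (auto simp: abs_mult intro!: sum_mono mult_mono abs_Re_le_cmod Basis_le_norm)
      then have g: "\<bar>\<Sum>b\<in>Basis. Re (G b x) * (x \<bullet> b)\<bar> \<le> G_abs x * norm x"
        by (simp add: G_abs_def sum_distrib_right)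
      \<comment> \<open>The length of x contributes the exponent 1/2 in s, which turns s^(-d/2) into
        the weight of \<open>tail\<close>.\<close>
      have "norm x * P (sq x) \<le> (b - a) * (indicator {a..} (sq x) * sq x powr ((1 - ?d) / 2))"
      proof (cases "a \<le> sq x")
        case True
        then have s1: "1 \<le> sq x" using a by simp
        have "P (sq x) \<le> (b - a) * 1 * sq x powr (- (?d / 2))"
          unfolding P_def F_def using s1 \<Phi>(4,5) a
          by (intro mult_mono flat_0_le_1 flat_le_powr mult_nonneg_nonneg flat_nonneg) auto
        then have "norm x * P (sq x) \<le> norm x * ((b - a) * sq x powr (- (?d / 2)))"
          by (intro mult_left_mono) auto
        also have "norm x * ((b - a) * sq x powr (- (?d / 2))) = (b - a) * (sq x powr (1 / 2) * sq x powr (- (?d / 2)))"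
          by (simp add: norm_eq_sqrt_inner powr_half_sqrt)
        also have "sq x powr (1 / 2) * sq x powr (- (?d / 2)) = sq x powr ((1 - ?d) / 2)"
          by (simp add: powr_add[symmetric] diff_divide_distrib)
        finally show ?thesis using True by simp
      next
        case False
        then show ?thesis using \<Phi>(3)[of "sq x"] a by (simp add: P_def)
      qed
      then have "G_abs x * (norm x * P (sq x)) \<le> G_abs x * ((b - a) * (indicator {a..} (sq x) * sq x powr ((1 - ?d) / 2)))"
        by (intro mult_left_mono G_abs_nonneg)
      moreover have "- ((\<Sum>b\<in>Basis. Re (G b x) * (x \<bullet> b)) * P (sq x)) \<le> G_abs x * norm x * P (sq x)"
      proof -
        have "0 \<le> P (sq x)" unfolding P_def using \<Phi>(4) F0 flat_nonneg by (intro mult_nonneg_nonneg) auto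
        then have "\<bar>\<Sum>b\<in>Basis. Re (G b x) * (x \<bullet> b)\<bar> * P (sq x) \<le> G_abs x * norm x * P (sq x)"
          using g by (rule mult_right_mono[rotated])
        moreover have "- ((\<Sum>b\<in>Basis. Re (G b x) * (x \<bullet> b)) * P (sq x)) \<le> \<bar>\<Sum>b\<in>Basis. Re (G b x) * (x \<bullet> b)\<bar> * P (sq x)"
          using \<open>0 \<le> P (sq x)\<close> by (simp only: mult_minus_left[symmetric]) (intro mult_right_mono, auto)
        ultimately show ?thesis by linarith
      qed
      ultimately show "- ((\<Sum>b\<in>Basis. Re (G b x) * (x \<bullet> b)) * P (sq x))
         \<le> (b - a) * (G_abs x * (indicator {a..} (sq x) * sq x powr ((1 - ?d) / 2)))"
        by (simp add: mult_ac)
    qed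
    also have "\<dots> = (b - a) * tail a" by (simp add: tail_def)
    finally show ?thesis using RD(3) by linarith
  qed
  finally show "?L \<le> (b - a) * tail a + (b - a) * ?E" by simp
qed

end

lemma flat_measurable [measurable]: "flat j \<in> borel_measurable borel"
  by (intro borel_measurable_continuous_onI smooth_continuous smooth_flat)

lemma box_bump_measurable [measurable]: "box_bump n a b \<in> borel_measurable borel" for a b :: real
  unfolding box_bump_def[abs_def] by measurable

lemma smooth_box_bump_real: "smooth_fun (box_bump n a b)" for a b :: real
proof -
  have "box_bump n a b = (\<lambda>x. flat 0 (real n * x + (- (real n * a))) * flat 0 ((- real n) * x + real n * b))"
    by (rule ext) (simp add: box_bump_def right_diff_distrib)
  then show ?thesis
    using smooth_mult[OF smooth_compose_real[OF smooth_flat smooth_affine] smooth_compose_real[OF smooth_flat smooth_affine]]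
    by metis
qed

text \<open>The shell has volume V (b^(d/2) - a^(d/2)), at least V (b - a) b^(d/2-1) because a^(d/2)
  <= a b^(d/2-1). The weight b^(1-d/2) removes the last factor, so that shells are measured by b -
  a, the scale on which the gradient controls averages.\<close>

lemma shell_weight_ge:
  assumes "0 \<le> a" "a < b" and d: "2 \<le> DIM('a::euclidean_space)"
  shows "integrable lebesgue (\<lambda>x::'a. indicator {a<..<b} (sq x) * b powr (1 - DIM('a) / 2))"
    and "unit_ball_vol (real DIM('a)) * (b - a) \<le> (LINT x|lebesgue. indicator {a<..<b} ((x::'a) \<bullet> x) * b powr (1 - DIM('a) / 2))"
proof -
  let ?d = "DIM('a)" and ?A = "ball 0 (sqrt b) - cball 0 (sqrt a) :: 'a set" and ?V = "unit_ball_vol (real DIM('a))"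
  have ind: "indicat_real {a<..<b} (sq x) = indicator ?A x" for x :: 'a
    by (auto simp: indicator_def norm_eq_sqrt_inner)
  have A: "?A \<in> lmeasurable" by (intro fmeasurable.Diff) auto
  show "integrable lebesgue (\<lambda>x::'a. indicator {a<..<b} (sq x) * b powr (1 - DIM('a) / 2))"
    unfolding ind using A by (intro integrable_mult_left) (simp add: integrable_indicator_iff fmeasurable_def)
  have cb: "cball 0 (sqrt a) \<subseteq> (ball 0 (sqrt b) :: 'a set)" by (auto intro: le_less_trans[OF _ real_sqrt_less_mono[OF assms(2)]])
  have "measure lebesgue ?A = measure lebesgue (ball 0 (sqrt b) :: 'a set) - measure lebesgue (cball 0 (sqrt a) :: 'a set)"
    by (rule measurable_measure_Diff[OF lmeasurable_ball _ cb]) simp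
  also have "\<dots> = ?V * (sqrt b ^ ?d - sqrt a ^ ?d)"
    using assms by (simp add: content_ball content_cball right_diff_distrib)
  finally have mA: "measure lebesgue ?A = ?V * (sqrt b ^ ?d - sqrt a ^ ?d)" .
  have "(b - a) * sqrt b ^ (?d - 2) \<le> sqrt b ^ ?d - sqrt a ^ ?d"
  proof -
    have e: "?d = 2 + (?d - 2)" using d by simp
    have "sqrt a ^ ?d \<le> a * sqrt b ^ (?d - 2)"
      using assms by (subst e, subst power_add) (auto intro!: mult_left_mono power_mono)
    moreover have "sqrt b ^ ?d = b * sqrt b ^ (?d - 2)"
      using assms by (subst e, subst power_add) simp
    ultimately show ?thesis by (simp add: algebra_simps)
  qed
  then have "?V * ((b - a) * sqrt b ^ (?d - 2)) * b powr (1 - ?d / 2) \<le> measure lebesgue ?A * b powr (1 - ?d / 2)"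
    unfolding mA by (intro mult_right_mono mult_left_mono) auto
  moreover have "sqrt b ^ (?d - 2) * b powr (1 - ?d / 2) = 1"
  proof -
    have "sqrt b ^ (?d - 2) = (b powr (1/2)) powr (real (?d - 2))"
      using assms by (subst powr_realpow) (auto simp: powr_half_sqrt)
    also have "\<dots> = b powr (?d / 2 - 1)"
      using d by (simp add: powr_powr of_nat_diff diff_divide_distrib)
    finally show ?thesis using assms by (simp add: powr_add[symmetric])
  qed
  ultimately have "?V * (b - a) \<le> measure lebesgue ?A * b powr (1 - ?d / 2)"
    by (simp add: mult.assoc)
  also have "\<dots> = (LINT x|lebesgue. indicator {a<..<b} ((x::'a) \<bullet> x) * b powr (1 - ?d / 2))"
    unfolding ind using A by simp
  finally show "?V * (b - a) \<le> (LINT x|lebesgue. indicator {a<..<b} ((x::'a) \<bullet> x) * b powr (1 - ?d / 2))" .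
qed

context radial_profile
begin

lemma q_bounded_shell_integrable:
  assumes "1 \<le> a" and h: "h \<in> borel_measurable borel" "\<And>s. s \<in> {a<..<b} \<Longrightarrow> \<bar>h s\<bar> \<le> C"
  shows "integrable lebesgue (\<lambda>x. q x * (indicator {a<..<b} (sq x) * h (sq x)))"
proof (rule integrable_real_mult_L2[OF q_L2])
  note [measurable] = h(1)
  show "(\<lambda>x::'a. complex_of_real (indicator {a<..<b} (sq x) * h (sq x))) \<in> L2"
  proof (rule L2_bounded_support[of _ "\<bar>C\<bar>" "sqrt \<bar>b\<bar>"])
    fix x :: 'a
    show "norm (complex_of_real (indicator {a<..<b} (sq x) * h (sq x))) \<le> \<bar>C\<bar>"
      using h(2)[of "sq x"] by (auto simp: indicator_def)
    assume "sqrt \<bar>b\<bar> < norm x"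
    then have "b \<le> sq x" by (simp add: norm_eq_sqrt_inner)
    then show "complex_of_real (indicator {a<..<b} (sq x) * h (sq x)) = 0" by simp
  qed measurable
qed

text \<open>Dominated by a multiple of q |x|^(-d) through \<open>cutoff_error_le\<close>, and
  pointwise of order 1/n. The index is shifted by one to keep the cutoff length positive.\<close>

lemma cutoff_error_tendsto_0:
  assumes a: "1 \<le> a"
  shows "(\<lambda>n. LINT x|lebesgue. q x * (indicator {a..} (sq x) * (2 * sq x * (flat 2 (1 - sq x / real (Suc n)) / real (Suc n)) * flat (DIM('a) / 2) (sq x)))) \<longlonglongrightarrow> 0"
proof -
  let ?d = "real DIM('a)"
  obtain C where C: "0 < C" "\<And>s. s \<le> 1 \<Longrightarrow> flat 2 s \<le> C" using flat_bounded_left by blast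
  let ?f = "\<lambda>n x. q x * (indicator {a..} (sq x) * (2 * sq x * (flat 2 (1 - sq x / real (Suc n)) / real (Suc n)) * flat (?d / 2) (sq x)))"
  have "(\<lambda>n. LINT x|lebesgue. ?f n x) \<longlonglongrightarrow> (LINT x|(lebesgue::'a measure). 0)"
  proof (rule integral_dominated_convergence[where w = "\<lambda>x. 2 * C * norm (q x * (indicator {1..} (sq x) * sq x powr (- (?d / 2))))"])
    show "integrable lebesgue (\<lambda>x. 2 * C * norm (q x * (indicator {1..} (sq x) * sq x powr (- (?d / 2)))))"
      by (intro integrable_mult_right integrable_norm q_weight_integrable)
    show "AE x in lebesgue. norm (?f n x) \<le> 2 * C * norm (q x * (indicator {1..} (sq x) * sq x powr (- (?d / 2))))" (is "AE x in _. ?P x") for n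
    proof (rule AE_I2)
      fix x :: 'a
      define s where "s = sq x"
      define N where "N = real (Suc n)"
      have N: "0 < N" by (simp add: N_def)
      have "norm (q x * (indicator {a..} s * (2 * s * (flat 2 (1 - s / N) / N) * flat (?d / 2) s)))
        = \<bar>q x\<bar> * (indicator {a..} s * (2 * s * (flat 2 (1 - s / N) / N) * flat (?d / 2) s))"
        using N flat_nonneg by (simp add: abs_mult s_def)
      also have "\<dots> \<le> \<bar>q x\<bar> * (indicator {1..} s * (2 * C * s powr (- (?d / 2))))"
        using cutoff_error_le[OF N _ C, of s "?d / 2"] a C(1)
        by (intro mult_left_mono) (auto simp: indicator_def)
      also have "\<dots> = 2 * C * norm (q x * (indicator {1..} s * s powr (- (?d / 2))))"
        using C(1) by (simp add: abs_mult)
      finally show "?P x"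
        unfolding s_def N_def .
    qed
    show "AE x in lebesgue. (\<lambda>n. ?f n x) \<longlonglongrightarrow> 0" (is "AE x in _. ?P x")
    proof (rule AE_I2)
      fix x :: 'a
      define s where "s = sq x"
      define D where "D = \<bar>q x\<bar> * (2 * s * C * flat (?d / 2) s)"
      have s0: "0 \<le> s" by (simp add: s_def)
      have "(\<lambda>n. D * inverse (real (Suc n))) \<longlonglongrightarrow> D * 0"
        by (intro tendsto_mult tendsto_const LIMSEQ_inverse_real_of_nat)
      then have lim: "(\<lambda>n. D * inverse (real (Suc n))) \<longlonglongrightarrow> 0" by simp
      show "?P x"
      proof (rule Lim_null_comparison[OF _ lim], rule eventuallyI)
        fix n
        define N where "N = real (Suc n)"
        have N: "0 < N" by (simp add: N_def)
        have "norm (q x * (indicator {a..} s * (2 * s * (flat 2 (1 - s / N) / N) * flat (?d / 2) s)))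
          = \<bar>q x\<bar> * (indicator {a..} s * (2 * s * (flat 2 (1 - s / N) / N) * flat (?d / 2) s))"
          using N flat_nonneg s0 by (simp add: abs_mult)
        also have "\<dots> \<le> \<bar>q x\<bar> * (1 * (2 * s * (C / N) * flat (?d / 2) s))"
          using N flat_nonneg s0 C(2)[of "1 - s / N"] C(1)
          by (intro mult_left_mono mult_mono mult_nonneg_nonneg divide_right_mono) (auto simp: indicator_def)
        also have "\<dots> = D * inverse N" by (simp add: D_def field_simps)
        finally show "norm (?f n x) \<le> D * inverse (real (Suc n))" unfolding s_def N_def .
      qed
    qed
  qed measurable
  then show ?thesis by simp
qed

text \<open>Two limits in \<open>smooth_shell_bound\<close>: the cutoff length tends to infinity,
  then the bump tends to the indicator of the interval. In the constant, 2 is the factor of the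
  shell term; one e compensates the limit \<open>flat 0 1\<close> = 1/e of the cutoff, the other e
  the lower bound \<open>flat_ge_powr\<close>.\<close>

lemma shell_bound:
  assumes a: "1 \<le> a" "a < b"
  shows "(LINT x|lebesgue. q x * (indicator {a<..<b} (sq x) * sq x powr (1 - DIM('a) / 2))) \<le> exp 2 / 2 * (b - a) * tail a"
proof -
  let ?d = "real DIM('a)"
  let ?F = "flat (?d / 2)"
  have Fb: "\<bar>?F s\<bar> \<le> 1" if "1 \<le> s" for s
  proof -
    have "?F s \<le> s powr (- (?d / 2))" using flat_le_powr that by simp
    also have "\<dots> \<le> 1" using that powr_mono[of "- (?d / 2)" 0 s] by simp
    finally show ?thesis by (simp add: flat_nonneg)
  qed
  have step1: "(LINT x|lebesgue. q x * (indicator {a<..<b} (sq x) * (2 * sq x * box_bump m a b (sq x) * exp (- 1) * ?F (sq x)))) \<le> (b - a) * tail a" for m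
  proof -
    let ?\<rho> = "box_bump m a b"
    let ?E = "\<lambda>n. LINT x|lebesgue. q x * (indicator {a..} (sq x) * (2 * sq x * (flat 2 (1 - sq x / real (Suc n)) / real (Suc n)) * ?F (sq x)))"
    have out: "?\<rho> s = 0" if "s \<notin> {a<..<b}" for s
      using box_bump_outside[of s a b m] that by (simp add: box_real)
    have ineq: "(LINT x|lebesgue. q x * (2 * sq x * ?\<rho> (sq x) * flat 0 (1 - sq x / real (Suc n)) * ?F (sq x)))
      \<le> (b - a) * tail a + (b - a) * ?E n" for n
      by (rule smooth_shell_bound(1)[OF a _ smooth_box_bump_real out box_bump_nonneg box_bump_le_1]) auto
    have lim: "(\<lambda>n. LINT x|lebesgue. q x * (2 * sq x * ?\<rho> (sq x) * flat 0 (1 - sq x / real (Suc n)) * ?F (sq x)))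
      \<longlonglongrightarrow> (LINT x|lebesgue. q x * (indicator {a<..<b} (sq x) * (2 * sq x * ?\<rho> (sq x) * exp (- 1) * ?F (sq x))))"
    proof (rule integral_dominated_convergence[where w = "\<lambda>x. norm (q x * (indicator {a<..<b} (sq x) * (2 * b)))"])
      show "integrable lebesgue (\<lambda>x. norm (q x * (indicator {a<..<b} (sq x) * (2 * b))))"
        by (intro integrable_norm q_bounded_shell_integrable[OF a(1), of "\<lambda>_. 2 * b" _ "2 * b"]) (use a in auto)
      show "AE x in lebesgue. norm (q x * (2 * sq x * ?\<rho> (sq x) * flat 0 (1 - sq x / real (Suc n)) * ?F (sq x)))
        \<le> norm (q x * (indicator {a<..<b} (sq x) * (2 * b)))" (is "AE x in _. ?P x") for n
      proof (rule AE_I2)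
        fix x :: 'a
        show "?P x"
        proof (cases "sq x \<in> {a<..<b}")
          case True
          have "2 * sq x * ?\<rho> (sq x) * flat 0 (1 - sq x / real (Suc n)) * \<bar>?F (sq x)\<bar> \<le> 2 * b * 1 * 1 * 1"
            using True a by (intro mult_mono box_bump_le_1 flat_0_le_1 Fb mult_nonneg_nonneg box_bump_nonneg flat_nonneg) auto
          then have "norm (2 * sq x * ?\<rho> (sq x) * flat 0 (1 - sq x / real (Suc n)) * ?F (sq x)) \<le> norm (indicator {a<..<b} (sq x) * (2 * b))"
            using True a by (simp add: abs_mult flat_nonneg box_bump_nonneg)
          then show ?thesis unfolding norm_mult[of "q x"] by (rule mult_left_mono) simp
        next
          case False
          then show ?thesis using out by simp
        qed
      qed
      show "AE x in lebesgue. (\<lambda>n. q x * (2 * sq x * ?\<rho> (sq x) * flat 0 (1 - sq x / real (Suc n)) * ?F (sq x)))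
        \<longlonglongrightarrow> q x * (indicator {a<..<b} (sq x) * (2 * sq x * ?\<rho> (sq x) * exp (- 1) * ?F (sq x)))" (is "AE x in _. ?P x")
      proof (rule AE_I2)
        fix x :: 'a
        have "(\<lambda>n. 1 - (sq x) * inverse (real (Suc n))) \<longlonglongrightarrow> 1 - (sq x) * 0"
          by (intro tendsto_intros LIMSEQ_inverse_real_of_nat)
        then have "(\<lambda>n. 1 - sq x / real (Suc n)) \<longlonglongrightarrow> 1" by (simp add: divide_inverse)
        moreover have "isCont (flat 0) 1"
          using smooth_continuous[OF smooth_flat, of UNIV] by (simp add: continuous_on_eq_continuous_at)
        ultimately have "(\<lambda>n. flat 0 (1 - sq x / real (Suc n))) \<longlonglongrightarrow> flat 0 1"
          by (rule isCont_tendsto_compose[rotated])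
        then have "(\<lambda>n. flat 0 (1 - sq x / real (Suc n))) \<longlonglongrightarrow> exp (- 1)" by (simp add: flat_def)
        then have "(\<lambda>n. q x * (2 * sq x * ?\<rho> (sq x) * flat 0 (1 - sq x / real (Suc n)) * ?F (sq x)))
        \<longlonglongrightarrow> q x * (2 * sq x * ?\<rho> (sq x) * exp (- 1) * ?F (sq x))"
          by (intro tendsto_mult tendsto_const)
        then show "?P x"
          using out[of "sq x"] by (cases "sq x \<in> {a<..<b}") auto
      qed
    qed measurable
    have "(\<lambda>n. (b - a) * tail a + (b - a) * ?E n) \<longlonglongrightarrow> (b - a) * tail a + (b - a) * 0"
      by (intro tendsto_intros cutoff_error_tendsto_0 a)
    from LIMSEQ_le[OF lim this] ineq show ?thesis by auto
  qed
  have lim: "(\<lambda>m. LINT x|lebesgue. q x * (indicator {a<..<b} (sq x) * (2 * sq x * box_bump m a b (sq x) * exp (- 1) * ?F (sq x))))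
    \<longlonglongrightarrow> (LINT x|lebesgue. q x * (indicator {a<..<b} (sq x) * (2 * sq x * exp (- 1) * ?F (sq x))))"
  proof (rule integral_dominated_convergence[where w = "\<lambda>x. norm (q x * (indicator {a<..<b} (sq x) * (2 * b)))"])
    show "integrable lebesgue (\<lambda>x. norm (q x * (indicator {a<..<b} (sq x) * (2 * b))))"
      by (intro integrable_norm q_bounded_shell_integrable[OF a(1), of "\<lambda>_. 2 * b" _ "2 * b"]) (use a in auto)
    show "AE x in lebesgue. norm (q x * (indicator {a<..<b} (sq x) * (2 * sq x * box_bump m a b (sq x) * exp (- 1) * ?F (sq x))))
      \<le> norm (q x * (indicator {a<..<b} (sq x) * (2 * b)))" (is "AE x in _. ?P x") for m
    proof (rule AE_I2)
      fix x :: 'a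
      show "?P x"
      proof (cases "sq x \<in> {a<..<b}")
        case True
        have "2 * sq x * box_bump m a b (sq x) * exp (- 1) * \<bar>?F (sq x)\<bar> \<le> 2 * b * 1 * 1 * 1"
          using True a by (intro mult_mono box_bump_le_1 Fb mult_nonneg_nonneg box_bump_nonneg) auto
        then have "norm (indicator {a<..<b} (sq x) * (2 * sq x * box_bump m a b (sq x) * exp (- 1) * ?F (sq x))) \<le> norm (indicator {a<..<b} (sq x) * (2 * b))"
          using True a by (simp add: abs_mult box_bump_nonneg)
        then show ?thesis unfolding norm_mult[of "q x"] by (rule mult_left_mono) simp
      qed simp
    qed
    show "AE x in lebesgue. (\<lambda>m. q x * (indicator {a<..<b} (sq x) * (2 * sq x * box_bump m a b (sq x) * exp (- 1) * ?F (sq x))))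
      \<longlonglongrightarrow> q x * (indicator {a<..<b} (sq x) * (2 * sq x * exp (- 1) * ?F (sq x)))" (is "AE x in _. ?P x")
    proof (rule AE_I2)
      fix x :: 'a
      have "(\<lambda>m. q x * (indicator {a<..<b} (sq x) * (2 * sq x * box_bump m a b (sq x) * exp (- 1) * ?F (sq x))))
      \<longlonglongrightarrow> q x * (indicator {a<..<b} (sq x) * (2 * sq x * indicator (box a b) (sq x) * exp (- 1) * ?F (sq x)))"
        by (intro tendsto_mult tendsto_const box_bump_tendsto)
      then show "?P x"
        by (cases "sq x \<in> {a<..<b}") (auto simp: box_real)
    qed
  qed measurable
  have step2: "(LINT x|lebesgue. q x * (indicator {a<..<b} (sq x) * (2 * sq x * exp (- 1) * ?F (sq x)))) \<le> (b - a) * tail a"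
    by (rule LIMSEQ_le_const2[OF lim]) (use step1 in blast)
  have "(LINT x|lebesgue. 2 * exp (- 2) * (q x * (indicator {a<..<b} (sq x) * sq x powr (1 - ?d / 2))))
     \<le> (LINT x|lebesgue. q x * (indicator {a<..<b} (sq x) * (2 * sq x * exp (- 1) * ?F (sq x))))"
  proof (rule integral_mono_AE)
    have "s powr (1 - ?d / 2) \<le> 1" if "1 \<le> s" for s
      using that dim powr_mono[of "1 - ?d / 2" 0 s] by simp
    then show "integrable lebesgue (\<lambda>x. 2 * exp (- 2) * (q x * (indicator {a<..<b} (sq x) * sq x powr (1 - ?d / 2))))"
      using a by (intro integrable_mult_right q_bounded_shell_integrable[of _ _ _ 1]) auto
    show "integrable lebesgue (\<lambda>x. q x * (indicator {a<..<b} (sq x) * (2 * sq x * exp (- 1) * ?F (sq x))))"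
    proof (rule q_bounded_shell_integrable[OF a(1), of _ _ "2 * b * 1 * 1"])
      fix s assume s: "s \<in> {a<..<b}"
      have "2 * s * exp (- 1) * \<bar>?F s\<bar> \<le> 2 * b * 1 * 1"
        using s a by (intro mult_mono Fb) auto
      then show "\<bar>2 * s * exp (- 1) * ?F s\<bar> \<le> 2 * b * 1 * 1" using s a by (simp add: abs_mult)
    qed measurable
    show "AE x in lebesgue. 2 * exp (- 2) * (q x * (indicator {a<..<b} (sq x) * sq x powr (1 - ?d / 2)))
      \<le> q x * (indicator {a<..<b} (sq x) * (2 * sq x * exp (- 1) * ?F (sq x)))"
      using q_nonneg
    proof eventually_elim
      case (elim x)
      show ?case
      proof (cases "sq x \<in> {a<..<b}")
        case True
        define s where "s = sq x"
        have s: "1 \<le> s" "s \<in> {a<..<b}" using True a by (auto simp: s_def)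
        have "2 * exp (- 2) * s powr (1 - ?d / 2) = 2 * s * exp (- 1) * (exp (- 1) * s powr (- (?d / 2)))"
        proof -
          have "s powr (1 - ?d / 2) = s * s powr (- (?d / 2))"
            using s powr_add[of s 1 "- (?d / 2)"] by simp
          moreover have "exp (- 2 :: real) = exp (- 1) * exp (- 1)" by (simp flip: exp_add)
          ultimately show ?thesis by (simp only: mult_ac)
        qed
        also have "\<dots> \<le> 2 * s * exp (- 1) * ?F s"
          using s flat_ge_powr[of s "?d / 2"] by (intro mult_left_mono) auto
        finally have "q x * (2 * exp (- 2) * s powr (1 - ?d / 2)) \<le> q x * (2 * s * exp (- 1) * ?F s)"
          using elim by (intro mult_left_mono)
        then show ?thesis using s unfolding s_def[symmetric] by (simp add: mult_ac)
      qed simp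
    qed
  qed
  then have "2 * exp (- 2) * (LINT x|lebesgue. q x * (indicator {a<..<b} (sq x) * sq x powr (1 - ?d / 2))) \<le> (b - a) * tail a"
    using step2 by simp
  then show ?thesis by (simp add: exp_minus field_simps)
qed

end

text \<open>Covers both signs of the exponent at once, since moments with decaying and with growing
  weights are treated by the same bootstrap step.\<close>

lemma powr_ratio_le:
  fixes t M i :: real
  assumes "1 \<le> t" "t \<le> M" shows "t powr i \<le> M powr \<bar>i\<bar>"
proof (cases "0 \<le> i")
  case True
  then show ?thesis using assms by (simp add: powr_mono2)
next
  case False
  have "t powr i \<le> 1" using assms False powr_mono[of i 0 t] by simp
  also have "1 \<le> M powr \<bar>i\<bar>" using assms ge_one_powr_ge_zero[of M "\<bar>i\<bar>"] by simp
  finally show ?thesis .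
qed

section \<open>Vanishing at infinity and nonvanishing gradient\<close>

context radial_profile
begin

lemma tail_tendsto_0: "(\<lambda>n. tail (real (Suc n))) \<longlonglongrightarrow> 0"
proof -
  let ?d = "real DIM('a)"
  have "(\<lambda>n. LINT x|lebesgue. G_abs x * (indicator {real (Suc n)..} (sq x) * sq x powr ((1 - ?d) / 2))) \<longlonglongrightarrow> (LINT x|(lebesgue::'a measure). 0)"
  proof (rule integral_dominated_convergence[where w = "\<lambda>x. G_abs x * (indicator {1..} (sq x) * sq x powr ((1 - ?d) / 2))"])
    show "integrable lebesgue (\<lambda>x. G_abs x * (indicator {1..} (sq x) * sq x powr ((1 - ?d) / 2)))"
      by (rule tail_integrable) simp
    show "AE x in lebesgue. norm (G_abs x * (indicator {real (Suc n)..} (sq x) * sq x powr ((1 - ?d) / 2)))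
      \<le> G_abs x * (indicator {1..} (sq x) * sq x powr ((1 - ?d) / 2))" for n
      using G_abs_nonneg by (intro AE_I2) (auto simp: abs_mult indicator_def)
    show "AE x in lebesgue. (\<lambda>n. G_abs x * (indicator {real (Suc n)..} (sq x) * sq x powr ((1 - ?d) / 2))) \<longlonglongrightarrow> 0" (is "AE x in _. ?P x")
    proof (rule AE_I2)
      fix x :: 'a
      obtain N where N: "sq x < real N" using reals_Archimedean2 by blast
      have "\<forall>\<^sub>F n in sequentially. G_abs x * (indicator {real (Suc n)..} (sq x) * sq x powr ((1 - ?d) / 2)) = 0"
        using eventually_ge_at_top[of N] by eventually_elim (use N in auto)
      then show "?P x"
        by (rule tendsto_eventually)
    qed
  qed measurable
  then show ?thesis by (simp add: tail_def)
qed

lemma tail_antimono: "1 \<le> a \<Longrightarrow> a \<le> b \<Longrightarrow> tail b \<le> tail a"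
  unfolding tail_def
  by (rule integral_mono[OF tail_integrable tail_integrable]) (auto simp: indicator_def G_abs_nonneg)

lemma shell_integrable:
  assumes "1 \<le> a" "a < b"
  shows "integrable lebesgue (\<lambda>x::'a. indicator {a<..<b} (sq x) * sq x powr (1 - DIM('a) / 2))"
proof (rule Bochner_Integration.integrable_bound)
  show "integrable lebesgue (\<lambda>x::'a. indicat_real {a<..<b} (sq x))"
    using shell_weight_ge(1)[of a b, where 'a = 'a] assms dim by simp
  have "s powr (1 - DIM('a) / 2) \<le> 1" if "1 \<le> s" for s :: real
    using that dim powr_mono[of "1 - DIM('a) / 2" 0 s] by simp
  then show "AE x::'a in lebesgue. norm (indicator {a<..<b} (sq x) * sq x powr (1 - DIM('a) / 2)) \<le> norm (indicat_real {a<..<b} (sq x))"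
    using assms by (intro AE_I2) (auto simp: indicator_def)
qed measurable

text \<open>Strauss' radial lemma in the weak form needed here. It suffices to compare shell averages
  of the profile, so only the linear identity \<open>radial_divergence\<close> enters.\<close>

lemma q_small_at_infinity:
  assumes \<epsilon>: "0 < \<epsilon>"
  obtains R where "1 \<le> R" "AE x in lebesgue. R < sq x \<longrightarrow> q x \<le> \<epsilon>"
proof -
  let ?d = "real DIM('a)" and ?V = "unit_ball_vol (real DIM('a))"
  have V: "0 < ?V" by simp
  have "(\<lambda>n. exp 2 / 2 * tail (real (Suc n))) \<longlonglongrightarrow> exp 2 / 2 * 0"
    by (intro tendsto_mult tendsto_const tail_tendsto_0)
  moreover have "exp 2 / 2 * 0 < \<epsilon> * ?V" using \<epsilon> V by simp
  ultimately have "\<forall>\<^sub>F n in sequentially. exp 2 / 2 * tail (real (Suc n)) < \<epsilon> * ?V"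
    by (rule order_tendstoD)
  then obtain n where n: "exp 2 / 2 * tail (real (Suc n)) < \<epsilon> * ?V"
    by (auto simp: eventually_sequentially)
  define R where "R = real (Suc n)"
  have R: "1 \<le> R" by (simp add: R_def)
  obtain g where g: "\<And>x y. norm x = norm y \<Longrightarrow> g x = g y" "AE x in lebesgue. Q x = g x"
    using rad unfolding radial_def by blast
  have iq: "integrable lebesgue (\<lambda>x. q x * (indicator {a<..<b} (sq x) * sq x powr (1 - ?d / 2)))" if "1 \<le> a" for a b
  proof (rule q_bounded_shell_integrable[OF that, of _ _ 1])
    fix s assume "s \<in> {a<..<b}"
    then show "\<bar>s powr (1 - ?d / 2)\<bar> \<le> 1"
      using that dim powr_mono[of "1 - ?d / 2" 0 s] by simp
  qed measurable
  have eq: "(q x - \<epsilon>) * sq x powr (1 - ?d / 2) * indicator {a<..<b} (sq x)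
    = q x * (indicator {a<..<b} (sq x) * sq x powr (1 - ?d / 2)) - \<epsilon> * (indicator {a<..<b} (sq x) * sq x powr (1 - ?d / 2))" for x :: 'a and a b
    by (simp add: algebra_simps)
  \<comment> \<open>On a shell the constant \<epsilon> integrates to at least \<epsilon> V (b - a)
    against this weight, while q integrates to at most e^2/2 (b - a) \<open>tail R\<close>. The
    choice of R makes the former dominate.\<close>
  have "AE x in lebesgue. R < sq x \<longrightarrow> (q x - \<epsilon>) * sq x powr (1 - ?d / 2) \<le> 0"
  proof (rule radial_nonpos_AE[where g = "\<lambda>x. (Re (g x) - \<epsilon>) * sq x powr (1 - ?d / 2)"])
    show "(Re (g x) - \<epsilon>) * sq x powr (1 - ?d / 2) = (Re (g y) - \<epsilon>) * (sq y) powr (1 - ?d / 2)" if "norm x = norm y" for x y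
      using g(1)[OF that] that by (simp add: norm_eq_sqrt_inner)
    show "AE x in lebesgue. (q x - \<epsilon>) * sq x powr (1 - ?d / 2) = (Re (g x) - \<epsilon>) * sq x powr (1 - ?d / 2)"
      using g(2) by eventually_elim (simp add: q_def)
    show "0 < R" using R by simp
    fix a b assume ab: "R \<le> a" "a < b"
    have a1: "1 \<le> a" using R ab by simp
    show "integrable lebesgue (\<lambda>x. (q x - \<epsilon>) * sq x powr (1 - ?d / 2) * indicator {a<..<b} (sq x))"
      unfolding eq by (intro Bochner_Integration.integrable_diff iq a1 integrable_mult_right shell_integrable ab)
    have "?V * (b - a) \<le> (LINT x|lebesgue. indicator {a<..<b} ((x::'a) \<bullet> x) * b powr (1 - ?d / 2))"
      by (rule shell_weight_ge(2)) (use a1 ab dim in auto)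
    also have "\<dots> \<le> (LINT x|lebesgue. indicator {a<..<b} ((x::'a) \<bullet> x) * sq x powr (1 - ?d / 2))"
    proof (rule integral_mono)
      show "integrable lebesgue (\<lambda>x::'a. indicator {a<..<b} (sq x) * b powr (1 - ?d / 2))"
        by (rule shell_weight_ge(1)) (use a1 ab dim in auto)
      show "integrable lebesgue (\<lambda>x::'a. indicator {a<..<b} (sq x) * sq x powr (1 - ?d / 2))"
        by (rule shell_integrable[OF a1 ab(2)])
      have "b powr (1 - ?d / 2) \<le> s powr (1 - ?d / 2)" if "a < s" "s < b" for s
        using that a1 dim by (intro powr_mono2') auto
      then show "indicator {a<..<b} (sq x) * b powr (1 - ?d / 2) \<le> indicator {a<..<b} (sq x) * sq x powr (1 - ?d / 2)" for x :: 'a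
        by (simp add: indicator_def)
    qed
    finally have low: "\<epsilon> * (?V * (b - a)) \<le> \<epsilon> * (LINT x|lebesgue. indicator {a<..<b} ((x::'a) \<bullet> x) * sq x powr (1 - ?d / 2))"
      using \<epsilon> by (intro mult_left_mono) auto
    have "exp 2 / 2 * (b - a) * tail a \<le> (b - a) * (exp 2 / 2 * tail R)"
      using tail_antimono[OF R ab(1)] ab by (simp add: mult_ac mult_left_mono)
    also have "\<dots> \<le> (b - a) * (\<epsilon> * ?V)"
      using n ab by (intro mult_left_mono) (auto simp: R_def)
    finally have "(LINT x|lebesgue. q x * (indicator {a<..<b} (sq x) * sq x powr (1 - ?d / 2))) \<le> \<epsilon> * (?V * (b - a))"
      using shell_bound[OF a1 ab(2)] by (simp add: mult_ac)
    with low show "(LINT x|lebesgue. (q x - \<epsilon>) * sq x powr (1 - ?d / 2) * indicator {a<..<b} (sq x)) \<le> 0"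
      unfolding eq by (subst Bochner_Integration.integral_diff[OF iq[OF a1] integrable_mult_right[OF shell_integrable[OF a1 ab(2)]]]) simp
  qed measurable
  then have "AE x in lebesgue. R < sq x \<longrightarrow> q x \<le> \<epsilon>"
  proof eventually_elim
    case (elim x)
    show ?case
    proof
      assume x: "R < sq x"
      then have "0 < sq x powr (1 - ?d / 2)" using R by auto
      then show "q x \<le> \<epsilon>" using elim x by (simp add: mult_le_0_iff)
    qed
  qed
  with that R show ?thesis by blast
qed

text \<open>A vanishing gradient gives \<open>tail 1\<close> = 0, and \<open>shell_bound\<close>
  then forces q = 0 almost everywhere on 1 < |x|^2 < 2, a set of positive volume on which q is
  positive. The strict sign is what makes the gradient of the explicit wave diverge.\<close>

lemma gradient_nonzero: "0 < (\<Sum>b\<in>Basis. L2norm2 (G b))"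
proof (rule ccontr)
  assume neg: "\<not> ?thesis"
  have nn: "0 \<le> L2norm2 f" for f :: "'a \<Rightarrow> complex" by (simp add: L2norm2_def)
  have "(\<Sum>b\<in>Basis. L2norm2 (G b)) = 0" using neg sum_nonneg[of Basis "\<lambda>b. L2norm2 (G b)"] nn by force
  then have z: "L2norm2 (G b) = 0" if "b \<in> Basis" for b
    using that nn by (simp add: sum_nonneg_eq_0_iff)
  have "AE x in lebesgue. G b x = 0" if "b \<in> Basis" for b
    using z[OF that] G_L2[OF that] integral_nonneg_eq_0_iff_AE[of lebesgue "\<lambda>x. (norm (G b x))^2"]
    by (simp add: L2norm2_def L2_def)
  then have "AE x in lebesgue. \<forall>b\<in>Basis. G b x = 0"
    by (intro AE_finite_allI) auto
  then have "AE x in lebesgue. G_abs x * (indicator {1..} (sq x) * sq x powr ((1 - real DIM('a)) / 2)) = 0"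
    by eventually_elim (simp add: G_abs_def)
  then have "tail 1 = (LINT x|(lebesgue::'a measure). 0)"
    unfolding tail_def by (intro integral_cong_AE) auto
  then have t: "tail 1 = 0" by simp
  let ?f = "\<lambda>x. q x * (indicator {1<..<2} (sq x) * sq x powr (1 - DIM('a) / 2))"
  have i: "integrable lebesgue ?f"
  proof (rule q_bounded_shell_integrable[of _ _ _ 1])
    fix s :: real assume "s \<in> {1<..<2}"
    then show "\<bar>s powr (1 - DIM('a) / 2)\<bar> \<le> 1"
      using dim powr_mono[of "1 - DIM('a) / 2" 0 s] by simp
  qed (simp, measurable)
  have nn: "AE x in lebesgue. 0 \<le> ?f x"
    using q_nonneg by eventually_elim (simp add: indicator_def)
  have "(LINT x|lebesgue. ?f x) \<le> 0" using shell_bound[of 1 2] t by simp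
  then have "(LINT x|lebesgue. ?f x) = 0" using integral_nonneg_AE[OF nn] by simp
  then have "AE x in lebesgue. ?f x = 0" using integral_nonneg_eq_0_iff_AE[OF i nn] by simp
  then have "AE x::'a in lebesgue. indicator {1<..<2} (sq x) * 2 powr (1 - DIM('a) / 2) = (0::real)"
    using q_pos by eventually_elim (auto simp: indicator_def)
  then have "(LINT x|lebesgue. indicator {1<..<2} ((x::'a) \<bullet> x) * 2 powr (1 - DIM('a) / 2)) = (LINT x|(lebesgue::'a measure). (0::real))"
    by (intro integral_cong_AE) auto
  moreover have "unit_ball_vol (real DIM('a)) * (2 - 1) \<le> (LINT x|lebesgue. indicator {1<..<2} ((x::'a) \<bullet> x) * 2 powr (1 - DIM('a) / 2))"
    by (rule shell_weight_ge(2)) (use dim in auto)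
  ultimately have "unit_ball_vol (real DIM('a)) \<le> 0" by simp
  moreover have "0 < unit_ball_vol (real DIM('a))" by simp
  ultimately show False by linarith
qed

end

lemma L2_sum: "(\<And>b. b \<in> B \<Longrightarrow> f b \<in> L2) \<Longrightarrow> (\<lambda>x. \<Sum>b\<in>B. f b x) \<in> L2"
proof (induction B rule: infinite_finite_induct)
  case (insert b B)
  then show ?case using L2_add[of "f b" "\<lambda>x. \<Sum>b\<in>B. f b x"] by simp
qed (simp_all add: L2_def)

subsection \<open>Uniform decay of families\<close>

text \<open>The class O(s^(-p)) beyond R, uniformly in the index n of the cutoff. With sums and
  products it forms a small symbol calculus, so derivatives of truncated powers are estimated by
  counting exponents instead of tracking constants.\<close>

definition decays :: "real \<Rightarrow> real \<Rightarrow> (nat \<Rightarrow> real \<Rightarrow> real) \<Rightarrow> bool" where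
  "decays R p f \<longleftrightarrow> (\<exists>K\<ge>0. \<forall>n s. R < s \<longrightarrow> \<bar>f n s\<bar> \<le> K * s powr (- p))"

lemma decaysD:
  assumes "decays R p f" obtains K where "0 \<le> K" "\<And>n s. R < s \<Longrightarrow> \<bar>f n s\<bar> \<le> K * s powr (- p)"
  using assms unfolding decays_def by blast

lemma decays_add:
  assumes "decays R p f" "decays R p g" shows "decays R p (\<lambda>n s. f n s + g n s)"
proof -
  obtain K where K: "0 \<le> K" "\<And>n s. R < s \<Longrightarrow> \<bar>f n s\<bar> \<le> K * s powr (- p)" using decaysD[OF assms(1)] by blast
  obtain L where L: "0 \<le> L" "\<And>n s. R < s \<Longrightarrow> \<bar>g n s\<bar> \<le> L * s powr (- p)" using decaysD[OF assms(2)] by blast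
  have "\<bar>f n s + g n s\<bar> \<le> (K + L) * s powr (- p)" if "R < s" for n s
    using K(2)[OF that, of n] L(2)[OF that, of n] by (simp add: distrib_right)
  then show ?thesis unfolding decays_def using K(1) L(1) by (intro exI[of _ "K + L"]) auto
qed

lemma decays_mult:
  assumes "decays R p f" "decays R r g" "p + r = t" shows "decays R t (\<lambda>n s. f n s * g n s)"
proof -
  obtain K where K: "0 \<le> K" "\<And>n s. R < s \<Longrightarrow> \<bar>f n s\<bar> \<le> K * s powr (- p)" using decaysD[OF assms(1)] by blast
  obtain L where L: "0 \<le> L" "\<And>n s. R < s \<Longrightarrow> \<bar>g n s\<bar> \<le> L * s powr (- r)" using decaysD[OF assms(2)] by blast
  have "\<bar>f n s * g n s\<bar> \<le> (K * L) * s powr (- t)" if "R < s" for n s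
  proof -
    have "\<bar>f n s * g n s\<bar> \<le> (K * s powr (- p)) * (L * s powr (- r))"
      unfolding abs_mult using K(1) by (intro mult_mono K(2) L(2) that) auto
    also have "\<dots> = (K * L) * (s powr (- p) * s powr (- r))" by (simp only: mult_ac)
    also have "s powr (- p) * s powr (- r) = s powr (- t)"
      by (simp add: powr_add[symmetric] assms(3)[symmetric])
    finally show ?thesis .
  qed
  then show ?thesis unfolding decays_def using K(1) L(1) by (intro exI[of _ "K * L"]) auto
qed

lemma decays_cmult: "decays R p f \<Longrightarrow> decays R p (\<lambda>n s. c * f n s)"
proof -
  assume "decays R p f"
  then obtain K where K: "0 \<le> K" "\<And>n s. R < s \<Longrightarrow> \<bar>f n s\<bar> \<le> K * s powr (- p)" using decaysD by blast
  have "\<bar>c * f n s\<bar> \<le> (\<bar>c\<bar> * K) * s powr (- p)" if "R < s" for n s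
    using mult_left_mono[OF K(2)[OF that, of n], of "\<bar>c\<bar>"] by (simp add: abs_mult)
  then show ?thesis unfolding decays_def using K(1) by (intro exI[of _ "\<bar>c\<bar> * K"]) auto
qed

lemma decays_weaken:
  assumes "decays R p f" "r \<le> p" "1 \<le> R" shows "decays R r f"
proof -
  obtain K where K: "0 \<le> K" "\<And>n s. R < s \<Longrightarrow> \<bar>f n s\<bar> \<le> K * s powr (- p)" using decaysD[OF assms(1)] by blast
  have "\<bar>f n s\<bar> \<le> K * s powr (- r)" if "R < s" for n s
  proof -
    have "s powr (- p) \<le> s powr (- r)" using that assms by (intro powr_mono) auto
    then show ?thesis using K(2)[OF that, of n] mult_left_mono[OF _ K(1)] order_trans by blast
  qed
  then show ?thesis unfolding decays_def using K(1) by blast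
qed

lemma decays_ident: "0 \<le> R \<Longrightarrow> decays R (- 1) (\<lambda>n s. s)"
  unfolding decays_def by (intro exI[of _ 1]) auto

text \<open>On R < s <= R + 1 compactness suffices. Beyond, s and s - R are comparable: 1 <= s/(s -
  R) <= R + 1, the upper bound being equivalent to R (s - R - 1) >= 0.\<close>

lemma decays_flat:
  assumes R: "0 < R" shows "decays R i (\<lambda>n s. flat i (s - R))"
proof -
  have "compact ((\<lambda>s. flat i (s - R) * s powr i) ` {R..R + 1})"
  proof (rule compact_continuous_image)
    show "continuous_on {R..R + 1} (\<lambda>s. flat i (s - R) * s powr i)"
      using R by (intro continuous_intros continuous_on_compose2[OF smooth_continuous[OF smooth_flat, of UNIV]]) auto
  qed simp
  then obtain B where B: "\<And>y. y \<in> (\<lambda>s. flat i (s - R) * s powr i) ` {R..R + 1} \<Longrightarrow> norm y \<le> B"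
    using compact_imp_bounded bounded_iff by metis
  let ?K = "max B ((R + 1) powr \<bar>i\<bar>)"
  have "flat i (s - R) * s powr i \<le> ?K" if s: "R < s" for s
  proof (cases "s \<le> R + 1")
    case True
    then have "flat i (s - R) * s powr i \<in> (\<lambda>s. flat i (s - R) * s powr i) ` {R..R + 1}"
      using s by (intro imageI) auto
    from B[OF this] show ?thesis by (auto simp: le_max_iff_disj)
  next
    case False
    have "flat i (s - R) * s powr i \<le> (s - R) powr (- i) * s powr i"
      using s by (intro mult_right_mono flat_le_powr) auto
    also have "\<dots> = (s / (s - R)) powr i"
      using s R by (simp add: powr_divide powr_minus field_simps)
    also have "\<dots> \<le> (R + 1) powr \<bar>i\<bar>"
    proof (rule powr_ratio_le)
      have "0 < R * (s - R - 1)" using False R by simp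
      then show "s / (s - R) \<le> R + 1" using s R by (simp add: pos_divide_le_eq algebra_simps)
      show "1 \<le> s / (s - R)" using s R by simp
    qed
    finally show ?thesis by simp
  qed
  then have "\<bar>flat i (s - R)\<bar> \<le> ?K * s powr (- i)" if "R < s" for s
    using that R by (simp add: flat_nonneg powr_minus field_simps)
  moreover have "0 \<le> ?K" by (simp add: le_max_iff_disj)
  ultimately show ?thesis unfolding decays_def by blast
qed

text \<open>On the support s < n + 1 each factor 1/(n + 1) is at most 1/s. Every derivative falling
  on the cutoff thus counts as one power of decay, uniformly in n.\<close>

lemma decays_cutoff:
  assumes R: "0 < R" shows "decays R (real k) (\<lambda>n s. flat i (1 - s / real (Suc n)) / real (Suc n) ^ k)"
proof -
  obtain C where C: "0 < C" "\<And>s. s \<le> 1 \<Longrightarrow> flat i s \<le> C" using flat_bounded_left by blast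
  have "\<bar>flat i (1 - s / real (Suc n)) / real (Suc n) ^ k\<bar> \<le> C * s powr (- real k)" if s: "R < s" for n s
  proof (cases "s < real (Suc n)")
    case True
    have "flat i (1 - s / real (Suc n)) / real (Suc n) ^ k \<le> C / s ^ k"
      using True s R C(1) C(2)[of "1 - s / real (Suc n)"] by (intro frac_le power_mono) auto
    also have "\<dots> = C * s powr (- real k)" using s R by (simp add: powr_minus powr_realpow field_simps)
    finally show ?thesis by (simp add: flat_nonneg)
  next
    case False
    then show ?thesis using C(1) by (simp add: field_simps)
  qed
  then show ?thesis unfolding decays_def using C(1) by (intro exI[of _ C]) auto
qed

subsection \<open>Decay of the profile\<close>

locale elliptic_profile = radial_profile +
  fixes c :: real
  assumes sol: "elliptic_sol c Q"
begin

text \<open>The elliptic equation tested with W(|x|^2), with the Laplacian on one side and all zero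
  order terms collected on the other. W vanishes up to R >= 1, which makes the test function vanish
  near the origin, and q <= 1 beyond R makes the nonlinear term integrable.\<close>

lemma elliptic_radial:
  fixes W W' W'' :: "real \<Rightarrow> real"
  assumes W: "smooth_fun W" "\<And>s. (W has_real_derivative W' s) (at s)" "\<And>s. (W' has_real_derivative W'' s) (at s)"
    and supp: "1 \<le> R" "\<And>s. s \<le> R \<Longrightarrow> W s = 0" "\<And>s. M \<le> s \<Longrightarrow> W s = 0"
    and small: "AE x in lebesgue. R < sq x \<longrightarrow> q x \<le> 1"
  shows "integrable lebesgue (\<lambda>x. q x * (4 * sq x * W'' (sq x) + 2 * real DIM('a) * W' (sq x)))" (is ?A)
    and "integrable lebesgue (\<lambda>x. q x * (W (sq x) * (1 - c / sq x - q x powr (4 / DIM('a)))))" (is ?B)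
    and "integrable lebesgue (\<lambda>x. q x * W (sq x))" (is ?D)
    and "(LINT x|lebesgue. q x * (4 * sq x * W'' (sq x) + 2 * real DIM('a) * W' (sq x)))
      = (LINT x|lebesgue. q x * (W (sq x) * (1 - c / sq x - q x powr (4 / DIM('a)))))" (is ?C)
proof -
  let ?d = "real DIM('a)"
  define w where "w x = complex_of_real (W (sq x))" for x :: 'a
  have V: "((\<lambda>s. complex_of_real (W s)) has_vector_derivative complex_of_real (W' s)) (at s)" for s
    by (rule bounded_linear.has_vector_derivative[OF bounded_linear_of_real])
      (use W(2) in \<open>simp add: has_real_derivative_iff_has_vector_derivative\<close>)
  have V': "((\<lambda>s. complex_of_real (W' s)) has_vector_derivative complex_of_real (W'' s)) (at s)" for s
    by (rule bounded_linear.has_vector_derivative[OF bounded_linear_of_real])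
      (use W(3) in \<open>simp add: has_real_derivative_iff_has_vector_derivative\<close>)
  have lapw: "lap w x = complex_of_real (4 * sq x * W'' (sq x) + 2 * ?d * W' (sq x))" for x
    using lap_radial[OF V V', of x] by (simp add: w_def[abs_def] scaleR_conv_of_real)
  have sm: "smooth_fun w" unfolding w_def[abs_def]
    by (rule smooth_bounded_linear_compose[OF bounded_linear_of_real smooth_compose_real[OF W(1) smooth_inner_self]])
  have out: "w x = 0" if "sqrt \<bar>M\<bar> < norm x" for x
  proof -
    have "M \<le> sq x" using that by (simp add: norm_eq_sqrt_inner)
    then show ?thesis by (simp add: w_def supp)
  qed
  have ins: "w x = 0" if "norm x < 1" for x
  proof -
    have "sq x < 1" using that by (simp add: norm_eq_sqrt_inner)
    then show ?thesis using supp by (simp add: w_def)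
  qed
  have tp: "test_fun_punct w" by (rule test_fun_punctI[OF sm out _ ins]) auto
  then have t: "test_fun w" by (simp add: test_fun_punct_def)
  have wL: "(\<lambda>x::'a. complex_of_real (W (sq x))) \<in> L2" using test_fun_L2[OF t] by (simp add: w_def[abs_def])
  have lapt: "test_fun (pd b (pd b w))" for b by (intro test_fun_pd t)
  have lapL: "lap w \<in> L2"
    unfolding lap_def[abs_def] by (intro L2_sum test_fun_L2 lapt)
  have [measurable]: "W \<in> borel_measurable borel"
    by (intro borel_measurable_continuous_onI smooth_continuous W(1))
  show A: ?A
    using integrable_real_mult_L2[OF q_L2, of "\<lambda>x. 4 * sq x * W'' (sq x) + 2 * ?d * W' (sq x)"] lapL
    by (simp add: lapw[abs_def])
  show D: ?D by (rule integrable_real_mult_L2[OF q_L2 wL])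
  have D2: "integrable lebesgue (\<lambda>x. q x * (W (sq x) / sq x))"
  proof (rule Bochner_Integration.integrable_bound[OF D])
    show "AE x in lebesgue. norm (q x * (W (sq x) / sq x)) \<le> norm (q x * W (sq x))" (is "AE x in _. ?P x")
    proof (rule AE_I2)
      fix x :: 'a
      have "\<bar>W (sq x) / sq x\<bar> \<le> \<bar>W (sq x)\<bar>"
      proof (cases "R < sq x")
        case True
        then have "1 \<le> sq x" using supp(1) by simp
        then have "\<bar>W (sq x)\<bar> / sq x \<le> \<bar>W (sq x)\<bar> / 1" by (intro divide_left_mono) auto
        then show ?thesis by simp
      qed (simp add: supp)
      then show "?P x"
        unfolding real_norm_def abs_mult[of "q x"] by (rule mult_left_mono) simp
    qed
  qed measurable
  have D3: "integrable lebesgue (\<lambda>x. q x * (W (sq x) * q x powr (4 / ?d)))"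
  proof (rule Bochner_Integration.integrable_bound[OF D])
    show "AE x in lebesgue. norm (q x * (W (sq x) * q x powr (4 / ?d))) \<le> norm (q x * W (sq x))"
      using small q_nonneg
    proof eventually_elim
      case (elim x)
      have "\<bar>W (sq x) * q x powr (4 / ?d)\<bar> \<le> \<bar>W (sq x)\<bar>"
      proof (cases "R < sq x")
        case True
        then have "q x powr (4 / ?d) \<le> 1" using elim powr_mono2[of "4 / ?d" "q x" 1] by simp
        then show ?thesis by (simp add: abs_mult mult_left_le)
      qed (simp add: supp)
      then show ?case unfolding real_norm_def abs_mult[of "q x"] by (rule mult_left_mono) simp
    qed
  qed measurable
  have split: "q x * (W (sq x) * (1 - c / sq x - q x powr (4 / ?d)))
    = q x * W (sq x) - c * (q x * (W (sq x) / sq x)) - q x * (W (sq x) * q x powr (4 / ?d))" for x :: 'a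
    by (simp add: algebra_simps)
  show B: ?B unfolding split by (intro Bochner_Integration.integrable_diff D D2 D3 integrable_mult_right)
  have E: "- (LINT x|lebesgue. Q x * lap w x)
        - of_real c * (LINT x|lebesgue. Q x * w x / of_real ((norm x)^2))
        + (LINT x|lebesgue. Q x * w x)
        = (LINT x|lebesgue. of_real (norm (Q x) powr (4 / ?d)) * Q x * w x)"
    using sol tp unfolding elliptic_sol_def by blast
  have Qm[measurable]: "Q \<in> borel_measurable lebesgue" using L2_measurable[OF Q_L2] .
  have wm[measurable]: "w \<in> borel_measurable lebesgue" using L2_measurable[OF test_fun_L2[OF t]] .
  have lm[measurable]: "lap w \<in> borel_measurable lebesgue" using L2_measurable[OF lapL] .
  have e1: "(LINT x|lebesgue. Q x * lap w x) = of_real (LINT x|lebesgue. q x * (4 * sq x * W'' (sq x) + 2 * ?d * W' (sq x)))"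
    unfolding integral_complex_of_real[symmetric]
  proof (rule integral_cong_AE)
    show "(\<lambda>x. complex_of_real (q x * (4 * sq x * W'' (sq x) + 2 * ?d * W' (sq x)))) \<in> borel_measurable lebesgue"
      by (rule borel_measurable_integrable[OF integrable_of_real[OF A]])
    show "AE x in lebesgue. Q x * lap w x = complex_of_real (q x * (4 * sq x * W'' (sq x) + 2 * ?d * W' (sq x)))"
      using Q_eq_q by eventually_elim (simp add: lapw)
  qed measurable
  have e2: "(LINT x|lebesgue. Q x * w x / of_real ((norm x)^2)) = of_real (LINT x|lebesgue. q x * (W (sq x) / sq x))"
    unfolding integral_complex_of_real[symmetric]
  proof (rule integral_cong_AE)
    show "AE x in lebesgue. Q x * w x / of_real ((norm x)^2) = complex_of_real (q x * (W (sq x) / sq x))"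
      using Q_eq_q by eventually_elim (simp add: w_def power2_norm_eq_inner)
  qed measurable
  have e3: "(LINT x|lebesgue. Q x * w x) = of_real (LINT x|lebesgue. q x * W (sq x))"
    unfolding integral_complex_of_real[symmetric]
  proof (rule integral_cong_AE)
    show "AE x in lebesgue. Q x * w x = complex_of_real (q x * W (sq x))"
      using Q_eq_q by eventually_elim (simp add: w_def)
  qed measurable
  have e4: "(LINT x|lebesgue. of_real (norm (Q x) powr (4 / ?d)) * Q x * w x) = of_real (LINT x|lebesgue. q x * (W (sq x) * q x powr (4 / ?d)))"
    unfolding integral_complex_of_real[symmetric]
  proof (rule integral_cong_AE)
    show "AE x in lebesgue. of_real (norm (Q x) powr (4 / ?d)) * Q x * w x = complex_of_real (q x * (W (sq x) * q x powr (4 / ?d)))"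
      using Q_eq_q q_nonneg by eventually_elim (simp add: w_def)
  qed measurable
  have "- (LINT x|lebesgue. q x * (4 * sq x * W'' (sq x) + 2 * ?d * W' (sq x)))
    - c * (LINT x|lebesgue. q x * (W (sq x) / sq x)) + (LINT x|lebesgue. q x * W (sq x))
    = (LINT x|lebesgue. q x * (W (sq x) * q x powr (4 / ?d)))"
    using arg_cong[OF E[unfolded e1 e2 e3 e4], of Re] by simp
  moreover have "(LINT x|lebesgue. q x * (W (sq x) * (1 - c / sq x - q x powr (4 / ?d))))
    = (LINT x|lebesgue. q x * W (sq x)) - c * (LINT x|lebesgue. q x * (W (sq x) / sq x)) - (LINT x|lebesgue. q x * (W (sq x) * q x powr (4 / ?d)))"
    unfolding split
    by (simp only: Bochner_Integration.integral_diff[OF Bochner_Integration.integrable_diff[OF D integrable_mult_right[OF D2]] D3]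
      Bochner_Integration.integral_diff[OF D integrable_mult_right[OF D2]] integral_mult_right_zero)
  ultimately show ?C by linarith
qed

text \<open>Beyond R the potential and the nonlinear coefficient are each at most 1/4 in absolute
  value, which leaves a zero order coefficient of at least 1/2.\<close>

definition far :: "real \<Rightarrow> bool" where
  "far R \<longleftrightarrow> 1 \<le> R \<and> 4 * \<bar>c\<bar> \<le> R \<and> (AE x in lebesgue. R < sq x \<longrightarrow> q x \<le> 1 \<and> q x powr (4 / DIM('a)) \<le> 1 / 4)"

lemma far_exists: "\<exists>R. far R"
proof -
  let ?d = "real DIM('a)"
  \<comment> \<open>The value whose power 4/d is exactly 1/4; being at most 1 it also yields q <=
    1.\<close>
  define \<epsilon> :: real where "\<epsilon> = (1 / 4) powr (?d / 4)"
  have \<epsilon>: "0 < \<epsilon>" "\<epsilon> \<le> 1" by (auto simp: \<epsilon>_def intro!: powr_le1)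
  obtain R where R: "1 \<le> R" "AE x in lebesgue. R < sq x \<longrightarrow> q x \<le> \<epsilon>"
    using q_small_at_infinity[OF \<epsilon>(1)] by blast
  have "AE x in lebesgue. max R (4 * \<bar>c\<bar>) < sq x \<longrightarrow> q x \<le> 1 \<and> q x powr (4 / ?d) \<le> 1 / 4"
    using R(2) q_nonneg
  proof eventually_elim
    case (elim x)
    show ?case
    proof
      assume "max R (4 * \<bar>c\<bar>) < sq x"
      then have qe: "q x \<le> \<epsilon>" using elim by simp
      then have "q x powr (4 / ?d) \<le> \<epsilon> powr (4 / ?d)" using elim by (intro powr_mono2) auto
      also have "\<dots> = 1 / 4" using dim by (simp add: \<epsilon>_def powr_powr)
      finally show "q x \<le> 1 \<and> q x powr (4 / ?d) \<le> 1 / 4" using qe \<epsilon> by simp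
    qed
  qed
  then show ?thesis unfolding far_def using R(1) by (intro exI[of _ "max R (4 * \<bar>c\<bar>)"]) auto
qed

lemma far_mono: "far R \<Longrightarrow> R \<le> R' \<Longrightarrow> far R'"
  unfolding far_def by (auto elim!: eventually_mono)

text \<open>One step of the bootstrap: two more powers of \<open>norm x\<close> can be afforded, because for
  \<open>w = |x|^(-2j)\<close> near infinity the Laplacian of \<open>w\<close> is smaller than \<open>w\<close> by two powers,
  whereas the zero order coefficient of the equation exceeds 1/2 there.\<close>

lemma moment_step:
  assumes far: "far R" and int: "integrable lebesgue (\<lambda>x. q x * (indicator {R<..} (sq x) * sq x powr (- (j + 1))))"
  shows "integrable lebesgue (\<lambda>x. q x * (indicator {R + 1<..} (sq x) * sq x powr (- j)))"
proof -
  let ?d = "real DIM('a)"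
  have R: "1 \<le> R" "4 * \<bar>c\<bar> \<le> R" and small: "AE x in lebesgue. R < sq x \<longrightarrow> q x \<le> 1 \<and> q x powr (4 / DIM('a)) \<le> 1 / 4"
    using far by (auto simp: far_def)
  have R0: "0 < R" using R by simp
  define N where "N n = real (Suc n)" for n
  have N: "0 < N n" for n by (simp add: N_def)
  define F where "F i s = flat i (s - R)" for i s
  define \<theta> where "\<theta> i k n s = flat i (1 - s / N n) / N n ^ k" for i k n s
  define F1 where "F1 s = F (j + 2) s + (- j) * F (j + 1) s" for s
  define F2 where "F2 s = (F (j + 4) s + (- (j + 2)) * F (j + 3) s) + (- j) * (F (j + 3) s + (- (j + 1)) * F (j + 2) s)" for s
  \<comment> \<open>A smooth version of s^(-j), truncated on the left at R, as required by
    \<open>elliptic_radial\<close>, and on the right at \<open>N n\<close>; \<open>W1\<close> and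
    \<open>W2\<close> are its first two derivatives. The exponent j may have either sign.\<close>
  define W where "W n s = F j s * \<theta> 0 0 n s" for n s
  define W1 where "W1 n s = F1 s * \<theta> 0 0 n s + (- 1) * (F j s * \<theta> 2 1 n s)" for n s
  define W2 where "W2 n s = F2 s * \<theta> 0 0 n s + (- 2) * (F1 s * \<theta> 2 1 n s) + F j s * (\<theta> 4 2 n s + (- 2) * \<theta> 3 2 n s)" for n s
  have dF: "(F i has_real_derivative F (i + 2) s - i * F (i + 1) s) (at s)" for i s
  proof -
    have "((\<lambda>s. s - R) has_real_derivative 1) (at s)" by (auto intro!: derivative_eq_intros)
    from DERIV_chain2[OF flat_has_derivative this] show ?thesis by (simp add: F_def[abs_def])
  qed
  have dF1: "(F1 has_real_derivative F2 s) (at s)" for s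
    unfolding F1_def[abs_def] F2_def
    by (rule DERIV_cong[OF DERIV_add[OF dF DERIV_cmult[OF dF]]]) (simp add: algebra_simps)
  have d\<theta>: "(\<theta> i k n has_real_derivative - (\<theta> (i + 2) (Suc k) n s - i * \<theta> (i + 1) (Suc k) n s)) (at s)" for i k n s
  proof -
    have "((\<lambda>s. 1 - s / N n) has_real_derivative - (1 / N n)) (at s)"
      using N[of n] by (auto intro!: derivative_eq_intros)
    from DERIV_cdivide[OF DERIV_chain2[OF flat_has_derivative this], of i "N n ^ k"] show ?thesis
      unfolding \<theta>_def[abs_def] by (rule DERIV_cong) (use N[of n] in \<open>simp add: field_simps\<close>)
  qed
  have dW: "(W n has_real_derivative W1 n s) (at s)" for n s
    unfolding W_def[abs_def] W1_def
    by (rule DERIV_cong[OF DERIV_mult[OF dF d\<theta>]]) (simp add: F1_def algebra_simps)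
  have dW1: "(W1 n has_real_derivative W2 n s) (at s)" for n s
    unfolding W1_def[abs_def] W2_def
    by (rule DERIV_cong[OF DERIV_add[OF DERIV_mult[OF dF1 d\<theta>] DERIV_cmult[OF DERIV_mult[OF dF d\<theta>]]]])
      (simp add: F1_def algebra_simps numeral_2_eq_2)
  have smF: "smooth_fun (F i)" for i
    using smooth_compose_real[OF smooth_flat smooth_affine[of 1 "- R"], of i] by (simp add: F_def[abs_def])
  have smW: "smooth_fun (W n)" for n
    unfolding W_def[abs_def] using smooth_mult[OF smF smooth_cutoff[of 0 "N n"]] by (simp add: \<theta>_def)
  have W0: "W n s = 0" if "s \<le> R" for n s using that by (simp add: W_def F_def)
  have WM: "W n s = 0" if "N n \<le> s" for n s using that N[of n] by (simp add: W_def \<theta>_def)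
  have Wnn: "0 \<le> W n s" for n s by (simp add: W_def F_def \<theta>_def flat_nonneg)
  have bF: "decays R i (\<lambda>n. F i)" for i unfolding F_def using decays_flat[OF R0] .
  have b\<theta>: "decays R (real k) (\<theta> i k)" for i k
    unfolding \<theta>_def[abs_def] N_def using decays_cutoff[OF R0] .
  have bF1: "decays R (j + 1) (\<lambda>n. F1)" unfolding F1_def
    by (intro decays_add decays_cmult bF decays_weaken[OF bF[of "j + 2"]]) (use R in auto)
  have bF2: "decays R (j + 2) (\<lambda>n. F2)" unfolding F2_def
    by (intro decays_add decays_cmult bF decays_weaken[OF bF[of "j + 3"]] decays_weaken[OF bF[of "j + 4"]]) (use R in auto)
  have bW1: "decays R (j + 1) W1" unfolding W1_def[abs_def]
    by (intro decays_add decays_cmult decays_mult[OF bF1 b\<theta>] decays_mult[OF bF b\<theta>]) auto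
  have bW2: "decays R (j + 2) W2" unfolding W2_def[abs_def]
    by (intro decays_add decays_cmult decays_mult[OF bF2 b\<theta>] decays_mult[OF bF1 b\<theta>]
      decays_mult[OF bF[of j] decays_add[OF b\<theta>[of 2 4] decays_cmult[OF b\<theta>[of 2 3]]]]) auto
  \<comment> \<open>This is the Laplacian of W(|x|^2). Each derivative gains a power of s, so even
    after the factor s in front of \<open>W2\<close> it is one power of s smaller than W, uniformly
    in n.\<close>
  have "decays R (j + 1) (\<lambda>n s. 4 * (s * W2 n s) + (2 * ?d) * W1 n s)"
    by (intro decays_add decays_cmult decays_mult[OF decays_ident bW2] bW1) (use R in auto)
  then obtain K where K: "0 \<le> K" "\<And>n s. R < s \<Longrightarrow> \<bar>4 * (s * W2 n s) + (2 * ?d) * W1 n s\<bar> \<le> K * s powr (- (j + 1))"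
    using decaysD by blast
  have left: "4 * (s * W2 n s) + (2 * ?d) * W1 n s = 0" if "s \<le> R" for n s
    using that by (simp add: W1_def W2_def F1_def F2_def F_def)
  define I where "I = K * (LINT x|lebesgue. q x * (indicator {R<..} (sq x) * sq x powr (- (j + 1))))"
  have small1: "AE x in lebesgue. R < sq x \<longrightarrow> q x \<le> 1" using small by (auto elim!: eventually_mono)
  note ER = elliptic_radial[where W = "W n" and W' = "W1 n" and W'' = "W2 n" and M = "N n" for n, OF smW dW dW1 R(1) W0 WM small1]
  have bound: "(LINT x|lebesgue. q x * W n (sq x)) \<le> 2 * I" for n
  proof -
    \<comment> \<open>Where \<open>W n\<close> can be nonzero, \<open>far\<close> bounds the zero
      order coefficient below by 1/2; this is the origin of the factor 2 in the bound.\<close>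
    have "(LINT x|lebesgue. (1 / 2) * (q x * W n (sq x))) \<le> (LINT x|lebesgue. q x * (W n (sq x) * (1 - c / sq x - q x powr (4 / DIM('a)))))"
    proof (rule integral_mono_AE)
      show "integrable lebesgue (\<lambda>x. (1 / 2) * (q x * W n (sq x)))" using ER(3)[of n] by simp
      show "integrable lebesgue (\<lambda>x. q x * (W n (sq x) * (1 - c / sq x - q x powr (4 / DIM('a)))))" using ER(2)[of n] by simp
      show "AE x in lebesgue. (1 / 2) * (q x * W n (sq x)) \<le> q x * (W n (sq x) * (1 - c / sq x - q x powr (4 / DIM('a))))"
        using small q_nonneg
      proof eventually_elim
        case (elim x)
        show ?case
        proof (cases "R < sq x")
          case True
          have "c / sq x \<le> \<bar>c\<bar> / sq x" by (intro divide_right_mono) auto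
          also have "\<dots> \<le> 1 / 4" by (subst pos_divide_le_eq) (use True R in linarith)+
          finally have "1 / 2 \<le> 1 - c / sq x - q x powr (4 / DIM('a))" using elim True by simp
          then have "q x * (W n (sq x) * (1 / 2)) \<le> q x * (W n (sq x) * (1 - c / sq x - q x powr (4 / DIM('a))))"
            using elim by (intro mult_left_mono Wnn) auto
          then show ?thesis by simp
        qed (simp add: W0)
      qed
    qed
    also have "\<dots> = (LINT x|lebesgue. q x * (4 * sq x * W2 n (sq x) + 2 * ?d * W1 n (sq x)))"
      using ER(4)[of n] by simp
    also have "\<dots> \<le> (LINT x|lebesgue. K * (q x * (indicator {R<..} (sq x) * sq x powr (- (j + 1)))))"
    proof (rule integral_mono_AE)
      show "integrable lebesgue (\<lambda>x. q x * (4 * sq x * W2 n (sq x) + 2 * ?d * W1 n (sq x)))" using ER(1)[of n] by simp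
      show "integrable lebesgue (\<lambda>x. K * (q x * (indicator {R<..} (sq x) * sq x powr (- (j + 1)))))"
        using int by (rule integrable_mult_right)
      show "AE x in lebesgue. q x * (4 * sq x * W2 n (sq x) + 2 * ?d * W1 n (sq x))
        \<le> K * (q x * (indicator {R<..} (sq x) * sq x powr (- (j + 1))))"
        using q_nonneg
      proof eventually_elim
        case (elim x)
        have "4 * sq x * W2 n (sq x) + 2 * ?d * W1 n (sq x) \<le> K * (indicator {R<..} (sq x) * sq x powr (- (j + 1)))"
          using K(2)[of "sq x" n] left[of "sq x" n] by (cases "R < sq x") auto
        from mult_left_mono[OF this elim] show ?case by (simp only: mult.left_commute)
      qed
    qed
    also have "\<dots> = I" by (simp add: I_def)
    finally show ?thesis by simp
  qed
  have [measurable]: "F i \<in> borel_measurable borel" "W n \<in> borel_measurable borel" for i n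
    by (intro borel_measurable_continuous_onI smooth_continuous smF smW)+
  \<comment> \<open>Fatou's lemma along the cutoffs: the integrals stay below 2 I, and the cutoff
    tends to \<open>flat 0 1\<close>, which accounts for the factor
    \<open>exp (- 1)\<close>.\<close>
  have iF: "integrable lebesgue (\<lambda>x. q x * (F j (sq x) * exp (- 1)))"
  proof (rule integrableI_bounded)
    let ?h = "\<lambda>x. ennreal (norm (q x * (F j (sq x) * exp (- 1))))"
    have nb: "(\<integral>\<^sup>+x. ennreal (norm (q x * W n (sq x))) \<partial>lebesgue) \<le> ennreal (2 * I)" for n
    proof -
      have "(\<integral>\<^sup>+x. ennreal (norm (q x * W n (sq x))) \<partial>lebesgue) = (\<integral>\<^sup>+x. ennreal (q x * W n (sq x)) \<partial>lebesgue)"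
        by (rule nn_integral_cong_AE) (use q_nonneg in \<open>eventually_elim, simp add: Wnn\<close>)
      also have "\<dots> = ennreal (LINT x|lebesgue. q x * W n (sq x))"
      proof (rule nn_integral_eq_integral)
        show "integrable lebesgue (\<lambda>x. q x * W n (sq x))" using ER(3)[of n] by simp
        show "AE x in lebesgue. 0 \<le> q x * W n (sq x)" using q_nonneg by eventually_elim (simp add: Wnn)
      qed
      finally show ?thesis using bound[of n] by (simp add: ennreal_leI)
    qed
    have lim: "(\<lambda>n. ennreal (norm (q x * W n (sq x)))) \<longlonglongrightarrow> ?h x" for x
    proof -
      have "(\<lambda>n. 1 - (sq x) * inverse (real (Suc n))) \<longlonglongrightarrow> 1 - (sq x) * 0"
        by (intro tendsto_intros LIMSEQ_inverse_real_of_nat)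
      then have "(\<lambda>n. 1 - sq x / N n) \<longlonglongrightarrow> 1" by (simp add: divide_inverse N_def)
      moreover have "isCont (flat 0) 1"
        using smooth_continuous[OF smooth_flat, of UNIV] by (simp add: continuous_on_eq_continuous_at)
      ultimately have "(\<lambda>n. flat 0 (1 - sq x / N n)) \<longlonglongrightarrow> flat 0 1"
        by (rule isCont_tendsto_compose[rotated])
      then have "(\<lambda>n. flat 0 (1 - sq x / N n)) \<longlonglongrightarrow> exp (- 1)" by (simp add: flat_def)
      then show ?thesis
        unfolding W_def \<theta>_def power_0 div_by_1 by (intro tendsto_intros)
    qed
    have "(\<integral>\<^sup>+x. ?h x \<partial>lebesgue) = (\<integral>\<^sup>+x. liminf (\<lambda>n. ennreal (norm (q x * W n (sq x)))) \<partial>lebesgue)"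
      by (intro nn_integral_cong lim_imp_Liminf[symmetric] lim) simp
    also have "\<dots> \<le> liminf (\<lambda>n. \<integral>\<^sup>+x. ennreal (norm (q x * W n (sq x))) \<partial>lebesgue)"
      by (rule nn_integral_liminf) measurable
    also have "\<dots> \<le> liminf (\<lambda>n. ennreal (2 * I))"
      by (rule Liminf_mono) (use nb in auto)
    also have "\<dots> = ennreal (2 * I)" by (simp add: Liminf_const)
    also have "\<dots> < \<infinity>" by simp
    finally show "(\<integral>\<^sup>+x. ?h x \<partial>lebesgue) < \<infinity>" .
  qed measurable
  \<comment> \<open>One e undoes the limit of the cutoff, the other the loss in
    \<open>flat_ge_powr\<close>, and the power of R + 1 replaces s - R by s. The comparison requires
    s - R >= 1, hence the radius R + 1 in the conclusion.\<close>
  let ?C = "exp 2 * (R + 1) powr \<bar>- j\<bar>"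
  show ?thesis
  proof (rule Bochner_Integration.integrable_bound[OF integrable_mult_right[OF iF, of ?C]])
    show "AE x in lebesgue. norm (q x * (indicator {R + 1<..} (sq x) * sq x powr (- j))) \<le> norm (?C * (q x * (F j (sq x) * exp (- 1))))" (is "AE x in _. ?P x")
    proof (rule AE_I2)
      fix x :: 'a
      define s where "s = sq x"
      have "indicator {R + 1<..} s * s powr (- j) \<le> ?C * (F j s * exp (- 1))"
      proof (cases "R + 1 < s")
        case True
        then have s: "1 \<le> s - R" "0 < s" using R by auto
        have "s powr (- j) = (s / (s - R)) powr (- j) * (s - R) powr (- j)"
          using s by (simp add: powr_divide)
        also have "\<dots> \<le> (R + 1) powr \<bar>- j\<bar> * (s - R) powr (- j)"
        proof (intro mult_right_mono powr_ratio_le)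
          have "0 < R * (s - R - 1)" using True R by simp
          then show "s / (s - R) \<le> R + 1" using s R by (simp add: pos_divide_le_eq algebra_simps)
          show "1 \<le> s / (s - R)" using s R by simp
        qed simp
        also have "\<dots> \<le> (R + 1) powr \<bar>- j\<bar> * (exp 1 * F j s)"
        proof -
          have "exp 1 * (exp (- 1) * (s - R) powr (- j)) \<le> exp 1 * F j s"
            unfolding F_def by (intro mult_left_mono flat_ge_powr s) auto
          moreover have "exp 1 * (exp (- 1) * (s - R) powr (- j)) = (s - R) powr (- j)"
            by (simp add: mult.assoc[symmetric] exp_add[symmetric])
          ultimately show ?thesis by (intro mult_left_mono) auto
        qed
        also have "\<dots> = ?C * (F j s * exp (- 1))"
        proof -
          have "exp (2::real) * exp (- 1) = exp 1" by (simp flip: exp_add)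
          then show ?thesis by (simp add: mult_ac)
        qed
        finally show ?thesis using True by simp
      next
        case False
        then show ?thesis by (simp add: F_def flat_nonneg)
      qed
      then have "\<bar>indicator {R + 1<..} s * s powr (- j)\<bar> \<le> \<bar>?C * (F j s * exp (- 1))\<bar>"
        by (simp add: indicator_def split: if_splits)
      then have "\<bar>q x\<bar> * \<bar>indicator {R + 1<..} s * s powr (- j)\<bar> \<le> \<bar>q x\<bar> * \<bar>?C * (F j s * exp (- 1))\<bar>"
        by (rule mult_left_mono) simp
      then show "?P x"
        unfolding s_def by (simp only: real_norm_def abs_mult mult_ac)
    qed
  qed measurable
qed

text \<open>Starts from the weight |x|^(-d); every step raises the exponent by one in s and enlarges
  R by one.\<close>

lemma moments:
  "\<exists>R. far R \<and> integrable lebesgue (\<lambda>x. q x * (indicator {R<..} (sq x) * sq x powr (- (DIM('a) / 2 - real k))))"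
proof (induction k)
  case 0
  obtain R where R: "far R" using far_exists by blast
  have "integrable lebesgue (\<lambda>x. q x * (indicator {R<..} (sq x) * sq x powr (- (DIM('a) / 2))))"
    by (rule Bochner_Integration.integrable_bound[OF q_weight_integrable])
      (measurable, use R in \<open>auto simp: far_def indicator_def intro!: AE_I2\<close>)
  then show ?case using R by auto
next
  case (Suc k)
  then obtain R where R: "far R"
    "integrable lebesgue (\<lambda>x. q x * (indicator {R<..} (sq x) * sq x powr (- (DIM('a) / 2 - real k))))" by blast
  have e: "DIM('a) / 2 - real k = (DIM('a) / 2 - real (Suc k)) + 1" by simp
  from moment_step[OF R(1) R(2)[unfolded e]] far_mono[OF R(1), of "R + 1"] show ?case by auto
qed

text \<open>After d + 1 steps the weight is s^(d/2+1), which dominates s far out, and q <= 1 there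
  gives q^2 <= q. Inside, |x|^2 <= R and square integrability of Q suffice.\<close>

lemma norm_times_Q_L2: "(\<lambda>x. complex_of_real (norm x) * Q x) \<in> L2"
proof -
  let ?d = "real DIM('a)"
  obtain R where R: "far R" "integrable lebesgue (\<lambda>x. q x * (indicator {R<..} (sq x) * sq x powr (- (?d / 2 - real (DIM('a) + 1)))))"
    using moments[of "DIM('a) + 1"] by blast
  have R1: "1 \<le> R" and small: "AE x in lebesgue. R < sq x \<longrightarrow> q x \<le> 1"
    using R(1) by (auto simp: far_def elim!: eventually_mono)
  note [measurable] = L2_measurable[OF Q_L2]
  have "integrable lebesgue (\<lambda>x. (norm (complex_of_real (norm x) * Q x))^2)"
  proof (rule Bochner_Integration.integrable_bound)
    show "integrable lebesgue (\<lambda>x. q x * (indicator {R<..} (sq x) * sq x powr (- (?d / 2 - real (DIM('a) + 1)))) + R * (norm (Q x))^2)"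
      using Q_L2 by (intro Bochner_Integration.integrable_add R(2) integrable_mult_right) (simp add: L2_def)
    show "AE x in lebesgue. norm ((norm (complex_of_real (norm x) * Q x))^2)
      \<le> norm (q x * (indicator {R<..} (sq x) * sq x powr (- (?d / 2 - real (DIM('a) + 1)))) + R * (norm (Q x))^2)"
      using small Q_eq_q q_nonneg
    proof eventually_elim
      case (elim x)
      have n: "(norm (Q x))^2 = (q x)^2" using elim by simp
      have l: "norm ((norm (complex_of_real (norm x) * Q x))^2) = (sq x) * (q x)^2"
        using n by (simp add: norm_mult power_mult_distrib power2_norm_eq_inner)
      have "(sq x) * (q x)^2 \<le> q x * (indicator {R<..} (sq x) * sq x powr (- (?d / 2 - real (DIM('a) + 1)))) + R * (q x)^2"
      proof (cases "R < sq x")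
        case True
        have "sq x = sq x powr 1" by simp
        also have "\<dots> \<le> sq x powr (- (?d / 2 - real (DIM('a) + 1)))"
          using True R1 by (intro powr_mono) auto
        finally have a: "sq x \<le> sq x powr (- (?d / 2 - real (DIM('a) + 1)))" .
        have "(sq x) * (q x)^2 \<le> (sq x) * q x"
          using elim True by (intro mult_left_mono) (auto simp: power2_eq_square mult_left_le)
        also have "\<dots> \<le> q x * sq x powr (- (?d / 2 - real (DIM('a) + 1)))"
          using mult_left_mono[OF a, of "q x"] elim by (simp add: mult.commute)
        finally show ?thesis using True R1 by (simp add: add_increasing2)
      next
        case False
        then show ?thesis by (simp add: mult_right_mono)
      qed
      then show ?case unfolding l n by simp
    qed
  qed measurable
  then show ?thesis unfolding L2_def by simp
qed

end

subsection \<open>Dilations and quadratic phases\<close>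

lemma lebesgue_density_scale:
  fixes r :: real
  assumes "0 < r"
  shows "(lebesgue :: 'a::euclidean_space measure) = density (distr lebesgue lebesgue ((*\<^sub>R) r)) (\<lambda>_. r ^ DIM('a))"
proof -
  have e: "(\<lambda>x::'a. 0 + (\<Sum>j\<in>Basis. (r * (x \<bullet> j)) *\<^sub>R j)) = (*\<^sub>R) r"
    unfolding scaleR_scaleR[symmetric] scaleR_sum_right[symmetric] euclidean_representation by auto
  show ?thesis
    using lebesgue_affine_euclidean[where c = "\<lambda>_::'a. r" and t = 0] assms unfolding e prod_constant by simp
qed

lemma measurable_lebesgue_scale:
  "f \<in> borel_measurable lebesgue \<Longrightarrow> (\<lambda>x. f (r *\<^sub>R x)) \<in> borel_measurable lebesgue"
  using measurable_compose[OF lebesgue_measurable_scaling] by blast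

lemma
  fixes f :: "'a::euclidean_space \<Rightarrow> 'b::{banach, second_countable_topology}"
  assumes f: "f \<in> borel_measurable lebesgue" and r: "0 < r"
  shows lebesgue_integral_scale: "(LINT x|lebesgue. f x) = r ^ DIM('a) *\<^sub>R (LINT x|lebesgue. f (r *\<^sub>R x))"
    and lebesgue_integrable_scale: "integrable lebesgue f \<longleftrightarrow> integrable lebesgue (\<lambda>x. f (r *\<^sub>R x))"
proof -
  have fm: "f \<in> borel_measurable (distr lebesgue lebesgue ((*\<^sub>R) r))" using f by simp
  have "(LINT x|lebesgue. f x) = (LINT x|density (distr lebesgue lebesgue ((*\<^sub>R) r)) (\<lambda>_. r ^ DIM('a)). f x)"
    using lebesgue_density_scale[OF r, where 'a = 'a] by simp
  also have "\<dots> = (LINT x|distr lebesgue lebesgue ((*\<^sub>R) r). r ^ DIM('a) *\<^sub>R f x)"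
    using r by (intro integral_density fm) auto
  also have "\<dots> = (LINT x|lebesgue. r ^ DIM('a) *\<^sub>R f (r *\<^sub>R x))"
    by (rule integral_distr) (use f in \<open>auto intro!: borel_measurable_scaleR\<close>)
  finally show "(LINT x|lebesgue. f x) = r ^ DIM('a) *\<^sub>R (LINT x|lebesgue. f (r *\<^sub>R x))" by simp
  have "integrable lebesgue f \<longleftrightarrow> integrable (density (distr lebesgue lebesgue ((*\<^sub>R) r)) (\<lambda>_. r ^ DIM('a))) f"
    using lebesgue_density_scale[OF r, where 'a = 'a] by simp
  also have "\<dots> \<longleftrightarrow> integrable (distr lebesgue lebesgue ((*\<^sub>R) r)) (\<lambda>x. r ^ DIM('a) *\<^sub>R f x)"
    using r by (intro integrable_density fm) auto
  also have "\<dots> \<longleftrightarrow> integrable lebesgue (\<lambda>x. r ^ DIM('a) *\<^sub>R f (r *\<^sub>R x))"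
    by (rule integrable_distr_eq) (use f in \<open>auto intro!: borel_measurable_scaleR\<close>)
  also have "\<dots> \<longleftrightarrow> integrable lebesgue (\<lambda>x. f (r *\<^sub>R x))"
  proof
    assume "integrable lebesgue (\<lambda>x. r ^ DIM('a) *\<^sub>R f (r *\<^sub>R x))"
    then have "integrable lebesgue (\<lambda>x. inverse (r ^ DIM('a)) *\<^sub>R (r ^ DIM('a) *\<^sub>R f (r *\<^sub>R x)))"
      by (rule integrable_scaleR_right)
    moreover have "(\<lambda>x. inverse (r ^ DIM('a)) *\<^sub>R (r ^ DIM('a) *\<^sub>R f (r *\<^sub>R x))) = (\<lambda>x. f (r *\<^sub>R x))"
      using r by simp
    ultimately show "integrable lebesgue (\<lambda>x. f (r *\<^sub>R x))" by (simp only:)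
  qed (intro integrable_scaleR_right)
  finally show "integrable lebesgue f \<longleftrightarrow> integrable lebesgue (\<lambda>x. f (r *\<^sub>R x))" .
qed

text \<open>Amplitude, quadratic phase and dilation in a single family. It contains the explicit
  wave at each time, its initial data (r = 1) and the transposed test functions, so boundedness and
  continuity in the parameters need one proof only.\<close>

definition modulate :: "complex \<Rightarrow> real \<Rightarrow> real \<Rightarrow> ('a::euclidean_space \<Rightarrow> complex) \<Rightarrow> 'a \<Rightarrow> complex" where
  "modulate a \<alpha> r F x = a * exp (\<i> * of_real (\<alpha> * (sq x))) * F (r *\<^sub>R x)"

lemma norm_modulate: "norm (modulate a \<alpha> r F x) = norm a * norm (F (r *\<^sub>R x))"
  by (simp add: modulate_def norm_mult)

lemma modulate_measurable:
  fixes F :: "'a::euclidean_space \<Rightarrow> complex"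
  assumes "F \<in> borel_measurable lebesgue" shows "modulate a \<alpha> r F \<in> borel_measurable lebesgue"
proof -
  note [measurable] = measurable_lebesgue_scale[OF assms, of r]
  have [measurable]: "(\<lambda>x::'a. exp (\<i> * complex_of_real (\<alpha> * (sq x)))) \<in> borel_measurable lebesgue"
    by (intro measurable_lebesgue_continuous continuous_intros)
  show ?thesis unfolding modulate_def[abs_def] by measurable
qed

lemma
  fixes F :: "'a::euclidean_space \<Rightarrow> complex"
  assumes F: "F \<in> L2" and r: "0 < r"
  shows modulate_L2: "modulate a \<alpha> r F \<in> L2"
    and L2norm2_modulate: "L2norm2 (modulate a \<alpha> r F) = (norm a)^2 / r ^ DIM('a) * L2norm2 F"
proof -
  have m: "(\<lambda>x. (norm (F x))^2) \<in> borel_measurable lebesgue" using L2_measurable[OF F] by measurable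
  have n: "(norm (modulate a \<alpha> r F x))^2 = (norm a)^2 * (norm (F (r *\<^sub>R x)))^2" for x
    by (simp add: norm_modulate power_mult_distrib)
  have "integrable lebesgue (\<lambda>x. (norm (F (r *\<^sub>R x)))^2)"
    using lebesgue_integrable_scale[OF m r] F by (simp add: L2_def)
  then show "modulate a \<alpha> r F \<in> L2"
    using modulate_measurable[OF L2_measurable[OF F]] by (simp add: L2_def n)
  show "L2norm2 (modulate a \<alpha> r F) = (norm a)^2 / r ^ DIM('a) * L2norm2 F"
    using lebesgue_integral_scale[OF m r] r by (simp add: L2norm2_def n)
qed

lemma test_fun_modulate:
  fixes w :: "'a::euclidean_space \<Rightarrow> complex"
  assumes w: "test_fun w" and r: "0 < r"
  shows "test_fun (modulate a \<alpha> r w)"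
proof -
  obtain R where R: "\<And>x. R \<le> norm x \<Longrightarrow> w x = 0" using test_fun_support[OF w] by metis
  show ?thesis
  proof (rule test_funI[of _ "R / r"])
    show "smooth_fun (modulate a \<alpha> r w)"
      unfolding modulate_def[abs_def]
      by (rule smooth_mult[OF smooth_mult[OF smooth_const smooth_exp_radial]
          smooth_compose_bounded_linear[OF test_fun_smooth[OF w] bounded_linear_scaleR_right]])
    fix x :: 'a assume "R / r < norm x"
    then have "R \<le> norm (r *\<^sub>R x)" using r by (simp add: pos_divide_less_eq mult.commute)
    then show "modulate a \<alpha> r w x = 0" by (simp add: modulate_def R)
  qed
qed

text \<open>A dilation fixes the origin, so the support stays away from it; transposed test
  functions therefore remain admissible in the elliptic equation.\<close>

lemma test_fun_punct_modulate:
  fixes w :: "'a::euclidean_space \<Rightarrow> complex"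
  assumes w: "test_fun_punct w" and r: "0 < r"
  shows "test_fun_punct (modulate a \<alpha> r w)"
proof -
  have t: "test_fun w" using w by (simp add: test_fun_punct_def)
  obtain R where R: "\<And>x. R \<le> norm x \<Longrightarrow> w x = 0" using test_fun_support[OF t] by metis
  obtain s where s: "0 < s" "\<And>x. norm x < s \<Longrightarrow> w x = 0" using test_fun_punct_near_0[OF w] by metis
  show ?thesis
  proof (rule test_fun_punctI[of _ "R / r" "s / r"])
    show "smooth_fun (modulate a \<alpha> r w)" by (rule test_fun_smooth[OF test_fun_modulate[OF t r]])
    show "0 < s / r" using s r by simp
    fix x :: 'a
    show "modulate a \<alpha> r w x = 0" if "R / r < norm x"
    proof -
      have "R \<le> norm (r *\<^sub>R x)" using r that by (simp add: pos_divide_less_eq mult.commute)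
      then show ?thesis by (simp add: modulate_def R)
    qed
    show "modulate a \<alpha> r w x = 0" if "norm x < s / r"
    proof -
      have "norm (r *\<^sub>R x) < s" using r that by (simp add: pos_less_divide_eq mult.commute)
      then show ?thesis by (simp add: modulate_def s)
    qed
  qed
qed

lemma pd_modulate:
  fixes w :: "'a::euclidean_space \<Rightarrow> complex"
  assumes "smooth_fun w"
  shows "pd b (modulate a \<alpha> r w) x = of_real r * modulate a \<alpha> r (pd b w) x + 2 * \<i> * of_real \<alpha> * of_real (x \<bullet> b) * modulate a \<alpha> r w x"
proof -
  have s: "smooth_fun (\<lambda>x. w (r *\<^sub>R x))"
    by (rule smooth_compose_bounded_linear[OF assms bounded_linear_scaleR_right])
  have e: "modulate a \<alpha> r w = (\<lambda>x. a * (exp (\<i> * of_real (\<alpha> * (sq x))) * w (r *\<^sub>R x)))"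
    by (rule ext) (simp add: modulate_def)
  have "pd b (modulate a \<alpha> r w) x = a * (exp (\<i> * of_real (\<alpha> * (sq x))) * pd b (\<lambda>x. w (r *\<^sub>R x)) x
      + pd b (\<lambda>x. exp (\<i> * of_real (\<alpha> * (sq x)))) x * w (r *\<^sub>R x)) + pd b (\<lambda>x. a) x * (exp (\<i> * of_real (\<alpha> * (sq x))) * w (r *\<^sub>R x))"
    unfolding e pd_mult[OF smooth_const smooth_mult[OF smooth_exp_radial s]] pd_mult[OF smooth_exp_radial s] ..
  also have "pd b (\<lambda>x. a) x = 0" by (rule pd_eq[OF has_derivative_const])
  finally have E: "pd b (modulate a \<alpha> r w) x = a * (exp (\<i> * of_real (\<alpha> * (sq x))) * pd b (\<lambda>x. w (r *\<^sub>R x)) x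
      + pd b (\<lambda>x. exp (\<i> * of_real (\<alpha> * (sq x)))) x * w (r *\<^sub>R x))" by simp
  show ?thesis
    unfolding E pd_scale[OF assms] pd_exp_radial by (simp add: modulate_def scaleR_conv_of_real algebra_simps)
qed

text \<open>Substitution y = r x. The transpose of a modulation is again a modulation up to the
  Jacobian; the phase keeps its sign because the pairing is bilinear, without conjugation.\<close>

lemma integral_modulate:
  fixes F w :: "'a::euclidean_space \<Rightarrow> complex"
  assumes F: "F \<in> borel_measurable lebesgue" and w: "w \<in> borel_measurable lebesgue" and r: "0 < r"
  shows "(LINT x|lebesgue. modulate a \<alpha> r F x * w x)
    = of_real (1 / r ^ DIM('a)) * (LINT y|lebesgue. F y * modulate a (\<alpha> / r^2) (1 / r) w y)"
proof -
  note fw = modulate_measurable[OF F] w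
  have "(LINT x|lebesgue. modulate a \<alpha> r F x * w x)
    = (1 / r) ^ DIM('a) *\<^sub>R (LINT y|lebesgue. modulate a \<alpha> r F ((1 / r) *\<^sub>R y) * w ((1 / r) *\<^sub>R y))"
    by (rule lebesgue_integral_scale) (use fw r in auto)
  also have "(\<lambda>y. modulate a \<alpha> r F ((1 / r) *\<^sub>R y) * w ((1 / r) *\<^sub>R y)) = (\<lambda>y. F y * modulate a (\<alpha> / r^2) (1 / r) w y)"
    using r by (intro ext) (simp add: modulate_def power2_eq_square mult_ac)
  finally show ?thesis by (simp add: scaleR_conv_of_real power_one_over)
qed

text \<open>The derivative is moved to the transposed test function, where the classical product
  rule holds. The gradient of the phase contributes the term with x_b Q, so the first moment of Q
  must be square integrable; dividing \<alpha> by r expresses x_b through the dilated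
  coordinate.\<close>

lemma weak_partial_modulate:
  fixes Q :: "'a::euclidean_space \<Rightarrow> complex"
  assumes Q: "Q \<in> L2" and G: "G \<in> L2" and X: "(\<lambda>x. of_real (x \<bullet> b) * Q x) \<in> L2" and wp: "weak_partial Q b G" and r: "0 < r"
  shows "weak_partial (modulate a \<alpha> r Q) b (\<lambda>x. of_real r * modulate a \<alpha> r G x + 2 * \<i> * of_real (\<alpha> / r) * modulate a \<alpha> r (\<lambda>y. of_real (y \<bullet> b) * Q y) x)"
  unfolding weak_partial_def
proof (intro allI impI)
  fix \<psi> :: "'a \<Rightarrow> complex" assume \<psi>: "test_fun \<psi>"
  let ?m = "\<lambda>w. modulate a (\<alpha> / r^2) (1 / r) w"
  let ?V = "of_real (1 / r ^ DIM('a)) :: complex"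
  have r1: "0 < 1 / r" using r by simp
  have t: "test_fun (?m \<psi>)" by (rule test_fun_modulate[OF \<psi> r1])
  have m: "\<psi> \<in> borel_measurable lebesgue" "pd b \<psi> \<in> borel_measurable lebesgue"
    using L2_measurable test_fun_L2 \<psi> test_fun_pd by blast+
  have pd: "?m (pd b \<psi>) y = of_real r * pd b (?m \<psi>) y - 2 * \<i> * of_real (\<alpha> / r) * of_real (y \<bullet> b) * ?m \<psi> y" for y
    using pd_modulate[OF test_fun_smooth[OF \<psi>], of b a "\<alpha> / r^2" "1 / r" y] r
    by (simp add: field_simps power2_eq_square)
  have i1: "integrable lebesgue (\<lambda>y. Q y * pd b (?m \<psi>) y)" by (rule L2_test_integrable[OF Q test_fun_pd[OF t]])
  have i2: "integrable lebesgue (\<lambda>y. of_real (y \<bullet> b) * Q y * ?m \<psi> y)" by (rule L2_test_integrable[OF X t])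
  have "(LINT x|lebesgue. modulate a \<alpha> r Q x * pd b \<psi> x) = ?V * (LINT y|lebesgue. Q y * ?m (pd b \<psi>) y)"
    by (rule integral_modulate[OF L2_measurable[OF Q] m(2) r])
  also have "(LINT y|lebesgue. Q y * ?m (pd b \<psi>) y) = (LINT y|lebesgue. of_real r * (Q y * pd b (?m \<psi>) y) - 2 * \<i> * of_real (\<alpha> / r) * (of_real (y \<bullet> b) * Q y * ?m \<psi> y))"
    by (intro Bochner_Integration.integral_cong) (simp_all add: pd algebra_simps)
  also have "\<dots> = of_real r * (LINT y|lebesgue. Q y * pd b (?m \<psi>) y) - 2 * \<i> * of_real (\<alpha> / r) * (LINT y|lebesgue. of_real (y \<bullet> b) * Q y * ?m \<psi> y)"
    using i1 i2 by (subst Bochner_Integration.integral_diff) auto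
  also have "(LINT y|lebesgue. Q y * pd b (?m \<psi>) y) = - (LINT y|lebesgue. G y * ?m \<psi> y)"
    using wp t unfolding weak_partial_def by blast
  finally have L: "(LINT x|lebesgue. modulate a \<alpha> r Q x * pd b \<psi> x)
    = - (of_real r * (?V * (LINT y|lebesgue. G y * ?m \<psi> y)) + 2 * \<i> * of_real (\<alpha> / r) * (?V * (LINT y|lebesgue. of_real (y \<bullet> b) * Q y * ?m \<psi> y)))"
    by (simp add: algebra_simps)
  have j1: "integrable lebesgue (\<lambda>x. modulate a \<alpha> r G x * \<psi> x)"
    by (rule L2_test_integrable[OF modulate_L2[OF G r] \<psi>])
  have j2: "integrable lebesgue (\<lambda>x. modulate a \<alpha> r (\<lambda>y. of_real (y \<bullet> b) * Q y) x * \<psi> x)"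
    by (rule L2_test_integrable[OF modulate_L2[OF X r] \<psi>])
  have "(LINT x|lebesgue. (of_real r * modulate a \<alpha> r G x + 2 * \<i> * of_real (\<alpha> / r) * modulate a \<alpha> r (\<lambda>y. of_real (y \<bullet> b) * Q y) x) * \<psi> x)
    = (LINT x|lebesgue. of_real r * (modulate a \<alpha> r G x * \<psi> x) + 2 * \<i> * of_real (\<alpha> / r) * (modulate a \<alpha> r (\<lambda>y. of_real (y \<bullet> b) * Q y) x * \<psi> x))"
    by (intro Bochner_Integration.integral_cong) (simp_all add: algebra_simps)
  also have "\<dots> = of_real r * (LINT x|lebesgue. modulate a \<alpha> r G x * \<psi> x) + 2 * \<i> * of_real (\<alpha> / r) * (LINT x|lebesgue. modulate a \<alpha> r (\<lambda>y. of_real (y \<bullet> b) * Q y) x * \<psi> x)"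
    using j1 j2 by (subst Bochner_Integration.integral_add) auto
  also have "\<dots> = of_real r * (?V * (LINT y|lebesgue. G y * ?m \<psi> y)) + 2 * \<i> * of_real (\<alpha> / r) * (?V * (LINT y|lebesgue. of_real (y \<bullet> b) * Q y * ?m \<psi> y))"
    by (simp only: integral_modulate[OF L2_measurable[OF G] m(1) r] integral_modulate[OF L2_measurable[OF X] m(1) r])
  finally show "(LINT x|lebesgue. modulate a \<alpha> r Q x * pd b \<psi> x) =
     - (LINT x|lebesgue. (of_real r * modulate a \<alpha> r G x + 2 * \<i> * of_real (\<alpha> / r) * modulate a \<alpha> r (\<lambda>y. of_real (y \<bullet> b) * Q y) x) * \<psi> x)"
    using L by simp
qed

subsection \<open>Strong continuity in \<open>L2\<close>\<close>

lemma L2norm2_nonneg: "0 \<le> L2norm2 f"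
  by (simp add: L2norm2_def)

lemma L2norm2_cmult: "L2norm2 (\<lambda>x. c * f x) = (norm c)^2 * L2norm2 f"
  by (simp add: L2norm2_def norm_mult power_mult_distrib)

lemma L2norm2_add_le:
  assumes f: "f \<in> L2" and g: "g \<in> L2"
  shows "L2norm2 (\<lambda>x. f x + g x) \<le> 2 * L2norm2 f + 2 * L2norm2 g"
proof -
  have "L2norm2 (\<lambda>x. f x + g x) \<le> (LINT x|lebesgue. 2 * (norm (f x))^2 + 2 * (norm (g x))^2)"
    unfolding L2norm2_def
  proof (rule integral_mono)
    show "integrable lebesgue (\<lambda>x. (norm (f x + g x))^2)" using L2_add[OF f g] by (simp add: L2_def)
    show "integrable lebesgue (\<lambda>x. 2 * (norm (f x))^2 + 2 * (norm (g x))^2)" using f g by (simp add: L2_def)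
    fix x
    have "(norm (f x + g x))^2 \<le> (norm (f x) + norm (g x))^2"
      by (intro power_mono norm_triangle_ineq) auto
    also have "\<dots> \<le> 2 * (norm (f x))^2 + 2 * (norm (g x))^2"
      using sum_squares_bound[of "norm (f x)" "norm (g x)"] by (simp add: power2_sum)
    finally show "(norm (f x + g x))^2 \<le> 2 * (norm (f x))^2 + 2 * (norm (g x))^2" .
  qed
  also have "\<dots> = 2 * L2norm2 f + 2 * L2norm2 g"
    unfolding L2norm2_def using f g by (subst Bochner_Integration.integral_add) (auto simp: L2_def)
  finally show ?thesis .
qed

lemma L2norm2_dominated_tendsto_0:
  fixes f :: "nat \<Rightarrow> 'a::euclidean_space \<Rightarrow> complex"
  assumes "\<And>n. f n \<in> borel_measurable lebesgue" "g \<in> L2" "\<And>n. AE x in lebesgue. norm (f n x) \<le> norm (g x)"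
    "AE x in lebesgue. (\<lambda>n. f n x) \<longlonglongrightarrow> 0"
  shows "(\<lambda>n. L2norm2 (f n)) \<longlonglongrightarrow> 0"
proof -
  have "(\<lambda>n. LINT x|lebesgue. (norm (f n x))^2) \<longlonglongrightarrow> (LINT x|(lebesgue::'a measure). 0)"
  proof (rule integral_dominated_convergence[where w = "\<lambda>x. (norm (g x))^2"])
    show "integrable lebesgue (\<lambda>x. (norm (g x))^2)" using assms(2) by (simp add: L2_def)
    show "AE x in lebesgue. norm ((norm (f n x))^2) \<le> (norm (g x))^2" for n
      using assms(3)[of n] by (auto elim!: eventually_mono intro: power_mono)
    show "AE x in lebesgue. (\<lambda>n. (norm (f n x))^2) \<longlonglongrightarrow> 0"
      using assms(4)
    proof eventually_elim
      case (elim x)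
      then have "(\<lambda>n. (norm (f n x))^2) \<longlonglongrightarrow> (norm (0::complex))^2" by (intro tendsto_intros)
      then show ?case by simp
    qed
    show "(\<lambda>x. (norm (f n x))^2) \<in> borel_measurable lebesgue" for n using assms(1)[of n] by measurable
  qed simp
  then show ?thesis by (simp add: L2norm2_def)
qed

text \<open>First Q-like data are truncated in space and in size, giving \<open>T k\<close>. Almost
  everywhere limits of continuous functions then approximate \<open>T k\<close>; forcing these to
  obey the same truncation provides a dominating function. The two errors below \<epsilon>/4 are
  doubled by \<open>L2norm2_add_le\<close>.\<close>

lemma L2_approx_continuous:
  fixes F :: "'a::euclidean_space \<Rightarrow> complex"
  assumes F: "F \<in> L2" and \<epsilon>: "0 < \<epsilon>"
  obtains h R where "continuous_on UNIV h" "\<And>x. R < norm x \<Longrightarrow> h x = 0" "L2norm2 (\<lambda>x. F x - h x) < \<epsilon>"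
proof -
  note [measurable] = L2_measurable[OF F]
  define T where "T k x = (if norm x \<le> real k \<and> norm (F x) \<le> real k then F x else 0)" for k :: nat and x
  have Tm[measurable]: "T k \<in> borel_measurable lebesgue" for k
    unfolding T_def[abs_def] by measurable
  have "(\<lambda>k. L2norm2 (\<lambda>x. F x - T k x)) \<longlonglongrightarrow> 0"
  proof (rule L2norm2_dominated_tendsto_0[OF _ F])
    show "AE x in lebesgue. norm (F x - T k x) \<le> norm (F x)" for k by (intro AE_I2) (auto simp: T_def)
    show "AE x in lebesgue. (\<lambda>k. F x - T k x) \<longlonglongrightarrow> 0" (is "AE x in _. ?P x")
    proof (rule AE_I2)
      fix x
      obtain N where N: "max (norm x) (norm (F x)) < real N" using reals_Archimedean2 by blast
      have "\<forall>\<^sub>F k in sequentially. F x - T k x = 0"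
        using eventually_ge_at_top[of N] by eventually_elim (use N in \<open>auto simp: T_def\<close>)
      then show "?P x" by (rule tendsto_eventually)
    qed
  qed measurable
  then have "\<forall>\<^sub>F k in sequentially. L2norm2 (\<lambda>x. F x - T k x) < \<epsilon> / 4"
    using \<epsilon> by (intro order_tendstoD) auto
  then have "\<forall>\<^sub>F k in sequentially. L2norm2 (\<lambda>x. F x - T k x) < \<epsilon> / 4 \<and> 0 < k"
    using eventually_gt_at_top[of 0] by eventually_elim simp
  then obtain k where k: "L2norm2 (\<lambda>x. F x - T k x) < \<epsilon> / 4" "0 < k"
    by (auto dest: eventually_happens)
  have "T k measurable_on UNIV"
    using lebesgue_measurable_imp_measurable_on[of "T k" UNIV] by simp
  then obtain N g where N: "negligible N" and g: "\<And>n. continuous_on UNIV (g n)" "\<And>x. x \<notin> N \<Longrightarrow> (\<lambda>n. g n x) \<longlonglongrightarrow> T k x"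
    unfolding measurable_on_def by auto
  \<comment> \<open>\<open>clip\<close> is the radial retraction onto the disc of radius k and
    \<open>cut\<close> equals 1 on the ball of radius k. Both leave \<open>T k\<close> unchanged, so
    the limit is not disturbed.\<close>
  define clip :: "complex \<Rightarrow> complex" where "clip z = (real k / max (real k) (norm z)) *\<^sub>R z" for z
  define cut :: "'a \<Rightarrow> real" where "cut x = max 0 (min 1 (real k + 1 - norm x))" for x
  define h where "h n x = cut x *\<^sub>R clip (g n x)" for n x
  have clipc: "continuous_on UNIV clip"
    unfolding clip_def[abs_def] using k(2) by (intro continuous_intros) auto
  have cutc: "continuous_on UNIV cut" unfolding cut_def[abs_def] by (intro continuous_intros)
  have hc: "continuous_on UNIV (h n)" for n
    unfolding h_def[abs_def] by (intro continuous_on_scaleR cutc continuous_on_compose2[OF clipc g(1)]) auto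
  have h0: "h n x = 0" if "real k + 1 < norm x" for n x using that by (simp add: h_def cut_def)
  have clipn: "norm (clip z) \<le> real k" for z
    using k(2) by (auto simp: clip_def max_def field_simps)
  have hn: "norm (h n x) \<le> real k" for n x
  proof -
    have "norm (h n x) \<le> 1 * real k" unfolding h_def norm_scaleR by (intro mult_mono clipn) (auto simp: cut_def)
    then show ?thesis by simp
  qed
  have hlim: "(\<lambda>n. h n x) \<longlonglongrightarrow> T k x" if "x \<notin> N" for x
  proof -
    have "isCont clip (T k x)" using clipc by (simp add: continuous_on_eq_continuous_at)
    from isCont_tendsto_compose[OF this g(2)[OF that]] have "(\<lambda>n. h n x) \<longlonglongrightarrow> cut x *\<^sub>R clip (T k x)"
      unfolding h_def by (intro tendsto_scaleR tendsto_const)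
    moreover have "cut x *\<^sub>R clip (T k x) = T k x"
      using k(2) by (auto simp: T_def clip_def cut_def)
    ultimately show ?thesis by simp
  qed
  have "(\<lambda>n. L2norm2 (\<lambda>x. T k x - h n x)) \<longlonglongrightarrow> 0"
  proof (rule L2norm2_dominated_tendsto_0)
    show "(\<lambda>x::'a. of_real (2 * real k * indicator (cball 0 (real k + 1)) x)) \<in> L2"
      by (rule L2_bounded_support[of _ "2 * real k" "real k + 1"]) (measurable, auto simp: indicator_def)
    show "(\<lambda>x. T k x - h n x) \<in> borel_measurable lebesgue" for n
      using measurable_lebesgue_continuous[OF hc] by measurable
    show "AE x in lebesgue. norm (T k x - h n x) \<le> norm (complex_of_real (2 * real k * indicator (cball 0 (real k + 1)) x))" (is "AE x in _. ?P x") for n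
    proof (rule AE_I2)
      fix x
      have "norm (T k x) \<le> real k" by (simp add: T_def)
      then have "norm (T k x - h n x) \<le> 2 * real k"
        using norm_triangle_ineq4[of "T k x" "h n x"] hn[of n x] by linarith
      moreover have "T k x - h n x = 0" if "x \<notin> cball 0 (real k + 1)"
        using that h0[of x n] by (simp add: T_def)
      ultimately show "?P x"
        by (auto simp: indicator_def)
    qed
    have "AE x in lebesgue. x \<notin> N" using N by (intro AE_not_in) (simp add: negligible_iff_null_sets)
    then show "AE x in lebesgue. (\<lambda>n. T k x - h n x) \<longlonglongrightarrow> 0"
    proof eventually_elim
      case (elim x)
      from tendsto_diff[OF tendsto_const hlim[OF elim], of "T k x"] show ?case by simp
    qed
  qed
  then have "\<forall>\<^sub>F n in sequentially. L2norm2 (\<lambda>x. T k x - h n x) < \<epsilon> / 4"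
    using \<epsilon> by (intro order_tendstoD) auto
  then obtain n where n: "L2norm2 (\<lambda>x. T k x - h n x) < \<epsilon> / 4" by (auto dest: eventually_happens)
  have hL: "h n \<in> L2" by (rule L2_continuous_support[OF hc h0])
  have TL: "T k \<in> L2" by (rule L2_bound[OF F Tm[of k], of 1]) (auto simp: T_def)
  have "L2norm2 (\<lambda>x. F x - h n x) = L2norm2 (\<lambda>x. (F x - T k x) + (T k x - h n x))" by simp
  also have "\<dots> \<le> 2 * L2norm2 (\<lambda>x. F x - T k x) + 2 * L2norm2 (\<lambda>x. T k x - h n x)"
    by (intro L2norm2_add_le L2_diff F TL hL)
  also have "\<dots> < \<epsilon>" using k(1) n by simp
  finally show ?thesis using that[OF hc h0] by blast
qed

lemma modulate_diff: "modulate a \<alpha> r (\<lambda>x. F x - h x) y = modulate a \<alpha> r F y - modulate a \<alpha> r h y"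
  by (simp add: modulate_def algebra_simps)

text \<open>Once r n > r0/2, all dilated functions are supported in the ball of radius 2|R|/r0;
  bounded amplitudes then give a common bound, and continuity of h gives pointwise
  convergence.\<close>

lemma modulate_continuous_tendsto:
  fixes h :: "'a::euclidean_space \<Rightarrow> complex"
  assumes hc: "continuous_on UNIV h" and h0: "\<And>x. R < norm x \<Longrightarrow> h x = 0"
    and a: "a \<longlonglongrightarrow> a0" and \<alpha>: "\<alpha> \<longlonglongrightarrow> \<alpha>0" and r: "r \<longlonglongrightarrow> r0" and r0: "0 < r0"
  shows "(\<lambda>n. L2norm2 (\<lambda>x. modulate (a n) (\<alpha> n) (r n) h x - modulate a0 \<alpha>0 r0 h x)) \<longlonglongrightarrow> 0"
proof -
  obtain B where B: "0 \<le> B" "\<And>x. norm (h x) \<le> B"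
    using continuous_compact_support_bounded[of h R] hc h0 by blast
  obtain A where A: "\<And>n. norm (a n) \<le> A"
    using convergent_imp_Bseq[OF convergentI[OF a]] by (auto simp: Bseq_def)
  have A0: "norm a0 \<le> A" using LIMSEQ_le_const2[OF tendsto_norm[OF a]] A by blast
  have "\<forall>\<^sub>F n in sequentially. r0 / 2 < r n" using r r0 by (intro order_tendstoD) auto
  then obtain N where N: "\<And>n. N \<le> n \<Longrightarrow> r0 / 2 < r n" by (auto simp: eventually_sequentially)
  let ?D = "\<lambda>n x. modulate (a n) (\<alpha> n) (r n) h x - modulate a0 \<alpha>0 r0 h x"
  let ?\<rho> = "2 * \<bar>R\<bar> / r0"
  have hm: "h \<in> borel_measurable lebesgue" by (rule measurable_lebesgue_continuous[OF hc])
  have zero: "h (t *\<^sub>R x) = 0" if "r0 / 2 < t" "?\<rho> < norm x" for t x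
  proof -
    have "\<bar>R\<bar> = r0 / 2 * ?\<rho>" using r0 by simp
    also have "\<dots> \<le> t * norm x" using that r0 by (intro mult_mono) auto
    finally have 1: "\<bar>R\<bar> \<le> t * norm x" .
    have "r0 / 2 * ?\<rho> < t * norm x"
    proof -
      have "0 \<le> ?\<rho>" using r0 by simp
      then have "r0 / 2 * ?\<rho> \<le> t * ?\<rho>" using that by (intro mult_right_mono) auto
      also have "\<dots> < t * norm x" using that r0 by (intro mult_strict_left_mono) auto
      finally show ?thesis .
    qed
    then have "R < norm (t *\<^sub>R x)" using that r0 by simp
    then show ?thesis by (rule h0)
  qed
  have nb: "norm (modulate b \<beta> t h x) \<le> A * B" if "norm b \<le> A" for b \<beta> t x
    unfolding norm_modulate using that B by (intro mult_mono) (auto intro: order_trans[OF norm_ge_zero])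
  have "(\<lambda>n. L2norm2 (?D (n + N))) \<longlonglongrightarrow> 0"
  proof (rule L2norm2_dominated_tendsto_0)
    show "(\<lambda>x::'a. of_real (2 * (A * B) * indicator (cball 0 ?\<rho>) x)) \<in> L2"
      by (rule L2_bounded_support[of _ "\<bar>2 * (A * B)\<bar>" ?\<rho>]) (measurable, auto simp: indicator_def norm_mult abs_mult)
    show "?D (n + N) \<in> borel_measurable lebesgue" for n
      using modulate_measurable[OF hm] by (intro borel_measurable_diff) auto
    show "AE x in lebesgue. norm (?D (n + N) x) \<le> norm (complex_of_real (2 * (A * B) * indicator (cball 0 ?\<rho>) x))" (is "AE x in _. ?P x") for n
    proof (rule AE_I2)
      fix x :: 'a
      show "?P x"
      proof (cases "norm x \<le> ?\<rho>")
        case True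
        have "norm (?D (n + N) x) \<le> A * B + A * B"
          by (rule order_trans[OF norm_triangle_ineq4 add_mono[OF nb[OF A] nb[OF A0]]])
        also have "\<dots> \<le> norm (complex_of_real (2 * (A * B) * indicator (cball 0 ?\<rho>) x))"
          using True abs_ge_self[of "A * B"] by (simp add: indicator_def norm_mult abs_mult)
        finally show ?thesis .
      next
        case False
        then have "h (r (n + N) *\<^sub>R x) = 0" "h (r0 *\<^sub>R x) = 0"
          using zero[OF N[of "n + N"]] zero[of r0 x] r0 by auto
        then show ?thesis by (simp add: modulate_def)
      qed
    qed
    show "AE x in lebesgue. (\<lambda>n. ?D (n + N) x) \<longlonglongrightarrow> 0" (is "AE x in _. ?P x")
    proof (rule AE_I2)
      fix x :: 'a
      have "isCont h (r0 *\<^sub>R x)" using hc by (simp add: continuous_on_eq_continuous_at)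
      moreover have "(\<lambda>n. r n *\<^sub>R x) \<longlonglongrightarrow> r0 *\<^sub>R x" by (intro tendsto_intros r)
      ultimately have "(\<lambda>n. h (r n *\<^sub>R x)) \<longlonglongrightarrow> h (r0 *\<^sub>R x)" by (rule isCont_tendsto_compose)
      then have "(\<lambda>n. modulate (a n) (\<alpha> n) (r n) h x) \<longlonglongrightarrow> modulate a0 \<alpha>0 r0 h x"
        unfolding modulate_def by (intro tendsto_intros a \<alpha>)
      then have "(\<lambda>n. ?D n x) \<longlonglongrightarrow> modulate a0 \<alpha>0 r0 h x - modulate a0 \<alpha>0 r0 h x"
        by (rule tendsto_diff[OF _ tendsto_const])
      from LIMSEQ_ignore_initial_segment[OF this, of N]
      show "?P x" by simp
    qed
  qed
  then show ?thesis by (rule LIMSEQ_offset)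
qed

text \<open>Density argument: F is replaced by a compactly supported continuous h. The replacement
  error is controlled because modulation multiplies the squared norm by |a|^2 / r^d, which stays
  bounded near the limit.\<close>

lemma modulate_L2_tendsto:
  fixes F :: "'a::euclidean_space \<Rightarrow> complex"
  assumes F: "F \<in> L2" and a: "a \<longlonglongrightarrow> a0" and \<alpha>: "\<alpha> \<longlonglongrightarrow> \<alpha>0" and r: "r \<longlonglongrightarrow> r0" and r0: "0 < r0" and rn: "\<And>n. 0 < r n"
  shows "(\<lambda>n. L2norm2 (\<lambda>x. modulate (a n) (\<alpha> n) (r n) F x - modulate a0 \<alpha>0 r0 F x)) \<longlonglongrightarrow> 0"
proof (rule LIMSEQ_I)
  fix \<epsilon> :: real assume \<epsilon>: "0 < \<epsilon>"
  let ?c = "\<lambda>n. (norm (a n))^2 / r n ^ DIM('a)" and ?b = "(norm a0)^2 / r0 ^ DIM('a)"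
  have c0: "0 \<le> ?b" using r0 by simp
  \<comment> \<open>Three errors of \<epsilon>/16 occur, with weights 2, 4 and 4 from applying
    \<open>L2norm2_add_le\<close> twice; together they are 10/16 of \<epsilon>. The bound
    \<open>?b + 1\<close> serves for both modulation factors.\<close>
  define \<delta> where "\<delta> = \<epsilon> / (16 * (?b + 1))"
  have \<delta>: "0 < \<delta>" using \<epsilon> c0 by (simp add: \<delta>_def)
  have \<delta>e: "(?b + 1) * \<delta> = \<epsilon> / 16"
  proof -
    have "?b + 1 \<noteq> 0" using c0 by linarith
    then show ?thesis unfolding \<delta>_def by (simp only: times_divide_eq_right mult_divide_mult_cancel_left_if mult.commute[of 16]) simp
  qed
  obtain h R where h: "continuous_on UNIV h" "\<And>x. R < norm x \<Longrightarrow> h x = 0" "L2norm2 (\<lambda>x. F x - h x) < \<delta>"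
    using L2_approx_continuous[OF F \<delta>] by metis
  have hL: "h \<in> L2" by (rule L2_continuous_support[OF h(1,2)])
  have fL: "(\<lambda>x. F x - h x) \<in> L2" by (rule L2_diff[OF F hL])
  have "?c \<longlonglongrightarrow> ?b" using r0 by (intro tendsto_intros a r) auto
  then have e1: "\<forall>\<^sub>F n in sequentially. ?c n < ?b + 1" by (intro order_tendstoD) auto
  have e2: "\<forall>\<^sub>F n in sequentially. L2norm2 (\<lambda>x. modulate (a n) (\<alpha> n) (r n) h x - modulate a0 \<alpha>0 r0 h x) < \<epsilon> / 16"
    using \<epsilon> by (intro order_tendstoD(2)[OF modulate_continuous_tendsto[OF h(1,2) a \<alpha> r r0]]) auto
  have "\<forall>\<^sub>F n in sequentially. norm (L2norm2 (\<lambda>x. modulate (a n) (\<alpha> n) (r n) F x - modulate a0 \<alpha>0 r0 F x) - 0) < \<epsilon>"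
    using e1 e2
  proof eventually_elim
    case (elim n)
    let ?f = "modulate (a n) (\<alpha> n) (r n)" and ?g = "modulate a0 \<alpha>0 r0"
    have "L2norm2 (\<lambda>x. ?f F x - ?g F x) = L2norm2 (\<lambda>x. ?f (\<lambda>x. F x - h x) x + ((?f h x - ?g h x) + (- 1) * ?g (\<lambda>x. F x - h x) x))"
      by (simp add: modulate_diff)
    also have "\<dots> \<le> 2 * L2norm2 (?f (\<lambda>x. F x - h x)) + 2 * L2norm2 (\<lambda>x. (?f h x - ?g h x) + (- 1) * ?g (\<lambda>x. F x - h x) x)"
      by (intro L2norm2_add_le L2_add L2_diff L2_cmult modulate_L2 fL hL rn r0)
    also have "L2norm2 (\<lambda>x. (?f h x - ?g h x) + (- 1) * ?g (\<lambda>x. F x - h x) x)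
        \<le> 2 * L2norm2 (\<lambda>x. ?f h x - ?g h x) + 2 * L2norm2 (\<lambda>x. (- 1) * ?g (\<lambda>x. F x - h x) x)"
      by (intro L2norm2_add_le L2_diff L2_cmult modulate_L2 fL hL rn r0)
    finally have le: "L2norm2 (\<lambda>x. ?f F x - ?g F x) \<le> 2 * L2norm2 (?f (\<lambda>x. F x - h x))
        + 2 * (2 * L2norm2 (\<lambda>x. ?f h x - ?g h x) + 2 * L2norm2 (\<lambda>x. (- 1) * ?g (\<lambda>x. F x - h x) x))" by simp
    have 1: "L2norm2 (?f (\<lambda>x. F x - h x)) \<le> \<epsilon> / 16"
    proof -
      have "L2norm2 (?f (\<lambda>x. F x - h x)) = ?c n * L2norm2 (\<lambda>x. F x - h x)" by (rule L2norm2_modulate[OF fL rn])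
      also have "\<dots> \<le> (?b + 1) * \<delta>" using elim(1) h(3) c0 by (intro mult_mono) (auto simp: L2norm2_nonneg)
      finally show ?thesis using \<delta>e by simp
    qed
    have 2: "L2norm2 (\<lambda>x. (- 1) * ?g (\<lambda>x. F x - h x) x) \<le> \<epsilon> / 16"
    proof -
      have "L2norm2 (\<lambda>x. (- 1) * ?g (\<lambda>x. F x - h x) x) = ?b * L2norm2 (\<lambda>x. F x - h x)"
        unfolding L2norm2_cmult L2norm2_modulate[OF fL r0] by simp
      also have "\<dots> \<le> (?b + 1) * \<delta>" using h(3) c0 by (intro mult_mono) (auto simp: L2norm2_nonneg)
      finally show ?thesis using \<delta>e by simp
    qed
    note le
    also have "2 * L2norm2 (?f (\<lambda>x. F x - h x)) + 2 * (2 * L2norm2 (\<lambda>x. ?f h x - ?g h x) + 2 * L2norm2 (\<lambda>x. (- 1) * ?g (\<lambda>x. F x - h x) x))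
      \<le> 2 * (\<epsilon> / 16) + 2 * (2 * (\<epsilon> / 16) + 2 * (\<epsilon> / 16))"
      by (intro add_mono mult_left_mono 1 2 less_imp_le[OF elim(2)]) auto
    also have "\<dots> < \<epsilon>" using \<epsilon> by simp
    finally have "L2norm2 (\<lambda>x. ?f F x - ?g F x) < \<epsilon>" .
    then show ?case using L2norm2_nonneg[of "\<lambda>x. ?f F x - ?g F x"] by simp
  qed
  then show "\<exists>no. \<forall>n\<ge>no. norm (L2norm2 (\<lambda>x. modulate (a n) (\<alpha> n) (r n) F x - modulate a0 \<alpha>0 r0 F x) - 0) < \<epsilon>"
    by (simp add: eventually_sequentially)
qed

subsection \<open>Differentiation under the integral\<close>

lemma vector_derivative_bound:
  fixes f :: "real \<Rightarrow> complex"
  assumes "\<And>s. \<bar>s - t\<bar> < \<delta> \<Longrightarrow> (f has_vector_derivative f' s) (at s)" "\<And>s. \<bar>s - t\<bar> < \<delta> \<Longrightarrow> norm (f' s) \<le> B"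
    and s: "\<bar>s - t\<bar> < \<delta>"
  shows "norm (f s - f t) \<le> B * \<bar>s - t\<bar>"
proof -
  have "norm (f s - f t) \<le> B * norm (s - t)"
  proof (rule differentiable_bound[of "ball t \<delta>" f "\<lambda>s h. h *\<^sub>R f' s"])
    fix x assume "x \<in> ball t \<delta>"
    then have x: "\<bar>x - t\<bar> < \<delta>" by (simp add: dist_real_def abs_minus_commute)
    show "(f has_derivative (\<lambda>h. h *\<^sub>R f' x)) (at x within ball t \<delta>)"
      using assms(1)[OF x] unfolding has_vector_derivative_def by (rule has_derivative_at_withinI)
    show "onorm (\<lambda>h. h *\<^sub>R f' x) \<le> B"
      by (rule onorm_le) (use assms(2)[OF x] in \<open>auto simp: mult.commute[of B] intro!: mult_left_mono\<close>)
  qed (use s in \<open>auto simp: dist_real_def abs_minus_commute\<close>)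
  then show ?thesis by simp
qed

text \<open>By the mean value inequality the remainder of the difference quotient is at most 2B on
  one fixed ball and zero outside. Multiplied by a square integrable Q this is integrable, so
  dominated convergence applies along every sequence tending to t.\<close>

lemma has_vector_derivative_integral:
  fixes Q :: "'a::euclidean_space \<Rightarrow> complex" and K K' :: "real \<Rightarrow> 'a \<Rightarrow> complex"
  assumes Q: "Q \<in> L2" and \<delta>: "0 < \<delta>"
    and D: "\<And>s y. \<bar>s - t\<bar> < \<delta> \<Longrightarrow> ((\<lambda>s. K s y) has_vector_derivative K' s y) (at s)"
    and B: "\<And>s y. \<bar>s - t\<bar> < \<delta> \<Longrightarrow> norm (K' s y) \<le> B * indicator (cball 0 R) y"
    and K: "\<And>s. \<bar>s - t\<bar> < \<delta> \<Longrightarrow> K s \<in> L2" and K': "K' t \<in> borel_measurable lebesgue"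
  shows "((\<lambda>s. LINT y|lebesgue. Q y * K s y) has_vector_derivative (LINT y|lebesgue. Q y * K' t y)) (at t)"
proof -
  let ?f = "\<lambda>s. LINT y|lebesgue. Q y * K s y" and ?D = "LINT y|lebesgue. Q y * K' t y"
  note [measurable] = L2_measurable[OF Q] K'
  have t: "\<bar>t - t\<bar> < \<delta>" using \<delta> by simp
  have Bn: "norm (K' t y) \<le> \<bar>B\<bar>" for y
    using B[OF t, of y] by (cases "norm y \<le> R") auto
  have K'0: "K' t y = 0" if "R < norm y" for y
    using B[OF t, of y] that by simp
  have K'L: "K' t \<in> L2"
    by (rule L2_bounded_support[OF K' Bn K'0])
  have indL: "(\<lambda>y::'a. complex_of_real (2 * B * indicator (cball 0 R) y)) \<in> L2"
    by (rule L2_bounded_support[of _ "\<bar>2 * B\<bar>" R]) (measurable, auto simp: indicator_def norm_mult)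
  have "((\<lambda>s. (1 / norm (s - t)) *\<^sub>R (?f s - (?f t + (s - t) *\<^sub>R ?D))) \<longlongrightarrow> 0) (at t)"
    unfolding tendsto_at_iff_sequentially
  proof (intro allI impI)
    fix X :: "nat \<Rightarrow> real" assume X: "\<forall>i. X i \<in> UNIV - {t}" and lim: "X \<longlonglongrightarrow> t"
    have "\<forall>\<^sub>F n in sequentially. dist (X n) t < \<delta>" using lim \<delta> by (rule tendstoD)
    then obtain N where N: "\<And>n. N \<le> n \<Longrightarrow> \<bar>X n - t\<bar> < \<delta>" by (auto simp: eventually_sequentially dist_real_def)
    let ?g = "\<lambda>n y. Q y * ((1 / norm (X n - t)) *\<^sub>R (K (X n) y - (K t y + (X n - t) *\<^sub>R K' t y)))"
    have gL: "(\<lambda>y. (1 / norm (X n - t)) *\<^sub>R (K (X n) y - (K t y + (X n - t) *\<^sub>R K' t y))) \<in> L2" if "N \<le> n" for n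
      unfolding scaleR_conv_of_real by (intro L2_cmult L2_diff L2_add K N that t K'L)
    have eq: "(LINT y|lebesgue. ?g n y) = (1 / norm (X n - t)) *\<^sub>R (?f (X n) - (?f t + (X n - t) *\<^sub>R ?D))" if n: "N \<le> n" for n
    proof -
      have i: "integrable lebesgue (\<lambda>y. Q y * K (X n) y)" "integrable lebesgue (\<lambda>y. Q y * K t y)" "integrable lebesgue (\<lambda>y. Q y * K' t y)"
        by (intro L2_mult_integrable Q K N n t K'L)+
      have "(LINT y|lebesgue. ?g n y) = (LINT y|lebesgue. (1 / norm (X n - t)) *\<^sub>R (Q y * K (X n) y - (Q y * K t y + (X n - t) *\<^sub>R (Q y * K' t y))))"
        by (intro Bochner_Integration.integral_cong) (simp_all add: algebra_simps)
      also have "\<dots> = (1 / norm (X n - t)) *\<^sub>R (?f (X n) - (?f t + (X n - t) *\<^sub>R ?D))"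
        using i by simp
      finally show ?thesis .
    qed
    have "(\<lambda>n. LINT y|lebesgue. ?g (n + N) y) \<longlonglongrightarrow> (LINT y|(lebesgue::'a measure). 0)"
    proof (rule integral_dominated_convergence[where w = "\<lambda>y. norm (Q y * complex_of_real (2 * B * indicator (cball 0 R) y))"])
      show "integrable lebesgue (\<lambda>y. norm (Q y * complex_of_real (2 * B * indicator (cball 0 R) y)))"
        by (intro integrable_norm L2_mult_integrable Q indL)
      show "(\<lambda>y. ?g (n + N) y) \<in> borel_measurable lebesgue" for n
        by (intro borel_measurable_times L2_measurable Q gL) simp
      show "AE y in lebesgue. norm (?g (n + N) y) \<le> norm (Q y * complex_of_real (2 * B * indicator (cball 0 R) y))" (is "AE y in _. ?P y") for n
      proof (rule AE_I2)
        fix y :: 'a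
        let ?s = "X (n + N)"
        have s: "\<bar>?s - t\<bar> < \<delta>" "?s \<noteq> t" using N[of "n + N"] X by auto
        let ?b = "B * indicator (cball 0 R) y"
        have 1: "norm (K ?s y - K t y) \<le> ?b * \<bar>?s - t\<bar>"
          by (rule vector_derivative_bound[where f' = "\<lambda>s. K' s y", OF D B s(1)])
        have 2: "norm ((?s - t) *\<^sub>R K' t y) \<le> ?b * \<bar>?s - t\<bar>"
          using mult_left_mono[OF B[OF t, of y], of "\<bar>?s - t\<bar>"] by (simp add: mult.commute)
        have "norm (K ?s y - (K t y + (?s - t) *\<^sub>R K' t y)) \<le> 2 * ?b * \<bar>?s - t\<bar>"
          using norm_triangle_ineq4[of "K ?s y - K t y" "(?s - t) *\<^sub>R K' t y"] 1 2 by (simp add: diff_diff_eq)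
        then have "norm ((1 / norm (?s - t)) *\<^sub>R (K ?s y - (K t y + (?s - t) *\<^sub>R K' t y))) \<le> 2 * ?b"
          using s(2) by (simp add: pos_divide_le_eq)
        also have "\<dots> \<le> norm (complex_of_real (2 * B * indicator (cball 0 R) y))"
          by (cases "norm y \<le> R") (auto simp: norm_mult)
        finally show "?P y"
          unfolding norm_mult[of "Q y"] by (intro mult_left_mono) auto
      qed
      show "AE y in lebesgue. (\<lambda>n. ?g (n + N) y) \<longlonglongrightarrow> 0" (is "AE y in _. ?P y")
      proof (rule AE_I2)
        fix y :: 'a
        have "((\<lambda>s. (1 / norm (s - t)) *\<^sub>R (K s y - (K t y + (s - t) *\<^sub>R K' t y))) \<longlongrightarrow> 0) (at t)"
          using D[OF t, of y] unfolding has_vector_derivative_def has_derivative_within by simp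
        then have "(\<lambda>n. (1 / norm (X n - t)) *\<^sub>R (K (X n) y - (K t y + (X n - t) *\<^sub>R K' t y))) \<longlonglongrightarrow> 0"
          using X lim unfolding tendsto_at_iff_sequentially by (auto simp: o_def)
        then have "(\<lambda>n. ?g n y) \<longlonglongrightarrow> Q y * 0" by (intro tendsto_mult tendsto_const)
        from LIMSEQ_ignore_initial_segment[OF this, of N] show "?P y" by simp
      qed
    qed simp
    then have "(\<lambda>n. (1 / norm (X (n + N) - t)) *\<^sub>R (?f (X (n + N)) - (?f t + (X (n + N) - t) *\<^sub>R ?D))) \<longlonglongrightarrow> 0"
      by (simp only: eq le_add2 Bochner_Integration.integral_zero)
    from LIMSEQ_offset[OF this] show "((\<lambda>s. (1 / norm (s - t)) *\<^sub>R (?f s - (?f t + (s - t) *\<^sub>R ?D))) \<circ> X) \<longlonglongrightarrow> 0"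
      by (simp add: o_def)
  qed
  then show ?thesis
    unfolding has_vector_derivative_def has_derivative_within
    by (simp add: bounded_linear_scaleR_left)
qed

section \<open>Space derivatives of modulated functions and time derivatives of phases\<close>

lemma pd_eq_sum:
  fixes w :: "'a::euclidean_space \<Rightarrow> complex"
  assumes "smooth_fun w"
  shows "pd v w x = (\<Sum>b\<in>Basis. of_real (v \<bullet> b) * pd b w x)"
proof -
  have lin: "linear (\<lambda>v. pd v w x)" using has_derivative_linear[OF smooth_has_derivative[OF assms]] .
  have "pd v w x = pd (\<Sum>b\<in>Basis. (v \<bullet> b) *\<^sub>R b) w x" by (simp add: euclidean_representation)
  also have "\<dots> = (\<Sum>b\<in>Basis. (v \<bullet> b) *\<^sub>R pd b w x)"
    using linear_sum[OF lin, of "\<lambda>b. (v \<bullet> b) *\<^sub>R b" Basis] linear_scale[OF lin] by simp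
  finally show ?thesis by (simp add: scaleR_conv_of_real)
qed

lemma lap_modulate:
  fixes w :: "'a::euclidean_space \<Rightarrow> complex"
  assumes w: "smooth_fun w"
  shows "lap (modulate a \<alpha> r w) y = a * exp (\<i> * of_real (\<alpha> * (sq y))) * (of_real (r^2) * lap w (r *\<^sub>R y)
    + 4 * \<i> * of_real (\<alpha> * r) * (\<Sum>b\<in>Basis. of_real (y \<bullet> b) * pd b w (r *\<^sub>R y))
    + (2 * \<i> * of_real (\<alpha> * DIM('a)) - 4 * of_real (\<alpha>^2 * (sq y))) * w (r *\<^sub>R y))"
proof -
  let ?E = "\<lambda>x::'a. exp (\<i> * of_real (\<alpha> * (sq x)))"
  have s: "smooth_fun (\<lambda>x. w (r *\<^sub>R x))"
    by (rule smooth_compose_bounded_linear[OF w bounded_linear_scaleR_right])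
  have c: "pd b (\<lambda>x::'a. a) = (\<lambda>x. 0)" for b by (rule ext) (rule pd_eq[OF has_derivative_const])
  have c2: "pd b (\<lambda>x::'a. 0::complex) x = 0" for b x by (rule pd_eq[OF has_derivative_const])
  have e: "modulate a \<alpha> r w = (\<lambda>x. a * (?E x * w (r *\<^sub>R x)))" by (rule ext) (simp add: modulate_def)
  have 1: "lap (modulate a \<alpha> r w) y = a * lap (\<lambda>x. ?E x * w (r *\<^sub>R x)) y"
    unfolding e lap_mult[OF smooth_const smooth_mult[OF smooth_exp_radial s]] by (simp add: c c2 lap_def)
  have 2: "lap (\<lambda>x. ?E x * w (r *\<^sub>R x)) y = ?E y * lap (\<lambda>x. w (r *\<^sub>R x)) y
      + 2 * (\<Sum>b\<in>Basis. pd b ?E y * pd b (\<lambda>x. w (r *\<^sub>R x)) y) + lap ?E y * w (r *\<^sub>R y)"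
    by (rule lap_mult[OF smooth_exp_radial s])
  have 3: "(\<Sum>b\<in>Basis. pd b ?E y * pd b (\<lambda>x. w (r *\<^sub>R x)) y)
     = 2 * \<i> * of_real (\<alpha> * r) * ?E y * (\<Sum>b\<in>Basis. of_real (y \<bullet> b) * pd b w (r *\<^sub>R y))"
    unfolding pd_exp_radial pd_scale[OF w] sum_distrib_left by (intro sum.cong) (simp_all add: scaleR_conv_of_real)
  show ?thesis unfolding 1 2 3 lap_exp_radial lap_scale[OF w] by (simp add: scaleR_conv_of_real algebra_simps)
qed

lemma has_vector_derivative_exp_i:
  assumes "(f has_real_derivative f') (at s)"
  shows "((\<lambda>s. exp (\<i> * complex_of_real (f s))) has_vector_derivative \<i> * of_real f' * exp (\<i> * of_real (f s))) (at s)"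
proof -
  have "((\<lambda>s. complex_of_real (f s)) has_vector_derivative of_real f') (at s)"
    by (rule bounded_linear.has_vector_derivative[OF bounded_linear_of_real])
      (use assms in \<open>simp add: has_real_derivative_iff_has_vector_derivative\<close>)
  then have "((\<lambda>s. \<i> * complex_of_real (f s)) has_vector_derivative \<i> * of_real f') (at s)"
    by (rule bounded_linear.has_vector_derivative[OF bounded_linear_mult_right])
  from field_vector_diff_chain_at[OF this DERIV_exp] show ?thesis by (simp add: o_def)
qed

subsection \<open>The pseudo-conformal solution\<close>

definition pc_amp :: "nat \<Rightarrow> real \<Rightarrow> real \<Rightarrow> complex" where
  "pc_amp d T s = of_real ((1 - s / T) powr (real d / 2)) * exp (\<i> * of_real (s / (1 - s / T)))"

text \<open>The transpose of the wave at time s applied to a test function: time now acts on a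
  smooth function of fixed type instead of on Q. The Jacobian turns the amplitude l^(-d/2) of the
  wave into l^(d/2), as in \<open>pc_amp\<close>.\<close>

definition pc_kernel :: "real \<Rightarrow> ('a::euclidean_space \<Rightarrow> complex) \<Rightarrow> real \<Rightarrow> 'a \<Rightarrow> complex" where
  "pc_kernel T w s = modulate (pc_amp DIM('a) T s) (- ((1 - s / T) / (4 * T))) (1 - s / T) w"

text \<open>The time derivative of the kernel. The three summands in front of w come from l^(d/2),
  from exp(i s/l), whose exponent has derivative i/l^2 because l + s/T = 1, and from the quadratic
  phase; the last term comes from the dilation inside w.\<close>

definition pc_kernel' :: "real \<Rightarrow> ('a::euclidean_space \<Rightarrow> complex) \<Rightarrow> real \<Rightarrow> 'a \<Rightarrow> complex" where
  "pc_kernel' T w s y = pc_amp DIM('a) T s * exp (\<i> * of_real (- ((1 - s / T) / (4 * T)) * (sq y))) *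
     ((of_real (- (DIM('a) / (2 * T * (1 - s / T)))) + \<i> * of_real (1 / (1 - s / T)^2) + \<i> * of_real (sq y / (4 * T^2))) * w ((1 - s / T) *\<^sub>R y)
      - of_real (1 / T) * (\<Sum>b\<in>Basis. of_real (y \<bullet> b) * pd b w ((1 - s / T) *\<^sub>R y)))"

lemma pc_kernel_has_derivative:
  fixes w :: "'a::euclidean_space \<Rightarrow> complex"
  assumes w: "smooth_fun w" and T: "0 < T" and s: "s < T"
  shows "((\<lambda>s. pc_kernel T w s y) has_vector_derivative pc_kernel' T w s y) (at s)"
proof -
  let ?d = "real DIM('a)"
  define l where "l = 1 - s / T"
  have l: "0 < l" using s T by (simp add: l_def)
  have dl: "((\<lambda>s. 1 - s / T) has_real_derivative - (1 / T)) (at s)"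
    using T by (auto intro!: derivative_eq_intros)
  have 1: "((\<lambda>s. complex_of_real ((1 - s / T) powr (?d / 2))) has_vector_derivative of_real (l powr (?d / 2) * (- (?d / (2 * T * l))))) (at s)"
  proof (rule bounded_linear.has_vector_derivative[OF bounded_linear_of_real])
    have "((\<lambda>s. (1 - s / T) powr (?d / 2)) has_real_derivative l powr (?d / 2) * (- (?d / (2 * T * l)))) (at s)"
    proof (rule DERIV_cong[OF DERIV_chain2[OF has_real_derivative_powr dl]])
      show "0 < 1 - s / T" using l by (simp only: l_def)
      show "?d / 2 * (1 - s / T) powr (?d / 2 - 1) * - (1 / T) = l powr (?d / 2) * (- (?d / (2 * T * l)))"
        unfolding l_def[symmetric] using l T by (simp add: powr_diff mult_ac)
    qed
    then show "((\<lambda>s. (1 - s / T) powr (?d / 2)) has_vector_derivative l powr (?d / 2) * (- (?d / (2 * T * l)))) (at s)"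
      by (simp add: has_real_derivative_iff_has_vector_derivative)
  qed
  have "((\<lambda>s. s / (1 - s / T)) has_real_derivative 1 / l^2) (at s)"
  proof (rule DERIV_cong[OF DERIV_divide[OF DERIV_ident dl]])
    show "1 - s / T \<noteq> 0" using l[unfolded l_def] by (rule less_imp_neq[THEN not_sym])
    have "l + s * (1 / T) = 1" by (simp add: l_def)
    then show "(1 * (1 - s / T) - s * - (1 / T)) / ((1 - s / T) * (1 - s / T)) = 1 / l\<^sup>2"
      unfolding l_def[symmetric] by (simp add: power2_eq_square)
  qed
  note 2 = has_vector_derivative_exp_i[OF this]
  have "((\<lambda>s. - ((1 - s / T) / (4 * T)) * (sq y)) has_real_derivative (sq y) / (4 * T^2)) (at s)"
    using T by (auto intro!: derivative_eq_intros simp: power2_eq_square)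
  note 3 = has_vector_derivative_exp_i[OF this]
  have 4: "((\<lambda>s. w ((1 - s / T) *\<^sub>R y)) has_vector_derivative - (of_real (1 / T) * (\<Sum>b\<in>Basis. of_real (y \<bullet> b) * pd b w (l *\<^sub>R y)))) (at s)"
  proof -
    have "((\<lambda>s. (1 - s / T) *\<^sub>R y) has_derivative (\<lambda>h. (- (1 / T) * h) *\<^sub>R y)) (at s)"
      by (rule has_derivative_scaleR_left) (rule dl[unfolded has_field_derivative_def])
    from has_derivative_compose[OF this smooth_has_derivative[OF w]]
    have "((\<lambda>s. w ((1 - s / T) *\<^sub>R y)) has_derivative (\<lambda>h. pd ((- (1 / T) * h) *\<^sub>R y) w (l *\<^sub>R y))) (at s)"
      by (simp add: l_def)
    moreover have "pd ((- (1 / T) * h) *\<^sub>R y) w (l *\<^sub>R y) = h *\<^sub>R (- (of_real (1 / T) * (\<Sum>b\<in>Basis. of_real (y \<bullet> b) * pd b w (l *\<^sub>R y))))" for h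
      unfolding pd_eq_sum[OF w, of "(- (1 / T) * h) *\<^sub>R y"]
      by (simp add: sum_distrib_left scaleR_conv_of_real mult_ac sum_negf)
    ultimately show ?thesis unfolding has_vector_derivative_def by simp
  qed
  show ?thesis
    unfolding pc_kernel_def modulate_def pc_amp_def pc_kernel'_def
    using has_vector_derivative_mult[OF has_vector_derivative_mult[OF has_vector_derivative_mult[OF 1 2] 3] 4]
    unfolding l_def[symmetric] by (simp add: algebra_simps)
qed

text \<open>Staying below T by \<delta> = (T - t)/2 keeps l at least \<delta>/T, so the supports of
  all kernels near time t lie in one ball; joint continuity on a compact set then bounds the
  derivative.\<close>

lemma pc_kernel'_bounded:
  fixes w :: "'a::euclidean_space \<Rightarrow> complex"
  assumes w: "test_fun w" and T: "0 < T" and t: "t < T"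
  obtains \<delta> B R where "0 < \<delta>" "\<And>s. \<bar>s - t\<bar> < \<delta> \<Longrightarrow> s < T"
    "\<And>s y. \<bar>s - t\<bar> < \<delta> \<Longrightarrow> norm (pc_kernel' T w s y) \<le> B * indicator (cball 0 R) y"
    "continuous_on UNIV (pc_kernel' T w t)"
proof -
  define \<delta> where "\<delta> = (T - t) / 2"
  have \<delta>: "0 < \<delta>" using t by (simp add: \<delta>_def)
  have sT: "s < T" if "\<bar>s - t\<bar> \<le> \<delta>" for s
    using abs_le_D1[OF that] t unfolding \<delta>_def by (simp add: field_simps)
  define m where "m = \<delta> / T"
  have m: "0 < m" using \<delta> T by (simp add: m_def)
  have lm: "m \<le> 1 - s / T" if "\<bar>s - t\<bar> \<le> \<delta>" for s
  proof -
    have "s \<le> T - \<delta>" using abs_le_D1[OF that] unfolding \<delta>_def by (simp add: field_simps)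
    then have "s / T \<le> (T - \<delta>) / T" using T by (intro divide_right_mono) auto
    then show ?thesis using T by (simp add: m_def diff_divide_distrib)
  qed
  obtain R0 where R0: "0 < R0" "\<And>x. R0 \<le> norm x \<Longrightarrow> w x = 0" using test_fun_support[OF w] by metis
  define R where "R = R0 / m"
  have zero: "pc_kernel' T w s y = 0" if "\<bar>s - t\<bar> \<le> \<delta>" "R < norm y" for s y
  proof -
    have "R0 = m * R" using m by (simp add: R_def)
    also have "\<dots> < m * norm y" using that m by simp
    also have "\<dots> \<le> (1 - s / T) * norm y" using lm[OF that(1)] by (intro mult_right_mono) auto
    also have "\<dots> = norm ((1 - s / T) *\<^sub>R y)" using lm[OF that(1)] m by simp
    finally have *: "R0 < norm ((1 - s / T) *\<^sub>R y)" .
    then have "w ((1 - s / T) *\<^sub>R y) = 0" "pd b w ((1 - s / T) *\<^sub>R y) = 0" for b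
      using R0(2) pd_zero_outside[of R0 w] by auto
    then show ?thesis by (simp add: pc_kernel'_def)
  qed
  have sm: "smooth_fun w" by (rule test_fun_smooth[OF w])
  let ?S = "{t - \<delta>..t + \<delta>} \<times> (UNIV :: 'a set)"
  have ne: "1 - fst p / T \<noteq> 0" "2 * T * (1 - fst p / T) \<noteq> 0" "0 < 1 - fst p / T" if "p \<in> ?S" for p
  proof -
    have "\<bar>fst p - t\<bar> \<le> \<delta>" using that by (auto simp: abs_le_iff)
    from lm[OF this] m have "0 < 1 - fst p / T" by linarith
    then show "1 - fst p / T \<noteq> 0" "2 * T * (1 - fst p / T) \<noteq> 0" "0 < 1 - fst p / T" using T by auto
  qed
  have c1: "continuous_on ?S (\<lambda>p. (1 - fst p / T) *\<^sub>R snd p)" using T by (intro continuous_intros) auto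
  have c2: "continuous_on ?S (\<lambda>p. w ((1 - fst p / T) *\<^sub>R snd p))"
    by (rule continuous_on_compose2[OF smooth_continuous[OF sm, of UNIV] c1]) auto
  have c3: "continuous_on ?S (\<lambda>p. pd b w ((1 - fst p / T) *\<^sub>R snd p))" for b
    by (rule continuous_on_compose2[OF smooth_continuous[OF smooth_pd[OF sm], of UNIV] c1]) auto
  have cont: "continuous_on ?S (\<lambda>p. pc_kernel' T w (fst p) (snd p))"
    unfolding pc_kernel'_def pc_amp_def
    by (intro continuous_intros c2 c3) (use ne T in \<open>auto simp: less_imp_le\<close>)
  have "compact ((\<lambda>p. pc_kernel' T w (fst p) (snd p)) ` ({t - \<delta>..t + \<delta>} \<times> cball 0 R))"
    by (rule compact_continuous_image[OF continuous_on_subset[OF cont]]) (auto intro: compact_Times)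
  then obtain B where B: "\<And>z. z \<in> (\<lambda>p. pc_kernel' T w (fst p) (snd p)) ` ({t - \<delta>..t + \<delta>} \<times> cball 0 R) \<Longrightarrow> norm z \<le> B"
    using compact_imp_bounded bounded_iff by metis
  show ?thesis
  proof (rule that[OF \<delta>])
    show "s < T" if "\<bar>s - t\<bar> < \<delta>" for s using sT that by simp
    show "norm (pc_kernel' T w s y) \<le> B * indicator (cball 0 R) y" if s: "\<bar>s - t\<bar> < \<delta>" for s y
    proof (cases "norm y \<le> R")
      case True
      have "(s, y) \<in> {t - \<delta>..t + \<delta>} \<times> cball 0 R" using s True by (auto simp: abs_less_iff)
      from B[OF imageI[OF this]] show ?thesis using True by simp
    next
      case False
      then show ?thesis using zero[of s y] s by simp
    qed
    have "continuous_on UNIV (\<lambda>y::'a. (\<lambda>p. pc_kernel' T w (fst p) (snd p)) (t, y))"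
      by (rule continuous_on_compose2[OF cont]) (use \<delta> in \<open>auto intro!: continuous_intros\<close>)
    then show "continuous_on UNIV (pc_kernel' T w t)" by simp
  qed
qed

text \<open>Pseudo-conformal invariance at the level of test functions: the time derivative and
  Laplacian of the wave become l^(-2) times the linear part, Laplacian minus identity, of the
  elliptic equation. The cross term of dilation and phase cancels the drift y . grad w, the squared
  gradient of the phase cancels its time derivative, the Laplacian of the phase cancels the
  derivative of the amplitude, and exp(i t/l) supplies the identity.\<close>

lemma pc_kernel_identity:
  fixes w :: "'a::euclidean_space \<Rightarrow> complex"
  assumes w: "smooth_fun w" and T: "0 < T" and t: "t < T"
  shows "\<i> * pc_kernel' T w t y + pc_kernel T (lap w) t y
    + of_real (1 / (1 - t / T)^2) * (pc_kernel T w t y - lap (pc_kernel T w t) y) = 0"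
proof -
  define l where "l = 1 - t / T"
  have l: "0 < l" using t T by (simp add: l_def)
  let ?E = "pc_amp DIM('a) T t * exp (\<i> * of_real (- (l / (4 * T)) * (sq y)))"
  let ?D = "\<Sum>b\<in>Basis. of_real (y \<bullet> b) * pd b w (l *\<^sub>R y)" and ?w = "w (l *\<^sub>R y)" and ?L = "lap w (l *\<^sub>R y)"
  let ?d = "real DIM('a)"
  have 1: "pc_kernel' T w t y = ?E * ((of_real (- (?d / (2 * T * l))) + \<i> * of_real (1 / l^2) + \<i> * of_real (sq y / (4 * T^2))) * ?w - of_real (1 / T) * ?D)"
    by (simp only: pc_kernel'_def l_def)
  have 2: "pc_kernel T (lap w) t y = ?E * ?L" "pc_kernel T w t y = ?E * ?w"
    by (simp_all only: pc_kernel_def modulate_def l_def)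
  have 3: "lap (pc_kernel T w t) y = ?E * (of_real (l^2) * ?L + 4 * \<i> * of_real (- (l / (4 * T)) * l) * ?D
    + (2 * \<i> * of_real (- (l / (4 * T)) * ?d) - 4 * of_real ((- (l / (4 * T)))^2 * (sq y))) * ?w)"
    unfolding pc_kernel_def lap_modulate[OF w] by (simp only: l_def)
  have z: "\<i> * ((of_real (- (?d / (2 * T * l))) + \<i> * of_real (1 / l^2) + \<i> * of_real (sq y / (4 * T^2))) * ?w - of_real (1 / T) * ?D) + ?L
    + of_real (1 / l^2) * (?w - (of_real (l^2) * ?L + 4 * \<i> * of_real (- (l / (4 * T)) * l) * ?D
    + (2 * \<i> * of_real (- (l / (4 * T)) * ?d) - 4 * of_real ((- (l / (4 * T)))^2 * (sq y))) * ?w)) = 0"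
  proof -
    have a1: "of_real (1 / l^2) * of_real (l^2) = (1::complex)" using l by (simp flip: of_real_mult)
    have a2: "of_real (1 / l^2) * (4 * \<i> * of_real (- (l / (4 * T)) * l)) = - (\<i> * of_real (1 / T))"
    proof -
      have "(1 / l^2) * (4 * (- (l / (4 * T)) * l)) = - (1 / T)" using l T by (simp add: field_simps power2_eq_square)
      then have "complex_of_real ((1 / l^2) * (4 * (- (l / (4 * T)) * l))) = of_real (- (1 / T))" by (rule arg_cong)
      then have "of_real (1 / l^2) * (4 * of_real (- (l / (4 * T)) * l)) = (of_real (- (1 / T)) :: complex)" by simp
      then have "\<i> * (of_real (1 / l^2) * (4 * of_real (- (l / (4 * T)) * l))) = \<i> * of_real (- (1 / T))" by (rule arg_cong)
      then show ?thesis by (simp add: mult_ac)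
    qed
    have a3: "of_real (1 / l^2) * (2 * \<i> * of_real (- (l / (4 * T)) * ?d)) = \<i> * of_real (- (?d / (2 * T * l)))"
    proof -
      have "(1 / l^2) * (2 * (- (l / (4 * T)) * ?d)) = - (?d / (2 * T * l))" using l T by (simp add: field_simps power2_eq_square)
      then have "complex_of_real ((1 / l^2) * (2 * (- (l / (4 * T)) * ?d))) = of_real (- (?d / (2 * T * l)))" by (rule arg_cong)
      then have "of_real (1 / l^2) * (2 * of_real (- (l / (4 * T)) * ?d)) = (of_real (- (?d / (2 * T * l))) :: complex)" by simp
      then have "\<i> * (of_real (1 / l^2) * (2 * of_real (- (l / (4 * T)) * ?d))) = \<i> * of_real (- (?d / (2 * T * l)))" by (rule arg_cong)
      then show ?thesis by (simp add: mult_ac)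
    qed
    have a4: "of_real (1 / l^2) * (4 * of_real ((- (l / (4 * T)))^2 * (sq y))) = (of_real (sq y / (4 * T^2)) :: complex)"
    proof -
      have "(1 / l^2) * (4 * ((- (l / (4 * T)))^2 * (sq y))) = sq y / (4 * T^2)" using l T by (simp add: field_simps power2_eq_square)
      then have "complex_of_real ((1 / l^2) * (4 * ((- (l / (4 * T)))^2 * (sq y)))) = of_real (sq y / (4 * T^2))" by (rule arg_cong)
      then show ?thesis by simp
    qed
    \<comment> \<open>The identity depends on the coefficients only through four products, so it is
      proved for abstract complex numbers and then instantiated with \<open>a1\<close> to
      \<open>a4\<close>.\<close>
    have gen: "\<i> * ((p + \<i> * k + \<i> * n) * u - m * v) + L + k * (u - (l2 * L + x2 * v + (x3 - x4) * u)) = 0"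
      if "k * l2 = 1" "k * x2 = - (\<i> * m)" "k * x3 = \<i> * p" "k * x4 = n" for p k n u m v L l2 x2 x3 x4 :: complex
    proof -
      have "k * (u - (l2 * L + x2 * v + (x3 - x4) * u)) = k * u - ((k * l2) * L + (k * x2) * v + (k * x3 - k * x4) * u)"
        by (simp add: algebra_simps)
      also have "\<dots> = k * u - (L - \<i> * m * v + (\<i> * p - n) * u)" unfolding that by simp
      finally show ?thesis by (simp add: algebra_simps)
    qed
    show ?thesis by (rule gen[OF a1 a2 a3 a4])
  qed
  have gen2: "\<i> * (E * A) + E * L + k * (E * u - E * M) = E * (\<i> * A + L + k * (u - M))" for E A L k u M :: complex
    by (simp add: algebra_simps)
  show ?thesis unfolding l_def[symmetric] 1 2 3 gen2 z by simp
qed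

lemma lap_L2:
  fixes w :: "'a::euclidean_space \<Rightarrow> complex"
  assumes "test_fun w" shows "lap w \<in> L2"
  unfolding lap_def[abs_def] by (intro L2_sum test_fun_L2 test_fun_pd assms)

lemma modulate_cmult: "c * modulate a \<alpha> r F x = modulate (c * a) \<alpha> r F x"
  by (simp add: modulate_def)

definition pc_wave_amp :: "nat \<Rightarrow> real \<Rightarrow> real \<Rightarrow> complex" where
  "pc_wave_amp d T t = of_real ((1 - t / T) powr (- (real d / 2))) * exp (\<i> * of_real (t / (1 - t / T)))"

definition pc_wave :: "real \<Rightarrow> ('a::euclidean_space \<Rightarrow> complex) \<Rightarrow> real \<Rightarrow> 'a \<Rightarrow> complex" where
  "pc_wave T Q t = modulate (pc_wave_amp DIM('a) T t) (- (1 / (4 * T * (1 - t / T)))) (1 / (1 - t / T)) Q"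

text \<open>The substitution y = x/l has Jacobian l^d, which turns the amplitude l^(-d/2) into
  l^(d/2). The lemma is stated for arbitrary measurable F because the nonlinear term uses it with
  |Q|^(4/d) Q in place of Q.\<close>

lemma pc_wave_pairing:
  fixes F w :: "'a::euclidean_space \<Rightarrow> complex"
  assumes F: "F \<in> borel_measurable lebesgue" and w: "w \<in> borel_measurable lebesgue" and T: "0 < T" and t: "t < T"
  shows "(LINT x|lebesgue. pc_wave T F t x * w x) = (LINT y|lebesgue. F y * pc_kernel T w t y)"
proof -
  let ?d = "real DIM('a)"
  define l where "l = 1 - t / T"
  have l: "0 < l" using t T by (simp add: l_def)
  have "(LINT x|lebesgue. pc_wave T F t x * w x) = of_real (1 / (1 / l) ^ DIM('a)) *
    (LINT y|lebesgue. F y * modulate (pc_wave_amp DIM('a) T t) (- (1 / (4 * T * l)) / (1 / l)^2) (1 / (1 / l)) w y)"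
    unfolding pc_wave_def l_def[symmetric] by (rule integral_modulate[OF F w]) (use l in simp)
  also have "- (1 / (4 * T * l)) / (1 / l)^2 = - (l / (4 * T))" using l T by (simp add: field_simps power2_eq_square)
  also have "1 / (1 / l) = l" by simp
  also have "of_real (1 / (1 / l) ^ DIM('a)) * (LINT y|lebesgue. F y * modulate (pc_wave_amp DIM('a) T t) (- (l / (4 * T))) l w y)
    = (LINT y|lebesgue. F y * (of_real (1 / (1 / l) ^ DIM('a)) * modulate (pc_wave_amp DIM('a) T t) (- (l / (4 * T))) l w y))"
    by (subst integral_mult_right_zero[symmetric]) (simp add: mult.left_commute)
  also have "(\<lambda>y. F y * (of_real (1 / (1 / l) ^ DIM('a)) * modulate (pc_wave_amp DIM('a) T t) (- (l / (4 * T))) l w y)) = (\<lambda>y. F y * pc_kernel T w t y)"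
  proof -
    have "1 / (1 / l) ^ DIM('a) = l powr ?d" using l by (simp add: powr_realpow power_one_over)
    moreover have "l powr ?d * l powr (- (?d / 2)) = l powr (?d / 2)" using l by (simp add: powr_add[symmetric])
    ultimately have "1 / (1 / l) ^ DIM('a) * l powr (- (?d / 2)) = l powr (?d / 2)" by simp
    then have "of_real (1 / (1 / l) ^ DIM('a)) * pc_wave_amp DIM('a) T t = pc_amp DIM('a) T t"
      unfolding pc_wave_amp_def pc_amp_def l_def[symmetric] mult.assoc[symmetric] of_real_mult[symmetric] by (simp only:)
    then show ?thesis unfolding modulate_cmult pc_kernel_def l_def[symmetric] by simp
  qed
  finally show ?thesis .
qed

section \<open>The wave of the profile: regularity, equation and blow-up\<close>

context elliptic_profile
begin

lemma coord_Q_L2: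
  assumes "b \<in> Basis" shows "(\<lambda>x. of_real (x \<bullet> b) * Q x) \<in> L2"
proof (rule L2_bound[OF norm_times_Q_L2, of _ 1])
  show "(\<lambda>x. of_real (x \<bullet> b) * Q x) \<in> borel_measurable lebesgue"
    using L2_measurable[OF Q_L2] by measurable
  show "AE x in lebesgue. norm (of_real (x \<bullet> b) * Q x) \<le> 1 * norm (of_real (norm x) * Q x)"
    using assms by (intro AE_I2) (auto simp: norm_mult intro!: mult_right_mono Basis_le_norm)
qed

text \<open>The weak gradient of a modulated profile with all scalars absorbed into the amplitudes.
  As a sum of two modulations it inherits norm formulas and continuity in the parameters.\<close>

definition grad :: "complex \<Rightarrow> real \<Rightarrow> real \<Rightarrow> 'a \<Rightarrow> 'a \<Rightarrow> complex" where
  "grad a \<alpha> r b x = modulate (of_real r * a) \<alpha> r (G b) x + modulate (2 * \<i> * of_real (\<alpha> / r) * a) \<alpha> r (\<lambda>y. of_real (y \<bullet> b) * Q y) x"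

lemma grad_L2: "0 < r \<Longrightarrow> b \<in> Basis \<Longrightarrow> grad a \<alpha> r b \<in> L2"
  unfolding grad_def[abs_def] by (intro L2_add modulate_L2 G_L2 coord_Q_L2)

lemma grad_weak: "0 < r \<Longrightarrow> b \<in> Basis \<Longrightarrow> weak_partial (modulate a \<alpha> r Q) b (grad a \<alpha> r b)"
  using weak_partial_modulate[OF Q_L2 G_L2 coord_Q_L2 G_weak, of b r a \<alpha>]
  unfolding grad_def[abs_def] modulate_cmult by simp

lemma modulate_H1: "0 < r \<Longrightarrow> modulate a \<alpha> r Q \<in> H1"
  unfolding H1_def using modulate_L2[OF Q_L2] grad_L2 grad_weak by blast

text \<open>Used twice: for the convergence of the initial data, where the phase tends to zero, and
  for the continuity of the wave in time.\<close>

lemma modulate_H1_tendsto: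
  assumes a: "a \<longlonglongrightarrow> a0" and \<alpha>: "\<alpha> \<longlonglongrightarrow> \<alpha>0" and r: "r \<longlonglongrightarrow> r0" and r0: "0 < r0" and rn: "\<And>n. 0 < r n"
  shows "(\<lambda>n. H1_dist (modulate (a n) (\<alpha> n) (r n) Q) (modulate a0 \<alpha>0 r0 Q)) \<longlonglongrightarrow> 0"
proof -
  have eq: "H1_dist (modulate (a n) (\<alpha> n) (r n) Q) (modulate a0 \<alpha>0 r0 Q)
    = sqrt (L2norm2 (\<lambda>x. modulate (a n) (\<alpha> n) (r n) Q x - modulate a0 \<alpha>0 r0 Q x)
      + (\<Sum>b\<in>Basis. L2norm2 (\<lambda>x. grad (a n) (\<alpha> n) (r n) b x - grad a0 \<alpha>0 r0 b x)))" for n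
    by (rule H1_dist_eq) (simp_all add: modulate_L2 Q_L2 rn r0 grad_L2 grad_weak)
  have g: "(\<lambda>n. L2norm2 (\<lambda>x. grad (a n) (\<alpha> n) (r n) b x - grad a0 \<alpha>0 r0 b x)) \<longlonglongrightarrow> 0" if b: "b \<in> Basis" for b
  proof -
    let ?A = "\<lambda>n x. modulate (of_real (r n) * a n) (\<alpha> n) (r n) (G b) x - modulate (of_real r0 * a0) \<alpha>0 r0 (G b) x"
    let ?B = "\<lambda>n x. modulate (2 * \<i> * of_real (\<alpha> n / r n) * a n) (\<alpha> n) (r n) (\<lambda>y. of_real (y \<bullet> b) * Q y) x
      - modulate (2 * \<i> * of_real (\<alpha>0 / r0) * a0) \<alpha>0 r0 (\<lambda>y. of_real (y \<bullet> b) * Q y) x"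
    have lim: "(\<lambda>n. 2 * L2norm2 (?A n) + 2 * L2norm2 (?B n)) \<longlonglongrightarrow> 2 * 0 + 2 * 0"
      using r0 by (intro tendsto_add tendsto_mult[OF tendsto_const] modulate_L2_tendsto G_L2 coord_Q_L2 b a \<alpha> r rn tendsto_intros) auto
    show ?thesis
    proof (rule tendsto_sandwich[OF _ _ tendsto_const])
      show "\<forall>\<^sub>F n in sequentially. 0 \<le> L2norm2 (\<lambda>x. grad (a n) (\<alpha> n) (r n) b x - grad a0 \<alpha>0 r0 b x)"
        by (simp add: L2norm2_nonneg)
      show "\<forall>\<^sub>F n in sequentially. L2norm2 (\<lambda>x. grad (a n) (\<alpha> n) (r n) b x - grad a0 \<alpha>0 r0 b x) \<le> 2 * L2norm2 (?A n) + 2 * L2norm2 (?B n)"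
      proof (rule eventuallyI)
        fix n
        have "(\<lambda>x. grad (a n) (\<alpha> n) (r n) b x - grad a0 \<alpha>0 r0 b x) = (\<lambda>x. ?A n x + ?B n x)"
          by (rule ext) (simp add: grad_def)
        moreover have "L2norm2 (\<lambda>x. ?A n x + ?B n x) \<le> 2 * L2norm2 (?A n) + 2 * L2norm2 (?B n)"
          by (intro L2norm2_add_le L2_diff modulate_L2 G_L2 coord_Q_L2 b rn r0)
        ultimately show "L2norm2 (\<lambda>x. grad (a n) (\<alpha> n) (r n) b x - grad a0 \<alpha>0 r0 b x) \<le> 2 * L2norm2 (?A n) + 2 * L2norm2 (?B n)"
          by (simp only:)
      qed
      show "(\<lambda>n. 2 * L2norm2 (?A n) + 2 * L2norm2 (?B n)) \<longlonglongrightarrow> 0" using lim by simp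
    qed
  qed
  have "(\<lambda>n. H1_dist (modulate (a n) (\<alpha> n) (r n) Q) (modulate a0 \<alpha>0 r0 Q)) \<longlonglongrightarrow> sqrt (0 + (\<Sum>b\<in>(Basis::'a set). 0))"
    unfolding eq by (intro tendsto_real_sqrt tendsto_add modulate_L2_tendsto tendsto_sum g Q_L2 a \<alpha> r r0 rn)
  then show ?thesis by simp
qed

text \<open>From |A|^2 <= 2 |A + B|^2 + 2 |B|^2 with A the dilated gradient and B the phase term.
  Along the wave the A part grows like l^(-2), whereas the B part stays constant in time, so the
  lower bound retains the growth.\<close>

lemma grad_norm2_modulate_ge:
  assumes r: "0 < r"
  shows "(norm a * r)^2 / (2 * r ^ DIM('a)) * (\<Sum>b\<in>Basis. L2norm2 (G b))
    - 4 * (\<alpha> / r)^2 * (norm a)^2 / r ^ DIM('a) * (\<Sum>b\<in>Basis. L2norm2 (\<lambda>x. of_real (x \<bullet> b) * Q x)) \<le> grad_norm2 (modulate a \<alpha> r Q)"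
proof -
  have "(norm a * r)^2 / (2 * r ^ DIM('a)) * L2norm2 (G b)
    - 4 * (\<alpha> / r)^2 * (norm a)^2 / r ^ DIM('a) * L2norm2 (\<lambda>x. of_real (x \<bullet> b) * Q x) \<le> L2norm2 (grad a \<alpha> r b)" if b: "b \<in> Basis" for b
  proof -
    let ?A = "modulate (of_real r * a) \<alpha> r (G b)" and ?B = "modulate (2 * \<i> * of_real (\<alpha> / r) * a) \<alpha> r (\<lambda>y. of_real (y \<bullet> b) * Q y)"
    have "L2norm2 ?A = L2norm2 (\<lambda>x. grad a \<alpha> r b x + (- 1) * ?B x)" by (simp add: grad_def)
    also have "\<dots> \<le> 2 * L2norm2 (grad a \<alpha> r b) + 2 * L2norm2 (\<lambda>x. (- 1) * ?B x)"
      by (intro L2norm2_add_le L2_cmult grad_L2 modulate_L2 coord_Q_L2 b r)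
    also have "L2norm2 (\<lambda>x. (- 1) * ?B x) = L2norm2 ?B" unfolding L2norm2_cmult by simp
    finally have le: "L2norm2 ?A / 2 - L2norm2 ?B \<le> L2norm2 (grad a \<alpha> r b)" by simp
    have nA: "L2norm2 ?A = (norm a * r)^2 / r ^ DIM('a) * L2norm2 (G b)"
      unfolding L2norm2_modulate[OF G_L2[OF b] r] using r by (simp add: norm_mult mult.commute)
    have nB: "L2norm2 ?B = 4 * (\<alpha> / r)^2 * (norm a)^2 / r ^ DIM('a) * L2norm2 (\<lambda>x. of_real (x \<bullet> b) * Q x)"
      unfolding L2norm2_modulate[OF coord_Q_L2[OF b] r] by (simp add: norm_mult norm_divide power_mult_distrib power_divide)
    show ?thesis using le unfolding nA nB by (simp add: field_simps)
  qed
  then have "(\<Sum>b\<in>Basis. (norm a * r)^2 / (2 * r ^ DIM('a)) * L2norm2 (G b)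
    - 4 * (\<alpha> / r)^2 * (norm a)^2 / r ^ DIM('a) * L2norm2 (\<lambda>x. of_real (x \<bullet> b) * Q x)) \<le> (\<Sum>b\<in>Basis. L2norm2 (grad a \<alpha> r b))"
    by (rule sum_mono)
  also have "\<dots> = grad_norm2 (modulate a \<alpha> r Q)"
    by (rule grad_norm2_eq[symmetric]) (use r in \<open>auto intro: grad_L2 grad_weak\<close>)
  finally show ?thesis by (simp add: sum_subtractf sum_distrib_left)
qed

text \<open>Every term is transposed to an integral of Q. The potential gains l^(-2) from the
  dilation, the nonlinearity gains l^(-2) from the amplitude since (d/2)(4/d) = 2, and
  \<open>pc_kernel_identity\<close> gives the linear terms the same factor. What remains is the
  elliptic equation tested with the kernel at time t.\<close>

lemma pc_wave_weak_equation:
  assumes T: "0 < T" and t: "t < T" and w: "test_fun_punct w"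
  shows "((\<lambda>s. LINT x|lebesgue. pc_wave T Q s x * w x) has_vector_derivative (LINT y|lebesgue. Q y * pc_kernel' T w t y)) (at t)" (is ?A)
    and "\<i> * (LINT y|lebesgue. Q y * pc_kernel' T w t y) + (LINT x|lebesgue. pc_wave T Q t x * lap w x)
        + of_real c * (LINT x|lebesgue. pc_wave T Q t x * w x / of_real ((norm x)^2))
        + (LINT x|lebesgue. of_real (norm (pc_wave T Q t x) powr (4 / real DIM('a))) * pc_wave T Q t x * w x) = 0" (is ?B)
proof -
  let ?d = "real DIM('a)"
  have tw: "test_fun w" using w by (simp add: test_fun_punct_def)
  have sw: "smooth_fun w" by (rule test_fun_smooth[OF tw])
  have Qm[measurable]: "Q \<in> borel_measurable lebesgue" by (rule L2_measurable[OF Q_L2])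
  have wm[measurable]: "w \<in> borel_measurable lebesgue" by (rule L2_measurable[OF test_fun_L2[OF tw]])
  have lm: "lap w \<in> borel_measurable lebesgue" by (rule L2_measurable[OF lap_L2[OF tw]])
  obtain \<delta> B R where \<delta>: "0 < \<delta>" "\<And>s. \<bar>s - t\<bar> < \<delta> \<Longrightarrow> s < T"
    and B: "\<And>s y. \<bar>s - t\<bar> < \<delta> \<Longrightarrow> norm (pc_kernel' T w s y) \<le> B * indicator (cball 0 R) y"
    and K'c: "continuous_on UNIV (pc_kernel' T w t)"
    using pc_kernel'_bounded[OF tw T t] by blast
  have pos: "0 < 1 - s / T" if "s < T" for s using that T by simp
  have KL: "pc_kernel T v s \<in> L2" if "s < T" "v \<in> L2" for s v
    unfolding pc_kernel_def by (rule modulate_L2[OF that(2) pos[OF that(1)]])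
  have D: "((\<lambda>s. LINT y|lebesgue. Q y * pc_kernel T w s y) has_vector_derivative (LINT y|lebesgue. Q y * pc_kernel' T w t y)) (at t)"
    by (rule has_vector_derivative_integral[OF Q_L2 \<delta>(1) pc_kernel_has_derivative[OF sw T] B KL measurable_lebesgue_continuous[OF K'c]])
      (use \<delta>(2) test_fun_L2[OF tw] in auto)
  show ?A
    by (rule has_vector_derivative_transform_within_open[OF D, of "{..<T}"])
      (use t pc_wave_pairing[OF Qm wm T] in auto)
  define l where "l = 1 - t / T"
  have l: "0 < l" using pos[OF t] by (simp add: l_def)
  let ?W = "pc_kernel T w t" and ?k = "complex_of_real (1 / l^2)"
  have Wp: "test_fun_punct ?W" unfolding pc_kernel_def by (rule test_fun_punct_modulate[OF w pos[OF t]])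
  then have Wt: "test_fun ?W" by (simp add: test_fun_punct_def)
  have E: "- (LINT x|lebesgue. Q x * lap ?W x) - of_real c * (LINT x|lebesgue. Q x * ?W x / of_real ((norm x)^2))
        + (LINT x|lebesgue. Q x * ?W x) = (LINT x|lebesgue. of_real (norm (Q x) powr (4 / ?d)) * Q x * ?W x)"
    using sol Wp unfolding elliptic_sol_def by blast
  have t2: "(LINT x|lebesgue. pc_wave T Q t x * lap w x) = (LINT y|lebesgue. Q y * pc_kernel T (lap w) t y)"
    by (rule pc_wave_pairing[OF Qm lm T t])
  have t3: "(LINT x|lebesgue. pc_wave T Q t x * w x / of_real ((norm x)^2)) = ?k * (LINT x|lebesgue. Q x * ?W x / of_real ((norm x)^2))"
  proof -
    have "(LINT x|lebesgue. pc_wave T Q t x * w x / of_real ((norm x)^2)) = (LINT x|lebesgue. pc_wave T Q t x * (w x / of_real ((norm x)^2)))"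
      by simp
    also have "\<dots> = (LINT y|lebesgue. Q y * pc_kernel T (\<lambda>x. w x / of_real ((norm x)^2)) t y)"
      by (rule pc_wave_pairing[OF Qm _ T t]) measurable
    also have "\<dots> = (LINT y|lebesgue. ?k * (Q y * ?W y / of_real ((norm y)^2)))"
      unfolding pc_kernel_def modulate_def l_def[symmetric]
      using l by (intro Bochner_Integration.integral_cong) (simp_all add: power_mult_distrib)
    finally show ?thesis by (simp only: integral_mult_right_zero)
  qed
  have t4: "(LINT x|lebesgue. of_real (norm (pc_wave T Q t x) powr (4 / ?d)) * pc_wave T Q t x * w x)
    = ?k * (LINT x|lebesgue. of_real (norm (Q x) powr (4 / ?d)) * Q x * ?W x)"
  proof -
    let ?N = "\<lambda>y. of_real (norm (Q y) powr (4 / ?d)) * Q y"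
    have "norm (pc_wave_amp DIM('a) T t) powr (4 / ?d) = 1 / l^2"
    proof -
      have "norm (pc_wave_amp DIM('a) T t) = l powr (- (?d / 2))"
        unfolding pc_wave_amp_def l_def[symmetric] by (simp add: norm_mult)
      moreover have "(l powr (- (?d / 2))) powr (4 / ?d) = l powr (- 2)" using dim by (simp add: powr_powr)
      moreover have "l powr (- 2) = 1 / l^2" using l by (simp add: powr_minus_divide)
      ultimately show ?thesis by simp
    qed
    then have "of_real (norm (pc_wave T Q t x) powr (4 / ?d)) * pc_wave T Q t x * w x = ?k * (pc_wave T ?N t x * w x)" for x
      unfolding pc_wave_def norm_modulate by (simp add: powr_mult modulate_def)
    then have "(LINT x|lebesgue. of_real (norm (pc_wave T Q t x) powr (4 / ?d)) * pc_wave T Q t x * w x) = ?k * (LINT x|lebesgue. pc_wave T ?N t x * w x)"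
      by simp
    also have "(LINT x|lebesgue. pc_wave T ?N t x * w x) = (LINT y|lebesgue. ?N y * ?W y)"
      by (rule pc_wave_pairing[OF _ wm T t]) measurable
    finally show ?thesis .
  qed
  have K'L: "pc_kernel' T w t \<in> L2"
  proof -
    have b: "norm (pc_kernel' T w t y) \<le> \<bar>B\<bar>" for y using B[of t y] \<delta>(1) by (cases "norm y \<le> R") auto
    have z: "pc_kernel' T w t y = 0" if "R < norm y" for y using B[of t y] \<delta>(1) that by simp
    show ?thesis by (rule L2_bounded_support[OF measurable_lebesgue_continuous[OF K'c] b z])
  qed
  have i: "integrable lebesgue (\<lambda>y. Q y * pc_kernel' T w t y)" "integrable lebesgue (\<lambda>y. Q y * pc_kernel T (lap w) t y)"
    "integrable lebesgue (\<lambda>y. Q y * ?W y)" "integrable lebesgue (\<lambda>y. Q y * lap ?W y)"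
    by (intro L2_mult_integrable Q_L2 K'L KL t lap_L2 tw Wt test_fun_L2)+
  have "\<i> * (LINT y|lebesgue. Q y * pc_kernel' T w t y) + (LINT y|lebesgue. Q y * pc_kernel T (lap w) t y)
      + ?k * ((LINT y|lebesgue. Q y * ?W y) - (LINT y|lebesgue. Q y * lap ?W y))
    = (LINT y|lebesgue. \<i> * (Q y * pc_kernel' T w t y) + Q y * pc_kernel T (lap w) t y + ?k * (Q y * ?W y - Q y * lap ?W y))"
    using i by simp
  also have "\<dots> = (LINT y|(lebesgue::'a measure). 0)"
  proof (intro Bochner_Integration.integral_cong refl)
    fix y
    have "\<i> * (Q y * pc_kernel' T w t y) + Q y * pc_kernel T (lap w) t y + ?k * (Q y * ?W y - Q y * lap ?W y)
      = Q y * (\<i> * pc_kernel' T w t y + pc_kernel T (lap w) t y + ?k * (?W y - lap ?W y))"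
      by (simp add: algebra_simps)
    also have "\<dots> = 0" using pc_kernel_identity[OF sw T t, of y] by (simp add: l_def)
    finally show "\<i> * (Q y * pc_kernel' T w t y) + Q y * pc_kernel T (lap w) t y + ?k * (Q y * ?W y - Q y * lap ?W y) = 0" .
  qed
  finally have Z: "\<i> * (LINT y|lebesgue. Q y * pc_kernel' T w t y) + (LINT y|lebesgue. Q y * pc_kernel T (lap w) t y)
      + ?k * ((LINT y|lebesgue. Q y * ?W y) - (LINT y|lebesgue. Q y * lap ?W y)) = 0" by simp
  have E': "(LINT y|lebesgue. Q y * ?W y) - (LINT y|lebesgue. Q y * lap ?W y)
    = of_real c * (LINT x|lebesgue. Q x * ?W x / of_real ((norm x)^2)) + (LINT x|lebesgue. of_real (norm (Q x) powr (4 / ?d)) * Q x * ?W x)"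
    using E by (simp add: algebra_simps)
  show ?B using Z unfolding E' t2 t3 t4 by (simp only: distrib_left mult.left_commute add.assoc)
qed

text \<open>Amplitude, phase and dilation depend continuously on t as long as 1 - t/T is positive,
  so continuity in H1 follows along sequences. At t = 0 only the quadratic phase survives.\<close>

lemma pc_wave_nls_solution:
  assumes T: "0 < T"
  shows "nls_solution c T (modulate 1 (- (1 / (4 * T))) 1 Q) (pc_wave T Q)"
  unfolding nls_solution_def
proof (intro conjI ballI allI impI)
  have pos: "0 < 1 / (1 - t / T)" if "t < T" for t using that T by simp
  show "0 < T" by (rule T)
  show "pc_wave T Q t \<in> H1" if "t \<in> {0..<T}" for t
    unfolding pc_wave_def by (rule modulate_H1) (use pos that in auto)
  show "AE x in lebesgue. pc_wave T Q 0 x = modulate 1 (- (1 / (4 * T))) 1 Q x"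
    by (simp add: pc_wave_def pc_wave_amp_def)
  show "((\<lambda>t. H1_dist (pc_wave T Q t) (pc_wave T Q t0)) \<longlongrightarrow> 0) (at t0 within {0..<T})" if t0: "t0 \<in> {0..<T}" for t0
    unfolding tendsto_at_iff_sequentially
  proof (intro allI impI)
    fix X :: "nat \<Rightarrow> real" assume X: "\<forall>i. X i \<in> {0..<T} - {t0}" and lim: "X \<longlonglongrightarrow> t0"
    have XT: "X n < T" for n using X by auto
    have l0: "0 < 1 - t0 / T" using t0 T by simp
    have L: "(\<lambda>n. 1 - X n / T) \<longlonglongrightarrow> 1 - t0 / T" using T by (intro tendsto_intros lim) auto
    have a: "(\<lambda>n. pc_wave_amp DIM('a) T (X n)) \<longlonglongrightarrow> pc_wave_amp DIM('a) T t0"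
      unfolding pc_wave_amp_def using l0 by (intro tendsto_intros lim L) auto
    have \<alpha>: "(\<lambda>n. - (1 / (4 * T * (1 - X n / T)))) \<longlonglongrightarrow> - (1 / (4 * T * (1 - t0 / T)))"
      using l0 T by (intro tendsto_intros L) auto
    have r: "(\<lambda>n. 1 / (1 - X n / T)) \<longlonglongrightarrow> 1 / (1 - t0 / T)" using l0 by (intro tendsto_intros L) auto
    show "((\<lambda>t. H1_dist (pc_wave T Q t) (pc_wave T Q t0)) \<circ> X) \<longlonglongrightarrow> 0"
      unfolding o_def pc_wave_def by (rule modulate_H1_tendsto[OF a \<alpha> r]) (use pos XT t0 in auto)
  qed
  fix w :: "'a \<Rightarrow> complex" and t assume "test_fun_punct w" "t \<in> {0<..<T}"
  then show "\<exists>D. ((\<lambda>s. LINT x|lebesgue. pc_wave T Q s x * w x) has_vector_derivative D) (at t) \<and>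
        \<i> * D + (LINT x|lebesgue. pc_wave T Q t x * lap w x)
        + of_real c * (LINT x|lebesgue. pc_wave T Q t x * w x / of_real ((norm x)^2))
        + (LINT x|lebesgue. of_real (norm (pc_wave T Q t x) powr (4 / real DIM('a))) * pc_wave T Q t x * w x) = 0"
    using pc_wave_weak_equation[OF T, of t w] by auto
qed

text \<open>The squared gradient norm is at least S/(2 l^2) - C/(4 T^2), with S the squared gradient
  norm of the profile and C its second moment. C is finite by the moment bound, S is positive by
  \<open>gradient_nonzero\<close>, and l tends to 0.\<close>

lemma pc_wave_blows_up:
  assumes T: "0 < T"
  shows "filterlim (\<lambda>t. grad_norm2 (pc_wave T Q t)) at_top (at_left T)"
proof -
  define S where "S = (\<Sum>b\<in>Basis. L2norm2 (G b))"
  define C where "C = (\<Sum>b\<in>Basis. L2norm2 (\<lambda>x. of_real (x \<bullet> b) * Q x))"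
  have S: "0 < S" unfolding S_def by (rule gradient_nonzero)
  have ge: "S / 2 * (1 / (1 - t / T)^2) - C / (4 * T^2) \<le> grad_norm2 (pc_wave T Q t)" if "t < T" for t
  proof -
    define l where "l = 1 - t / T"
    have l: "0 < l" using that T by (simp add: l_def)
    have na: "(norm (pc_wave_amp DIM('a) T t))^2 = 1 / l ^ DIM('a)"
    proof -
      have "(norm (pc_wave_amp DIM('a) T t))^2 = (l powr (- (DIM('a) / 2)))^2"
        unfolding pc_wave_amp_def l_def[symmetric] by (simp add: norm_mult)
      also have "\<dots> = l powr (- DIM('a))" by (simp add: power2_eq_square powr_add[symmetric])
      finally show ?thesis using l by (simp add: powr_minus_divide powr_realpow)
    qed
    have "S / 2 * (1 / l^2) - C / (4 * T^2)
      = (norm (pc_wave_amp DIM('a) T t) * (1 / l))^2 / (2 * (1 / l) ^ DIM('a)) * S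
        - 4 * (- (1 / (4 * T * l)) / (1 / l))^2 * (norm (pc_wave_amp DIM('a) T t))^2 / (1 / l) ^ DIM('a) * C"
      unfolding power_mult_distrib[of "norm _"] na using l T by (simp add: power_one_over field_simps power2_eq_square)
    also have "\<dots> \<le> grad_norm2 (pc_wave T Q t)"
      unfolding pc_wave_def S_def C_def l_def[symmetric] by (rule grad_norm2_modulate_ge) (use l in simp)
    finally show ?thesis by (simp only: l_def)
  qed
  have lim: "filterlim (\<lambda>t. S / 2 * (1 / (1 - t / T)^2) - C / (4 * T^2)) at_top (at_left T)"
  proof -
    have "((\<lambda>t. (1 - t / T)^2) \<longlongrightarrow> (1 - T / T)^2) (at_left T)" using T by (intro tendsto_intros) auto
    then have "((\<lambda>t. (1 - t / T)^2) \<longlongrightarrow> 0) (at_left T)" using T by simp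
    moreover have "\<forall>\<^sub>F t in at_left T. 0 < (1 - t / T)^2"
      using T by (intro eventually_at_leftI[of 0 T]) auto
    ultimately have "filterlim (\<lambda>t. inverse ((1 - t / T)^2)) at_top (at_left T)"
      by (intro filterlim_inverse_at_top)
    then have "filterlim (\<lambda>t. S / 2 * inverse ((1 - t / T)^2)) at_top (at_left T)"
      using S by (intro filterlim_tendsto_pos_mult_at_top[OF tendsto_const]) auto
    then have "filterlim (\<lambda>t. - (C / (4 * T^2)) + S / 2 * inverse ((1 - t / T)^2)) at_top (at_left T)"
      by (rule filterlim_tendsto_add_at_top[OF tendsto_const])
    moreover have "(\<lambda>t. - (C / (4 * T^2)) + S / 2 * inverse ((1 - t / T)^2)) = (\<lambda>t. S / 2 * (1 / (1 - t / T)^2) - C / (4 * T^2))"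
      by (rule ext) (simp add: inverse_eq_divide)
    ultimately show ?thesis by (simp only:)
  qed
  show ?thesis
    by (rule filterlim_at_top_mono[OF lim]) (use ge in \<open>auto intro!: eventually_at_leftI[of "T - 1" T]\<close>)
qed

lemma instability:
  "\<exists>u0 :: nat \<Rightarrow> 'a \<Rightarrow> complex. (\<forall>n. u0 n \<in> H1) \<and> (\<lambda>n. H1_dist (u0 n) Q) \<longlonglongrightarrow> 0 \<and> (\<forall>n. blows_up c (u0 n))"
proof -
  \<comment> \<open>The n-th datum blows up at time n + 1; the shift keeps that time
    positive.\<close>
  let ?u = "\<lambda>n::nat. modulate 1 (- (1 / (4 * real (Suc n)))) 1 Q"
  have \<alpha>: "(\<lambda>n. - (1 / (4 * real (Suc n)))) \<longlonglongrightarrow> 0" by real_asymp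
  have "(\<lambda>n. H1_dist (?u n) (modulate 1 0 1 Q)) \<longlonglongrightarrow> 0"
    by (rule modulate_H1_tendsto[OF tendsto_const \<alpha> tendsto_const]) auto
  moreover have "modulate 1 0 1 Q = Q" by (rule ext) (simp add: modulate_def)
  moreover have "blows_up c (?u n)" for n
    unfolding blows_up_def using pc_wave_nls_solution[of "real (Suc n)"] pc_wave_blows_up[of "real (Suc n)"] by fastforce
  ultimately show ?thesis using modulate_H1 by (intro exI[of _ ?u]) auto
qed

end

lemma elliptic_profile_instability:
  fixes Q :: "'a::euclidean_space \<Rightarrow> complex"
  assumes "3 \<le> DIM('a)" "Q \<in> H1" "positive_fun Q" "radial Q" "elliptic_sol c Q"
  shows "\<exists>u0 :: nat \<Rightarrow> 'a \<Rightarrow> complex. (\<forall>n. u0 n \<in> H1) \<and> (\<lambda>n. H1_dist (u0 n) Q) \<longlonglongrightarrow> 0 \<and> (\<forall>n. blows_up c (u0 n))"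
proof -
  have "\<forall>b\<in>Basis. \<exists>g. g \<in> L2 \<and> weak_partial Q b g" using assms(2) by (auto simp: H1_def)
  then obtain G where G: "\<forall>b\<in>Basis. G b \<in> L2 \<and> weak_partial Q b (G b)" by metis
  interpret elliptic_profile Q G c
    by unfold_locales (use assms G in \<open>auto simp: H1_def\<close>)
  show ?thesis by (rule instability)
qed

theorem theorem1p4:
  assumes "DIM('a::euclidean_space) \<ge> 3"
  shows "(\<forall>c (Q :: 'a \<Rightarrow> complex). 0 < c \<and> c < lam DIM('a) \<and> Q \<in> ground_states c \<longrightarrow>
            (\<exists>u0 :: nat \<Rightarrow> 'a \<Rightarrow> complex. (\<forall>n. u0 n \<in> H1) \<and>
               (\<lambda>n. H1_dist (u0 n) Q) \<longlonglongrightarrow> 0 \<and> (\<forall>n. blows_up c (u0 n))))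
       \<and> (\<forall>c (Q :: 'a \<Rightarrow> complex). c < 0 \<and> Q \<in> rad_ground_states c \<longrightarrow>
            (\<exists>u0 :: nat \<Rightarrow> 'a \<Rightarrow> complex. (\<forall>n. u0 n \<in> H1) \<and>
               (\<lambda>n. H1_dist (u0 n) Q) \<longlonglongrightarrow> 0 \<and> (\<forall>n. blows_up c (u0 n))))"
  using elliptic_profile_instability[OF assms] unfolding ground_states_def rad_ground_states_def by blast

end
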